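(* Let $A$ be a unital associative $\mathbf{k}$-algebra such that $\mathbf{k}\to A$ is a $\mathbf{k}$-split injection, where $\mathbf{k}$ is a unital commutative $\mathbb{Q}$-algebra. The Tsygan map $\mathsf{E}:\overline{\Omega}\to\overline{\mathrm{DR}}_t^{\wedge}$ has the properties: $$\text{(i)}\ \ \tfrac{d}{dt}\circ\mathsf{E}=\mathsf{E};\qquad\text{(ii)}\ \ \mathsf{E}\circ\mathsf{B}=\mathsf{d}\circ\mathsf{E};\qquad\text{(iii)}\ \ \mathsf{E}\circ\mathsf{b}=\mathsf{i}_t\circ\mathsf{E}.$$
   Context: $\mathbf{k}$ is a unital commutative $\mathbb{Q}$-algebra, $\otimes=\otimes_{\mathbf{k}}$, $\overline{A}=A/\mathbf{k}$. Noncommutative differential forms: $\Omega=\Omega A$ is the dg algebra generated by $A$ (degree $0$) and symbols $\mathsf{d}a$ (degree $1$), $\mathbf{k}$-linear in $a\in\overline{A}$, with relations: products of elements of $A$ are as in $A$ (same unit), and $\mathsf{d}(ab)=\mathsf{d}a\,b+a\,\mathsf{d}b$; the differential is $a\mapsto \mathsf{d}a\mapsto 0$. One has $A\otimes\overline{A}^{\otimes n}\cong\Omega^nA$ via $a_0\otimes\cdots\otimes a_n\mapsto a_0\,\mathsf{d}a_1\cdots \mathsf{d}a_n$. Commutators are supercommutators. $\overline{\Omega}=\Omega/\mathbf{k}$. Operators on $\overline{\Omega}$: $\mathsf{b}(\alpha\,\mathsf{d}a)=(-1)^{n-1}[\alpha,a]$ for $\alpha\in\Omega^{n-1}A$, $a\in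 A$, $\mathsf{b}|_{\Omega^0}=0$; $\kappa(\alpha\,\mathsf{d}a)=(-1)^{|\alpha|}\mathsf{d}a\,\alpha$ on forms of degree $\ge1$; $\mathsf{B}|_{\overline{\Omega}^n}=(\mathrm{Id}+\kappa+\cdots+\kappa^n)\mathsf{d}$. Extended forms: $\Omega_t=\Omega A*_{\mathbf{k}}\mathbf{k}[t]$ (free product of algebras), bigraded as $\Omega_t^{p,q}$ with $p$ the de Rham degree and $q$ the degree in $t$ ($t$ is even of de Rham degree $0$). $\mathrm{DR}_t=\Omega_t/[\Omega_t,\Omega_t]$ (supercommutators), with induced bigrading; $f_\natural$ is the image of $f\in\Omega_t$. Reduced versions: $\overline{\Omega}_t=\Omega_t/\mathbf{k}[t]$, $\overline{\mathrm{DR}}_t=\mathrm{DR}_t/\mathbf{k}[t]$ (quotient by the image of $\mathbf k[t]$). On $\Omega_t$ there are: the superderivation $\mathsf{d}$ extending $\mathsf{d}$ on $\Omega$ with $\mathsf{d}t=0$; the derivation $\frac{d}{dt}$ killing $\Omega$ with $t\mapsto1$; the superderivation $\mathbf{i}_t$ with $t\mapsto0$, $a\mapsto0$, $\mathsf{d}a\mapsto[a,t]$ for $a\in A$. They descend to $\mathrm{DR}_t$ and $\overline{\mathrm{DR}}_t$; the map induced by $\mathbf{i}_t$ is denoted $\mathsf{i}_t$. $\overline{\mathrm{DR}}_t^{\wedge}$, with $(\overline{\mathrm{DR}}_t^{\wedge})^\bullet=\prod_{q\ge0}\overline{\mathrm{DR}}_t^{\bullet,q}$, is the $t$-adic completion,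 to which these operators extend. The Tsygan map is the $\mathbf{k}$-linear map $\mathsf{E}:\overline{\Omega}\to\overline{\mathrm{DR}}_t^{\wedge}$, $$\mathsf{E}(a_0\,\mathsf{d}a_1\cdots\mathsf{d}a_n)=\sum_{k_0,\ldots,k_n\ge0}\frac{1}{(k_0+\cdots+k_n+n)!}\,(a_0t^{k_0}\,\mathsf{d}a_1\,t^{k_1}\cdots\mathsf{d}a_n\,t^{k_n})_\natural .$$ *)

theory Defs
  imports Complex_Main "HOL-Library.Poly_Mapping" "HOL-Library.Set_Algebras" "HOL-Library.FuncSet"
begin

subsection \<open>Free algebras\<close>

text \<open>
  The free monoid is written additively, so that the product of \<open>Poly_Mapping\<close> (convolution)
  turns \<open>'g fmonoid \<Rightarrow>\<^sub>0 'k\<close> into the free associative unital \<open>'k\<close>-algebra on \<open>'g\<close>.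
\<close>

datatype 'g fmonoid = Word (letters: "'g list")

instantiation fmonoid :: (type) monoid_add
begin
definition "0 = Word []"
definition "u + v = Word (letters u @ letters v)"
instance
  by standard (simp_all add: zero_fmonoid_def plus_fmonoid_def)
end

type_synonym ('g, 'k) falg = "'g fmonoid \<Rightarrow>\<^sub>0 'k"

definition var :: "'g \<Rightarrow> ('g, 'k::comm_ring_1) falg" where
  "var g = Poly_Mapping.single (Word [g]) 1"

definition const :: "'k::comm_ring_1 \<Rightarrow> ('g, 'k) falg" where
  "const c = Poly_Mapping.single 0 c"

definition scl :: "'k::comm_ring_1 \<Rightarrow> ('g, 'k) falg \<Rightarrow> ('g, 'k) falg" where
  "scl c x = const c * x"

definition lspan :: "('g, 'k::comm_ring_1) falg set \<Rightarrow> ('g, 'k) falg set" where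
  "lspan S = module.span scl S"

definition wdeg :: "('g \<Rightarrow> nat) \<Rightarrow> 'g fmonoid \<Rightarrow> nat" where
  "wdeg \<delta> w = sum_list (map \<delta> (letters w))"

definition homog :: "('g \<Rightarrow> nat) \<Rightarrow> nat \<Rightarrow> ('g, 'k::comm_ring_1) falg set" where
  "homog \<delta> n = {x. \<forall>w\<in>Poly_Mapping.keys x. wdeg \<delta> w = n}"

text \<open>
  The \<open>'k\<close>-linear map \<open>D\<close> with \<open>D (var g) = D0 g\<close> and \<open>D (g w) = D g w + \<sigma> g g D w\<close> for
  a generator \<open>g\<close>: a derivation for \<open>\<sigma> = 1\<close>, an odd superderivation for
  \<open>\<sigma> g = (-1)^\<bar>g\<bar>\<close>.
\<close>

fun derw :: "('g \<Rightarrow> ('g, 'k::comm_ring_1) falg) \<Rightarrow> ('g \<Rightarrow> ('g, 'k) falg) \<Rightarrow> 'g list \<Rightarrow> ('g, 'k) falg" where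
  "derw \<sigma> D0 [] = 0"
| "derw \<sigma> D0 (g # gs) = D0 g * Poly_Mapping.single (Word gs) 1 + \<sigma> g * var g * derw \<sigma> D0 gs"

definition der :: "('g \<Rightarrow> ('g, 'k::comm_ring_1) falg) \<Rightarrow> ('g \<Rightarrow> ('g, 'k) falg) \<Rightarrow> ('g, 'k) falg \<Rightarrow> ('g, 'k) falg" where
  "der \<sigma> D0 x = (\<Sum>w\<in>Poly_Mapping.keys x. scl (Poly_Mapping.lookup x w) (derw \<sigma> D0 (letters w)))"


subsection \<open>Quotient modules\<close>

text \<open>
  For a submodule \<open>N\<close>, the elements of the quotient by \<open>N\<close> are the cosets \<open>x +o N\<close>; the zero
  element is \<open>N\<close>.  Addition of cosets is the addition of sets of \<open>Set_Algebras\<close>.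
  \<open>qmap M f\<close> is the map on cosets induced by a map \<open>f\<close> of representatives, with values in the
  quotient by \<open>M\<close>.
\<close>

definition quo :: "('g, 'k::comm_ring_1) falg set \<Rightarrow> ('g, 'k) falg set set" where
  "quo N = range (\<lambda>x. x +o N)"

definition qmap :: "('h, 'k::comm_ring_1) falg set \<Rightarrow> (('g, 'k) falg \<Rightarrow> ('h, 'k) falg)
    \<Rightarrow> ('g, 'k) falg set \<Rightarrow> ('h, 'k) falg set" where
  "qmap M f X = (\<Union>x\<in>X. f x +o M)"

text \<open>\<open>f\<close> is \<open>'k\<close>-linear on the submodule \<open>Q\<close> of the quotient by \<open>N\<close>, with values in the quotient by \<open>M\<close>.\<close>

definition klinear :: "('g, 'k::comm_ring_1) falg set set \<Rightarrow> ('g, 'k) falg set \<Rightarrow> ('h, 'k) falg set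
    \<Rightarrow> (('g, 'k) falg set \<Rightarrow> ('h, 'k) falg set) \<Rightarrow> bool" where
  "klinear Q N M f \<longleftrightarrow>
     f ` Q \<subseteq> quo M \<and>
     (\<forall>X\<in>Q. \<forall>Y\<in>Q. f (X + Y) = f X + f Y) \<and>
     (\<forall>c. \<forall>X\<in>Q. f (qmap N (scl c) X) = qmap M (scl c) (f X))"


subsection \<open>Ground ring and algebra\<close>

text \<open>
  \<open>\<rho>\<close> is the \<open>\<rat>\<close>-algebra structure of \<open>'k\<close>, and \<open>\<iota>\<close> the structure map of the
  \<open>'k\<close>-algebra \<open>'a\<close>, which is required to have a \<open>'k\<close>-linear retraction.
\<close>

locale split_algebra =
  fixes \<rho> :: "rat \<Rightarrow> 'k::comm_ring_1" and \<iota> :: "'k \<Rightarrow> 'a::ring_1"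
  assumes \<rho>_one: "\<rho> 1 = 1"
    and \<rho>_add: "\<rho> (r + s) = \<rho> r + \<rho> s"
    and \<rho>_mult: "\<rho> (r * s) = \<rho> r * \<rho> s"
    and \<iota>_one: "\<iota> 1 = 1"
    and \<iota>_add: "\<iota> (c + d) = \<iota> c + \<iota> d"
    and \<iota>_mult: "\<iota> (c * d) = \<iota> c * \<iota> d"
    and \<iota>_central: "\<iota> c * a = a * \<iota> c"
    and \<iota>_split: "\<exists>\<pi>. module_hom (\<lambda>c a. \<iota> c * a) (*) \<pi> \<and> (\<forall>c. \<pi> (\<iota> c) = c)"


subsection \<open>Noncommutative differential forms\<close>

text \<open>
  The defining relations of \<open>\<Omega>\<close>, for symbols \<open>el a\<close> (standing for \<open>a\<close>) and \<open>df a\<close>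
  (standing for \<open>\<d>a\<close>) in a free algebra.  That \<open>df\<close> vanishes on the image of \<open>\<iota>\<close> says that
  \<open>\<d>a\<close> only depends on the class of \<open>a\<close> modulo \<open>'k\<close>.
\<close>

definition form_rels :: "('k::comm_ring_1 \<Rightarrow> 'a::ring_1) \<Rightarrow> ('a \<Rightarrow> ('g, 'k) falg) \<Rightarrow> ('a \<Rightarrow> ('g, 'k) falg)
    \<Rightarrow> ('g, 'k) falg set" where
  "form_rels \<iota> el df =
     {el (a + b) - (el a + el b) | a b. True} \<union>
     {el (\<iota> c * a) - scl c (el a) | c a. True} \<union>
     {el (a * b) - el a * el b | a b. True} \<union>
     {el 1 - 1} \<union>
     {df (a + b) - (df a + df b) | a b. True} \<union>
     {df (\<iota> c * a) - scl c (df a) | c a. True} \<union>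
     {df (\<iota> c) | c. True} \<union>
     {df (a * b) - (df a * el b + el a * df b) | a b. True}"

definition two_sided :: "('g, 'k::comm_ring_1) falg set \<Rightarrow> ('g, 'k) falg set" where
  "two_sided R = {u * r * v | u r v. r \<in> R}"

datatype 'a gen = El 'a | Df 'a

fun gdeg :: "'a gen \<Rightarrow> nat" where
  "gdeg (El a) = 0"
| "gdeg (Df a) = 1"

abbreviation el :: "'a \<Rightarrow> ('a gen, 'k::comm_ring_1) falg" where "el a \<equiv> var (El a)"
abbreviation df :: "'a \<Rightarrow> ('a gen, 'k::comm_ring_1) falg" where "df a \<equiv> var (Df a)"

text \<open>
  \<open>\<Omega>\<close> is the quotient of the free algebra by the ideal spanned by \<open>two_sided (form_rels \<iota> el df)\<close>;
  its quotient by \<open>'k\<close> is the quotient of the free algebra by \<open>Omega_null \<iota>\<close>.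
\<close>

definition Omega_null :: "('k::comm_ring_1 \<Rightarrow> 'a::ring_1) \<Rightarrow> ('a gen, 'k) falg set" where
  "Omega_null \<iota> = lspan (two_sided (form_rels \<iota> el df) \<union> range const)"

definition Omega_bar :: "('k::comm_ring_1 \<Rightarrow> 'a::ring_1) \<Rightarrow> ('a gen, 'k) falg set set" where
  "Omega_bar \<iota> = quo (Omega_null \<iota>)"

definition Omega_pos :: "('k::comm_ring_1 \<Rightarrow> 'a::ring_1) \<Rightarrow> ('a gen, 'k) falg set set" where
  "Omega_pos \<iota> = {x +o Omega_null \<iota> | x. \<forall>w\<in>Poly_Mapping.keys x. wdeg gdeg w \<ge> 1}"

definition d_form :: "('a gen, 'k::comm_ring_1) falg \<Rightarrow> ('a gen, 'k) falg" where
  "d_form = der (\<lambda>g. (-1) ^ gdeg g) (case_gen df (\<lambda>a. 0))"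

definition d_bar :: "('k::comm_ring_1 \<Rightarrow> 'a::ring_1) \<Rightarrow> ('a gen, 'k) falg set \<Rightarrow> ('a gen, 'k) falg set" where
  "d_bar \<iota> = qmap (Omega_null \<iota>) d_form"

text \<open>
  \<open>b\<close>, \<open>\<kappa>\<close> and \<open>B\<close> are determined by linearity and their prescribed values; extensionality
  only fixes the junk values outside the quotient module.  In the formula for \<open>b\<close>, \<open>a\<close> has
  degree 0, so the supercommutator of \<open>\<alpha>\<close> and \<open>a\<close> is the ordinary one.
\<close>

definition b_bar :: "('k::comm_ring_1 \<Rightarrow> 'a::ring_1) \<Rightarrow> ('a gen, 'k) falg set \<Rightarrow> ('a gen, 'k) falg set" where
  "b_bar \<iota> = (THE b. b \<in> extensional (Omega_bar \<iota>) \<and>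
     klinear (Omega_bar \<iota>) (Omega_null \<iota>) (Omega_null \<iota>) b \<and>
     (\<forall>x\<in>homog gdeg 0. b (x +o Omega_null \<iota>) = Omega_null \<iota>) \<and>
     (\<forall>p. \<forall>\<alpha>\<in>homog gdeg p. \<forall>a.
        b (\<alpha> * df a +o Omega_null \<iota>) = (-1) ^ p * (\<alpha> * el a - el a * \<alpha>) +o Omega_null \<iota>))"

definition kappa :: "('k::comm_ring_1 \<Rightarrow> 'a::ring_1) \<Rightarrow> ('a gen, 'k) falg set \<Rightarrow> ('a gen, 'k) falg set" where
  "kappa \<iota> = (THE \<kappa>. \<kappa> \<in> extensional (Omega_pos \<iota>) \<and>
     klinear (Omega_pos \<iota>) (Omega_null \<iota>) (Omega_null \<iota>) \<kappa> \<and>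
     (\<forall>p. \<forall>\<alpha>\<in>homog gdeg p. \<forall>a.
        \<kappa> (\<alpha> * df a +o Omega_null \<iota>) = (-1) ^ p * (df a * \<alpha>) +o Omega_null \<iota>))"

definition B_bar :: "('k::comm_ring_1 \<Rightarrow> 'a::ring_1) \<Rightarrow> ('a gen, 'k) falg set \<Rightarrow> ('a gen, 'k) falg set" where
  "B_bar \<iota> = (THE B. B \<in> extensional (Omega_bar \<iota>) \<and>
     klinear (Omega_bar \<iota>) (Omega_null \<iota>) (Omega_null \<iota>) B \<and>
     (\<forall>n. \<forall>x\<in>homog gdeg n.
        B (x +o Omega_null \<iota>) = (\<Sum>i\<le>n. (kappa \<iota> ^^ i) (d_bar \<iota> (x +o Omega_null \<iota>)))))"


subsection \<open>Extended forms\<close>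

text \<open>
  The free product of \<open>\<Omega>\<close> with the polynomial algebra in \<open>t\<close>: the relations of \<open>\<Omega>\<close> are kept
  and one generator is added, subject to no relation.
\<close>

datatype 'a tgen = Frm "'a gen" | Tv

fun fdeg :: "'a tgen \<Rightarrow> nat" where
  "fdeg (Frm g) = gdeg g"
| "fdeg Tv = 0"

fun tdeg :: "'a tgen \<Rightarrow> nat" where
  "tdeg (Frm g) = 0"
| "tdeg Tv = 1"

abbreviation elt :: "'a \<Rightarrow> ('a tgen, 'k::comm_ring_1) falg" where "elt a \<equiv> var (Frm (El a))"
abbreviation dft :: "'a \<Rightarrow> ('a tgen, 'k::comm_ring_1) falg" where "dft a \<equiv> var (Frm (Df a))"
abbreviation tvar :: "('a tgen, 'k::comm_ring_1) falg" where "tvar \<equiv> var Tv"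

definition supercommutators :: "('a tgen, 'k::comm_ring_1) falg set" where
  "supercommutators =
     {x * y - (-1) ^ (p * q) * (y * x) | x y p q. x \<in> homog fdeg p \<and> y \<in> homog fdeg q}"

text \<open>
  \<open>DR_null \<iota>\<close> is the kernel of the surjection from the free algebra onto the reduced
  \<open>DR\<^sub>t\<close>: modulo the first set of generators one obtains \<open>\<Omega>\<^sub>t\<close>, modulo the first two \<open>DR\<^sub>t\<close>.
\<close>

definition DR_null :: "('k::comm_ring_1 \<Rightarrow> 'a::ring_1) \<Rightarrow> ('a tgen, 'k) falg set" where
  "DR_null \<iota> = lspan (two_sided (form_rels \<iota> elt dft) \<union> supercommutators \<union> range (\<lambda>n. tvar ^ n))"

definition DR_bar :: "('k::comm_ring_1 \<Rightarrow> 'a::ring_1) \<Rightarrow> nat \<Rightarrow> nat \<Rightarrow> ('a tgen, 'k) falg set set" where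
  "DR_bar \<iota> p q = {x +o DR_null \<iota> | x. x \<in> homog fdeg p \<inter> homog tdeg q}"

text \<open>
  An element of the \<open>t\<close>-adic completion is the family of its components in bidegrees \<open>(p, q)\<close>:
  direct sum over the de Rham degree \<open>p\<close>, direct product over the degree \<open>q\<close> in \<open>t\<close>.
\<close>

definition DR_hat :: "('k::comm_ring_1 \<Rightarrow> 'a::ring_1) \<Rightarrow> (nat \<Rightarrow> nat \<Rightarrow> ('a tgen, 'k) falg set) set" where
  "DR_hat \<iota> = {x. (\<forall>p q. x p q \<in> DR_bar \<iota> p q) \<and> finite {p. \<exists>q. x p q \<noteq> DR_null \<iota>}}"

definition dt_form :: "('a tgen, 'k::comm_ring_1) falg \<Rightarrow> ('a tgen, 'k) falg" where
  "dt_form = der (\<lambda>g. (-1) ^ fdeg g) (case_tgen (case_gen dft (\<lambda>a. 0)) 0)"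

definition ddt_form :: "('a tgen, 'k::comm_ring_1) falg \<Rightarrow> ('a tgen, 'k) falg" where
  "ddt_form = der (\<lambda>g. 1) (case_tgen (\<lambda>g. 0) 1)"

definition it_form :: "('a tgen, 'k::comm_ring_1) falg \<Rightarrow> ('a tgen, 'k) falg" where
  "it_form = der (\<lambda>g. (-1) ^ fdeg g)
     (case_tgen (case_gen (\<lambda>a. 0) (\<lambda>a. elt a * tvar - tvar * elt a)) 0)"

text \<open>
  The induced operators on the completion.  They have bidegrees \<open>(1, 0)\<close>, \<open>(0, -1)\<close> and
  \<open>(-1, 1)\<close>.
\<close>

definition d_hat :: "('k::comm_ring_1 \<Rightarrow> 'a::ring_1) \<Rightarrow> (nat \<Rightarrow> nat \<Rightarrow> ('a tgen, 'k) falg set)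
    \<Rightarrow> nat \<Rightarrow> nat \<Rightarrow> ('a tgen, 'k) falg set" where
  "d_hat \<iota> x p q = (case p of 0 \<Rightarrow> DR_null \<iota> | Suc p' \<Rightarrow> qmap (DR_null \<iota>) dt_form (x p' q))"

definition ddt_hat :: "('k::comm_ring_1 \<Rightarrow> 'a::ring_1) \<Rightarrow> (nat \<Rightarrow> nat \<Rightarrow> ('a tgen, 'k) falg set)
    \<Rightarrow> nat \<Rightarrow> nat \<Rightarrow> ('a tgen, 'k) falg set" where
  "ddt_hat \<iota> x p q = qmap (DR_null \<iota>) ddt_form (x p (Suc q))"

definition it_hat :: "('k::comm_ring_1 \<Rightarrow> 'a::ring_1) \<Rightarrow> (nat \<Rightarrow> nat \<Rightarrow> ('a tgen, 'k) falg set)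
    \<Rightarrow> nat \<Rightarrow> nat \<Rightarrow> ('a tgen, 'k) falg set" where
  "it_hat \<iota> x p q = (case q of 0 \<Rightarrow> DR_null \<iota> | Suc q' \<Rightarrow> qmap (DR_null \<iota>) it_form (x (Suc p) q'))"


subsection \<open>The Tsygan map\<close>

text \<open>For \<open>as = [a\<^sub>1, \<dots>, a\<^sub>n]\<close> and \<open>ks = [k\<^sub>0, \<dots>, k\<^sub>n]\<close>: \<open>a\<^sub>0 t^k\<^sub>0 \<d>a\<^sub>1 t^k\<^sub>1 \<dots> \<d>a\<^sub>n t^k\<^sub>n\<close>.\<close>

definition tsygan_term :: "'a \<Rightarrow> 'a list \<Rightarrow> nat list \<Rightarrow> ('a tgen, 'k::comm_ring_1) falg" where
  "tsygan_term a0 as ks =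
     elt a0 * tvar ^ hd ks * prod_list (map2 (\<lambda>a k. dft a * tvar ^ k) as (tl ks))"

text \<open>
  The summand of index \<open>k\<^sub>0, \<dots>, k\<^sub>n\<close> has bidegree \<open>(n, k\<^sub>0 + \<dots> + k\<^sub>n)\<close>, so the component of
  the infinite sum in bidegree \<open>(n, q)\<close> is the finite sum over \<open>k\<^sub>0 + \<dots> + k\<^sub>n = q\<close>.
\<close>

definition tsygan_value :: "(rat \<Rightarrow> 'k::comm_ring_1) \<Rightarrow> ('k \<Rightarrow> 'a::ring_1) \<Rightarrow> 'a \<Rightarrow> 'a list
    \<Rightarrow> nat \<Rightarrow> nat \<Rightarrow> ('a tgen, 'k) falg set" where
  "tsygan_value \<rho> \<iota> a0 as p q =
     (if p = length as
      then (\<Sum>ks | length ks = Suc (length as) \<and> sum_list ks = q.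
              scl (\<rho> (1 / fact (sum_list ks + length as))) (tsygan_term a0 as ks)) +o DR_null \<iota>
      else DR_null \<iota>)"

definition tsygan :: "(rat \<Rightarrow> 'k::comm_ring_1) \<Rightarrow> ('k \<Rightarrow> 'a::ring_1) \<Rightarrow> ('a gen, 'k) falg set
    \<Rightarrow> nat \<Rightarrow> nat \<Rightarrow> ('a tgen, 'k) falg set" where
  "tsygan \<rho> \<iota> = (THE E. E \<in> extensional (Omega_bar \<iota>) \<and>
     E ` Omega_bar \<iota> \<subseteq> DR_hat \<iota> \<and>
     (\<forall>p q. klinear (Omega_bar \<iota>) (Omega_null \<iota>) (DR_null \<iota>) (\<lambda>\<omega>. E \<omega> p q)) \<and>
     (\<forall>a0 as. E (el a0 * prod_list (map df as) +o Omega_null \<iota>) = tsygan_value \<rho> \<iota> a0 as))"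

end

theory Submission
  imports Defs
begin

text \<open>
  Normal forms \<open>a\<^sub>0 \<d>a\<^sub>1 \<dots> \<d>a\<^sub>n\<close> span \<open>\<Omega>\<close>, and every family of maps that is multilinear and
  normalized in the \<open>a\<^sub>i\<close> extends to \<open>\<Omega>\<close>; so \<open>b\<close>, \<open>\<kappa>\<close>, \<open>B\<close> and the Tsygan map exist, are unique,
  and the identities only have to be checked on normal forms.  Let \<open>T\<^sub>q\<close> be the sum of all
  \<open>a\<^sub>0 t^k\<^sub>0 \<d>a\<^sub>1 \<dots> \<d>a\<^sub>n t^k\<^sub>n\<close> with \<open>k\<^sub>0 + \<dots> + k\<^sub>n = q\<close>, so that the component of bidegree \<open>(n, q)\<close> of the
  Tsygan map is \<open>T\<^sub>q / (q + n)!\<close>.  It satisfies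
  \<open>T\<^sub>q\<^sub>+\<^sub>1(\<alpha> \<d>a) = T\<^sub>q(\<alpha> \<d>a) t + T\<^sub>q\<^sub>+\<^sub>1(\<alpha>) \<d>a\<close>.  By induction along this recursion, \<open>d/dt\<close> sends \<open>T\<^sub>q\<^sub>+\<^sub>1\<close> to
  \<open>(q + n + 1) T\<^sub>q\<close>, and \<open>i\<^sub>t\<close> sends \<open>T\<^sub>q(\<alpha> \<d>a)\<close> to \<open>\<plusminus>(T\<^sub>q\<^sub>+\<^sub>1(\<alpha> a) - T\<^sub>q\<^sub>+\<^sub>1(\<alpha>) a)\<close>, which modulo commutators
  is \<open>T\<^sub>q\<^sub>+\<^sub>1\<close> of \<open>b(\<alpha> \<d>a) = \<plusminus>[\<alpha>, a]\<close>.  For \<open>B\<close>, each of the \<open>n + 1\<close> cyclic rotations contributes the word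
  \<open>\<d>a\<^sub>0 t^l\<^sub>0 \<dots> \<d>a\<^sub>n t^l\<^sub>n\<close> with multiplicity \<open>l\<^sub>j + 1\<close> for a different \<open>j\<close>, and these add up to \<open>q + n + 1\<close>.
\<close>

section \<open>Linear maps and submodules of free algebras\<close>

text \<open>The factorial is forced by the degrees. Both d/dt and B meet the multiplicity q + n + 1,
  which 1 / (q + n + 1)! turns into 1 / (q + n)!, while b and i_t trade one differential for one t
  and leave q + n unchanged. Hence (iii) comes from an identity with integral coefficients between
  the unnormalized sums, and (i) and (ii) each need a single division (\<open>scl_fact_Suc\<close>).
  The other obstacle is that E, b, kappa and B are definite descriptions on cosets: each must first
  be realized by a linear map on a free algebra that respects the null submodules (the lemmas ending
  in \<open>_coset\<close>). After that everything is a congruence in a free algebra. Congruences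
  are kept modulo \<open>ideal_t\<close> where possible, because it is stable under multiplication;
  \<open>DR_null\<close> is only a submodule, and congruences modulo it are merely added and
  scaled.\<close>

lemma poly_mapping_single_induct [case_names zero add single]:
  assumes "P 0" "\<And>x y. P x \<Longrightarrow> P y \<Longrightarrow> P (x + y)" "\<And>a b. P (Poly_Mapping.single a b)"
  shows "P (x :: 'a \<Rightarrow>\<^sub>0 'b::comm_monoid_add)"
proof (induction x rule: update_induct)
  case const
  then show ?case by (simp add: assms)
next
  case (update f a b)
  then have "Poly_Mapping.update a b f = f + Poly_Mapping.single a b"
    by (intro poly_mapping_eqI) (auto simp: lookup_update lookup_add lookup_single when_def in_keys_iff)
  then show ?case
    using update assms by simp
qed

lemma single_0_commute:
  fixes c :: "'k::comm_ring_1" and x :: "('g, 'k) falg"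
  shows "Poly_Mapping.single 0 c * x = x * Poly_Mapping.single 0 c"
  by (induction x rule: poly_mapping_single_induct) (simp_all add: mult_single mult.commute algebra_simps)

lemma scl_mult_left: "scl c x * y = scl c (x * y)"
  by (simp add: scl_def mult.assoc)

lemma scl_mult_right: "x * scl c y = scl c (x * y)"
  unfolding scl_def const_def by (metis single_0_commute mult.assoc)

interpretation falg: module "scl :: 'k::comm_ring_1 \<Rightarrow> ('g, 'k) falg \<Rightarrow> ('g, 'k) falg"
proof
  fix a b :: 'k and x y :: "('g, 'k) falg"
  show "scl a (x + y) = scl a x + scl a y" "scl (a + b) x = scl a x + scl b x"
    by (simp_all add: scl_def const_def algebra_simps single_add)
  show "scl a (scl b x) = scl (a * b) x"
    by (simp add: scl_def const_def mult_single flip: mult.assoc)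
  show "scl 1 x = x"
    by (simp add: scl_def const_def)
qed

abbreviation lmap :: "(('g, 'k::comm_ring_1) falg \<Rightarrow> ('h, 'k) falg) \<Rightarrow> bool" where
  "lmap \<equiv> module_hom scl scl"

lemma lmapI:
  assumes "\<And>x y. f (x + y) = f x + f y" "\<And>c x. f (scl c x) = scl c (f x)"
  shows "lmap f"
  by unfold_locales (auto simp: assms)

lemmas lmap_add = module_hom.add[of scl scl]
  and lmap_scl = module_hom.scale[of scl scl]
  and lmap_zero = module_hom.zero[of scl scl]
  and lmap_neg = module_hom.neg[of scl scl]
  and lmap_diff = module_hom.diff[of scl scl]
  and lmap_sum = module_hom.sum[of scl scl]

lemma lmap_ident: "lmap (\<lambda>x. x)"
  and lmap_0: "lmap (\<lambda>x. 0)"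
  and lmap_mult_left: "lmap (\<lambda>x. u * x)"
  and lmap_mult_right: "lmap (\<lambda>x. x * u)"
  and lmap_scale: "lmap (\<lambda>x. scl c x)"
  by (rule lmapI; simp add: algebra_simps falg.scale_right_distrib scl_mult_left scl_mult_right mult.commute)+

lemma lmap_compose: "lmap f \<Longrightarrow> lmap g \<Longrightarrow> lmap (\<lambda>x. f (g x))"
  by (rule lmapI) (simp_all add: lmap_add lmap_scl)

lemma lmap_plus: "lmap f \<Longrightarrow> lmap g \<Longrightarrow> lmap (\<lambda>x. f x + g x)"
  and lmap_minus: "lmap f \<Longrightarrow> lmap g \<Longrightarrow> lmap (\<lambda>x. f x - g x)"
  by (rule lmapI; simp add: lmap_add lmap_scl falg.scale_right_distrib falg.scale_right_diff_distrib)+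

lemma lmap_summation: "(\<And>i. i \<in> I \<Longrightarrow> lmap (f i)) \<Longrightarrow> lmap (\<lambda>x. \<Sum>i\<in>I. f i x)"
  by (rule lmapI) (auto simp: lmap_add lmap_scl falg.scale_sum_right simp flip: sum.distrib intro!: sum.cong)

lemma lmap_funpow:
  fixes f :: "('g, 'k::comm_ring_1) falg \<Rightarrow> ('g, 'k) falg"
  shows "lmap f \<Longrightarrow> lmap (f ^^ n)"
proof (induction n)
  case 0
  then show ?case using lmap_ident by (simp add: funpow.simps(1) id_def)
next
  case (Suc n)
  then show ?case using lmap_compose[of f "f ^^ n"] by (simp add: o_def)
qed

text \<open>Signs and multiplicities occur as elements of the free algebra. Read as scalars they
  pass through linear maps and submodules, which need not be stable under multiplication.\<close>

lemma scl_of_nat: "scl (of_nat n) x = of_nat n * x"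
  by (induction n) (simp_all add: falg.scale_left_distrib algebra_simps)

lemma scl_minus_one_power: "scl ((- 1) ^ n) x = (- 1) ^ n * x"
  by (cases "even n") (simp_all add: falg.scale_minus_left)

lemma subspace_sign: "falg.subspace N \<Longrightarrow> x \<in> N \<Longrightarrow> (- 1) ^ n * x \<in> N"
  by (metis scl_minus_one_power falg.subspace_scale)

abbreviation mon :: "'g list \<Rightarrow> ('g, 'k::comm_ring_1) falg" where
  "mon u \<equiv> Poly_Mapping.single (Word u) 1"

lemma mon_Nil: "mon [] = 1"
  by (metis zero_fmonoid_def single_one)

lemma mon_append: "mon (u @ v) = mon u * mon v"
  by (simp add: mult_single plus_fmonoid_def)

lemma mon_Cons: "mon (g # v) = var g * mon v"
  by (simp add: mult_single plus_fmonoid_def var_def)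

lemma single_eq_scl_mon: "Poly_Mapping.single w c = scl c (mon (letters w))"
  by (simp add: scl_def const_def mult_single)

lemma falg_expand: "x = (\<Sum>w\<in>Poly_Mapping.keys x. scl (Poly_Mapping.lookup x w) (mon (letters w)))"
proof (rule poly_mapping_eqI)
  fix v
  have "Poly_Mapping.lookup (\<Sum>w\<in>Poly_Mapping.keys x. scl (Poly_Mapping.lookup x w) (mon (letters w))) v
      = (\<Sum>w\<in>Poly_Mapping.keys x. if w = v then Poly_Mapping.lookup x w else 0)"
    unfolding lookup_sum by (rule sum.cong) (auto simp only: single_eq_scl_mon[symmetric] lookup_single when_def)
  also have "\<dots> = Poly_Mapping.lookup x v"
    by (simp add: in_keys_iff)
  finally show "Poly_Mapping.lookup x v = Poly_Mapping.lookup
      (\<Sum>w\<in>Poly_Mapping.keys x. scl (Poly_Mapping.lookup x w) (mon (letters w))) v" ..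
qed

lemma falg_induct [case_names zero add scl mon]:
  assumes "P 0" "\<And>x y. P x \<Longrightarrow> P y \<Longrightarrow> P (x + y)" "\<And>c x. P x \<Longrightarrow> P (scl c x)" "\<And>w. P (mon w)"
  shows "P (x :: ('g, 'k::comm_ring_1) falg)"
proof (induction x rule: poly_mapping_single_induct)
  case (single a b)
  then show ?case
    using assms(3,4) single_eq_scl_mon[of a b] by metis
qed (use assms in auto)

lemma in_span_mon: "x \<in> falg.span {mon (letters w) | w. w \<in> Poly_Mapping.keys x}"
proof -
  have "(\<Sum>w\<in>Poly_Mapping.keys x. scl (Poly_Mapping.lookup x w) (mon (letters w)))
      \<in> falg.span {mon (letters w) | w. w \<in> Poly_Mapping.keys x}"
    by (intro falg.span_sum falg.span_scale falg.span_base) auto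
  then show ?thesis
    by (subst falg_expand)
qed

text \<open>Applied to a difference of two linear maps, this reduces a congruence between them to a
  spanning set; most identities below are obtained in this way.\<close>

lemma lmap_in_span:
  assumes "lmap f" "falg.subspace N" "\<And>s. s \<in> S \<Longrightarrow> f s \<in> N" "x \<in> falg.span S"
  shows "f x \<in> N"
  using assms(4)
proof (induction rule: falg.span_induct_alt)
  case base
  then show ?case using assms by (simp add: lmap_zero falg.subspace_0)
next
  case (step c x y)
  then show ?case using assms by (simp add: lmap_add lmap_scl falg.subspace_add falg.subspace_scale)
qed

text \<open>Common form of \<open>der\<close> and of \<open>form_act\<close> below, so that
  linearity is proved once.\<close>

definition lin :: "('g list \<Rightarrow> ('h, 'k::comm_ring_1) falg) \<Rightarrow> ('g, 'k) falg \<Rightarrow> ('h, 'k) falg" where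
  "lin f x = (\<Sum>w\<in>Poly_Mapping.keys x. scl (Poly_Mapping.lookup x w) (f (letters w)))"

lemma lin_superset:
  assumes "finite S" "Poly_Mapping.keys x \<subseteq> S"
  shows "lin f x = (\<Sum>w\<in>S. scl (Poly_Mapping.lookup x w) (f (letters w)))"
  unfolding lin_def using assms
  by (intro sum.mono_neutral_left) (auto simp: not_in_keys_iff_lookup_eq_zero)

lemma lmap_lin:
  fixes f :: "'g list \<Rightarrow> ('h, 'k::comm_ring_1) falg"
  shows "lmap (lin f)"
proof (rule lmapI)
  fix x y :: "('g, 'k) falg"
  let ?S = "Poly_Mapping.keys x \<union> Poly_Mapping.keys y"
  have "lin f (x + y) = (\<Sum>w\<in>?S. scl (Poly_Mapping.lookup (x + y) w) (f (letters w)))"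
    by (rule lin_superset) (auto dest: keys_add[THEN subsetD])
  also have "\<dots> = lin f x + lin f y"
    by (simp add: lin_superset[of ?S] lookup_add falg.scale_left_distrib sum.distrib)
  finally show "lin f (x + y) = lin f x + lin f y" .
next
  fix c :: 'k and x :: "('g, 'k) falg"
  have lk: "Poly_Mapping.lookup (scl c x) w = c * Poly_Mapping.lookup x w" for w
    unfolding scl_def const_def mult_map_scale_conv_mult[symmetric]
    by (simp add: map.rep_eq when_def)
  then have "Poly_Mapping.keys (scl c x) \<subseteq> Poly_Mapping.keys x"
    by (auto simp: in_keys_iff)
  then have "lin f (scl c x) = (\<Sum>w\<in>Poly_Mapping.keys x. scl (Poly_Mapping.lookup (scl c x) w) (f (letters w)))"
    by (intro lin_superset) auto
  then show "lin f (scl c x) = scl c (lin f x)"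
    by (simp add: lk lin_def falg.scale_sum_right)
qed

lemma lin_mon: "lin f (mon w) = f w"
  by (simp add: lin_def)

lemma der_eq_lin: "der \<sigma> D0 = lin (derw \<sigma> D0)"
  by (simp add: fun_eq_iff der_def lin_def)

lemma lmap_der: "lmap (der \<sigma> D0)"
  by (simp add: der_eq_lin lmap_lin)

lemma der_mon: "der \<sigma> D0 (mon w) = derw \<sigma> D0 w"
  by (simp add: der_eq_lin lin_mon)

lemma der_var: "der \<sigma> D0 (var g) = D0 g"
  using der_mon[of \<sigma> D0 "[g]"] by (simp add: mon_Cons mon_Nil)

lemma der_1: "der \<sigma> D0 1 = 0"
  using der_mon[of \<sigma> D0 "[]"] by (simp add: mon_Nil)

section \<open>Gradings and superderivations\<close>

lemma wdeg_Word: "wdeg \<delta> (Word u) = sum_list (map \<delta> u)"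
  by (simp add: wdeg_def)

lemma wdeg_plus: "wdeg \<delta> (u + v) = wdeg \<delta> u + wdeg \<delta> v"
  by (simp add: wdeg_def plus_fmonoid_def)

text \<open>Turning the support condition into a span lets claims about homogeneous elements be
  reduced to words by \<open>lmap_in_span\<close>.\<close>

lemma homog_eq_span: "homog \<delta> n = falg.span {mon u | u. sum_list (map \<delta> u) = n}"
proof (intro equalityI subsetI)
  fix x :: "('a, 'b) falg" assume "x \<in> homog \<delta> n"
  then have "{mon (letters w) | w. w \<in> Poly_Mapping.keys x} \<subseteq> {mon u | u. sum_list (map \<delta> u) = n}"
    by (fastforce simp: homog_def wdeg_def)
  then show "x \<in> falg.span {mon u | u. sum_list (map \<delta> u) = n}"
    using in_span_mon[of x] falg.span_mono by blast
next
  fix x :: "('a, 'b) falg" assume "x \<in> falg.span {mon u | u. sum_list (map \<delta> u) = n}"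
  moreover have "falg.subspace (homog \<delta> n :: ('a, 'b) falg set)"
  proof (rule falg.subspaceI)
    show "0 \<in> (homog \<delta> n :: ('a, 'b) falg set)"
      by (simp add: homog_def)
    show "x + y \<in> homog \<delta> n" if "x \<in> homog \<delta> n" "y \<in> homog \<delta> n" for x y :: "('a, 'b) falg"
      using that keys_add[of x y] by (auto simp: homog_def)
    show "scl c x \<in> homog \<delta> n" if "x \<in> homog \<delta> n" for c and x :: "('a, 'b) falg"
      using that keys_mult[of "const c" x]
      by (fastforce simp: homog_def scl_def const_def split: if_splits)
  qed
  moreover have "{mon u | u. sum_list (map \<delta> u) = n} \<subseteq> (homog \<delta> n :: ('a, 'b) falg set)"
    by (auto simp: homog_def wdeg_Word)
  ultimately show "x \<in> homog \<delta> n"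
    using falg.span_minimal by blast
qed

lemma subspace_homog: "falg.subspace (homog \<delta> n)"
  by (simp add: homog_eq_span)

lemma homog_mon: "sum_list (map \<delta> u) = n \<Longrightarrow> mon u \<in> homog \<delta> n"
  by (auto simp: homog_def wdeg_Word)

lemma homog_var: "\<delta> g = n \<Longrightarrow> var g \<in> homog \<delta> n"
  using homog_mon[of \<delta> "[g]" n] by (simp add: mon_Cons mon_Nil)

lemma homog_1: "1 \<in> homog \<delta> 0"
  using homog_mon[of \<delta> "[]" 0] by (simp add: mon_Nil)

lemma homog_mult: "x \<in> homog \<delta> p \<Longrightarrow> y \<in> homog \<delta> q \<Longrightarrow> x * y \<in> homog \<delta> (p + q)"
  using keys_mult[of x y] by (auto simp: homog_def wdeg_plus)

lemma homog_power: "x \<in> homog \<delta> p \<Longrightarrow> x ^ n \<in> homog \<delta> (n * p)"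
  by (induction n) (auto simp: homog_1 intro!: homog_mult)

text \<open>The recursion of \<open>derw\<close> is the Leibniz rule for a left factor of one
  letter; associativity extends it to words by induction on \<open>u\<close>.\<close>

lemma der_mult_mon:
  "der (\<lambda>g. (- 1) ^ \<delta> g) D (mon u * y) = der (\<lambda>g. (- 1) ^ \<delta> g) D (mon u) * y
    + (- 1) ^ sum_list (map \<delta> u) * (mon u * der (\<lambda>g. (- 1) ^ \<delta> g) D y)"
proof (induction y rule: falg_induct)
  case (mon v)
  show ?case
  proof (induction u)
    case Nil
    then show ?case by (simp add: mon_Nil der_1)
  next
    case (Cons g u)
    have "der (\<lambda>g. (- 1) ^ \<delta> g) D (mon (g # u) * mon v) = derw (\<lambda>g. (- 1) ^ \<delta> g) D (g # (u @ v))"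
      by (simp only: der_mon mon_append[symmetric] append_Cons)
    also have "\<dots> = D g * mon u * mon v
        + (- 1) ^ \<delta> g * var g * der (\<lambda>g. (- 1) ^ \<delta> g) D (mon u * mon v)"
      by (simp add: der_mon mon_append mult.assoc flip: mon_append)
    also have "(- 1) ^ \<delta> g * var g * der (\<lambda>g. (- 1) ^ \<delta> g) D (mon u * mon v)
       = (- 1) ^ \<delta> g * var g * derw (\<lambda>g. (- 1) ^ \<delta> g) D u * mon v
       + (- 1) ^ (\<delta> g + sum_list (map \<delta> u)) * (var g * mon u * der (\<lambda>g. (- 1) ^ \<delta> g) D (mon v))"
      unfolding Cons
      \<comment> \<open>The ring is noncommutative, so signs are eliminated by parity instead of
        being moved past other factors.\<close>
      by (cases "even (\<delta> g)"; cases "even (sum_list (map \<delta> u))") (simp_all add: algebra_simps der_mon)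
    finally have "der (\<lambda>g. (- 1) ^ \<delta> g) D (mon (g # u) * mon v) =
        (D g * mon u + (- 1) ^ \<delta> g * var g * derw (\<lambda>g. (- 1) ^ \<delta> g) D u) * mon v
        + (- 1) ^ (\<delta> g + sum_list (map \<delta> u)) * (mon (g # u) * der (\<lambda>g. (- 1) ^ \<delta> g) D (mon v))"
      by (simp only: distrib_right mon_Cons add.assoc)
    moreover have "der (\<lambda>g. (- 1) ^ \<delta> g) D (mon (g # u)) = D g * mon u + (- 1) ^ \<delta> g * var g * derw (\<lambda>g. (- 1) ^ \<delta> g) D u"
      by (simp only: der_mon derw.simps)
    ultimately show ?case
      by (simp only: list.map sum_list.Cons)
  qed
qed (simp_all add: lmap_zero[OF lmap_der] lmap_add[OF lmap_der] lmap_scl[OF lmap_der] algebra_simps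
      scl_mult_right falg.scale_right_distrib)

lemma der_mult:
  assumes "x \<in> homog \<delta> p"
  shows "der (\<lambda>g. (- 1) ^ \<delta> g) D (x * y) = der (\<lambda>g. (- 1) ^ \<delta> g) D x * y
    + (- 1) ^ p * (x * der (\<lambda>g. (- 1) ^ \<delta> g) D y)"
  using assms unfolding homog_eq_span
proof (induction rule: falg.span_induct_alt)
  case base
  then show ?case by (simp add: lmap_zero[OF lmap_der])
next
  case (step c x x')
  then show ?case
    by (auto simp: lmap_add[OF lmap_der] lmap_scl[OF lmap_der] der_mult_mon distrib_right distrib_left
        scl_mult_left scl_mult_right falg.scale_right_distrib)
qed

lemma derw_homog:
  assumes "\<And>g. \<sigma> g \<in> homog \<delta> 0" "\<And>g. D g \<in> homog \<delta> (\<delta> g + k)"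
  shows "derw \<sigma> D u \<in> homog \<delta> (sum_list (map \<delta> u) + k)"
proof (induction u)
  case Nil
  then show ?case by (simp add: falg.subspace_0 subspace_homog)
next
  case (Cons g u)
  have "D g * mon u \<in> homog \<delta> ((\<delta> g + k) + sum_list (map \<delta> u))"
    by (intro homog_mult assms homog_mon refl)
  moreover have "\<sigma> g * var g * derw \<sigma> D u \<in> homog \<delta> (0 + \<delta> g + (sum_list (map \<delta> u) + k))"
    by (intro homog_mult Cons.IH homog_var assms refl)
  ultimately show ?case
    by (auto simp: algebra_simps intro!: falg.subspace_add subspace_homog)
qed

lemma der_homog_raise:
  assumes "\<And>g. \<sigma> g \<in> homog \<delta> 0" "\<And>g. D g \<in> homog \<delta> (\<delta> g + k)" "x \<in> homog \<delta> p"
  shows "der \<sigma> D x \<in> homog \<delta> (p + k)"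
  using lmap_der subspace_homog _ assms(3)[unfolded homog_eq_span]
  by (rule lmap_in_span) (use derw_homog[OF assms(1,2)] in \<open>force simp: der_mon\<close>)

text \<open>Subtraction of degrees is truncated, so a generator of degree 0 would break the bound
  unless its image vanishes. For the same reason vanishing in total degree 0 is carried through the
  induction: it removes the term in which \<open>u\<close> has degree 0 but \<open>g\<close> does
  not.\<close>

lemma derw_homog_lower:
  assumes "\<And>g. \<sigma> g \<in> homog \<delta> 0" "\<And>g. D g \<in> homog \<delta> (\<delta> g - 1)" "\<And>g. \<delta> g = 0 \<Longrightarrow> D g = 0"
  shows "derw \<sigma> D u \<in> homog \<delta> (sum_list (map \<delta> u) - 1) \<and> (sum_list (map \<delta> u) = 0 \<longrightarrow> derw \<sigma> D u = 0)"
proof (induction u)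
  case Nil
  then show ?case by (simp add: falg.subspace_0 subspace_homog)
next
  case (Cons g u)
  let ?n = "sum_list (map \<delta> (g # u)) - 1"
  have "D g * mon u \<in> homog \<delta> ?n"
  proof (cases "\<delta> g = 0")
    case True
    then show ?thesis by (simp add: assms(3) falg.subspace_0 subspace_homog)
  next
    case False
    then show ?thesis
      using homog_mult[OF assms(2)[of g] homog_mon[of \<delta> u, OF refl]] by simp
  qed
  moreover have "\<sigma> g * var g * derw \<sigma> D u \<in> homog \<delta> ?n"
  proof (cases "sum_list (map \<delta> u) = 0")
    case True
    then show ?thesis using Cons.IH by (simp add: falg.subspace_0 subspace_homog)
  next
    case False
    then have n: "0 + \<delta> g + (sum_list (map \<delta> u) - 1) = ?n"
      by (simp del: sum_list_eq_0_iff)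
    show ?thesis
      unfolding n[symmetric] by (intro homog_mult homog_var refl assms conjunct1[OF Cons.IH])
  qed
  ultimately show ?case
    using Cons.IH by (auto simp: assms(3) intro!: falg.subspace_add subspace_homog)
qed

lemma der_homog_lower:
  assumes "\<And>g. \<sigma> g \<in> homog \<delta> 0" "\<And>g. D g \<in> homog \<delta> (\<delta> g - 1)" "\<And>g. \<delta> g = 0 \<Longrightarrow> D g = 0"
    and "x \<in> homog \<delta> p"
  shows "der \<sigma> D x \<in> homog \<delta> (p - 1)" "p = 0 \<Longrightarrow> der \<sigma> D x = 0"
proof -
  show "der \<sigma> D x \<in> homog \<delta> (p - 1)"
    using lmap_der subspace_homog _ assms(4)[unfolded homog_eq_span]
    by (rule lmap_in_span) (use derw_homog_lower[OF assms(1-3)] in \<open>force simp: der_mon\<close>)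
  assume "p = 0"
  have "der \<sigma> D x \<in> {0}"
    using lmap_der falg.subspace_single_0 _ assms(4)[unfolded homog_eq_span]
    by (rule lmap_in_span) (use derw_homog_lower[OF assms(1-3)] \<open>p = 0\<close> in \<open>force simp: der_mon\<close>)
  then show "der \<sigma> D x = 0" by simp
qed

lemma homog_sign: "(- 1) ^ n \<in> homog \<delta> 0"
  using subspace_sign[OF subspace_homog homog_1, of n \<delta>] by simp

section \<open>Two-sided ideals\<close>

lemma lspan_eq: "lspan S = falg.span S"
  by (simp add: lspan_def)

lemma ideal_mult:
  assumes "x \<in> lspan (two_sided R)"
  shows "u * x \<in> lspan (two_sided R)" "x * v \<in> lspan (two_sided R)"
proof -
  have "u * (u' * r * v') = (u * u') * r * v'" "u' * r * v' * v = u' * r * (v' * v)" for u' r v'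
    by (simp_all add: mult.assoc)
  then have "u * s \<in> two_sided R \<and> s * v \<in> two_sided R" if "s \<in> two_sided R" for s
    using that unfolding two_sided_def by blast
  then show "u * x \<in> lspan (two_sided R)" "x * v \<in> lspan (two_sided R)"
    using assms unfolding lspan_eq
    by (auto intro: falg.span_base lmap_in_span[OF lmap_mult_left] lmap_in_span[OF lmap_mult_right])
qed

lemma ideal_base: "r \<in> R \<Longrightarrow> r \<in> lspan (two_sided R)"
proof -
  assume "r \<in> R"
  then have "1 * r * 1 \<in> two_sided R"
    unfolding two_sided_def by blast
  then show ?thesis
    by (simp add: lspan_eq falg.span_base)
qed

lemma ideal_mult_generator: "r \<in> R \<Longrightarrow> u * r * v \<in> lspan (two_sided R)"
  by (intro ideal_mult ideal_base)

text \<open>By the Leibniz rule every term of \<open>D (u * r * v)\<close> contains \<open>r\<close>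
  or \<open>D r\<close>. Homogeneity of \<open>r\<close> supplies the sign for \<open>v\<close>; the
  factor \<open>u\<close> is arbitrary and is first reduced to words, which are homogeneous.\<close>

lemma der_ideal:
  assumes r: "\<And>r. r \<in> R \<Longrightarrow> (\<exists>p. r \<in> homog \<delta> p) \<and> der (\<lambda>g. (- 1) ^ \<delta> g) D r \<in> lspan (two_sided R)"
    and x: "x \<in> lspan (two_sided R)"
  shows "der (\<lambda>g. (- 1) ^ \<delta> g) D x \<in> lspan (two_sided R)"
  using lmap_der _ _ x[unfolded lspan_eq]
proof (rule lmap_in_span)
  let ?I = "lspan (two_sided R)" and ?D = "der (\<lambda>g. (- 1) ^ \<delta> g) D"
  show I: "falg.subspace ?I" by (simp add: lspan_eq)
  fix s assume "s \<in> two_sided R"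
  then obtain u r v where s: "s = u * r * v" and "r \<in> R"
    by (auto simp: two_sided_def)
  obtain p where p: "r \<in> homog \<delta> p" and D: "?D r \<in> ?I"
    using r[OF \<open>r \<in> R\<close>] by blast
  have rv: "r * v \<in> ?I" for v
    using \<open>r \<in> R\<close> by (intro ideal_mult ideal_base)
  have "?D (r * v) \<in> ?I"
    unfolding der_mult[OF p] by (intro falg.subspace_add subspace_sign I rv) (rule ideal_mult D)+
  then have "?D (u * (r * v)) \<in> ?I"
  proof (induction u rule: falg_induct)
    case (mon w)
    then show ?case
      unfolding der_mult_mon by (intro falg.subspace_add subspace_sign I) (auto intro: ideal_mult rv)
  qed (simp_all add: distrib_right scl_mult_left lmap_zero[OF lmap_der] lmap_add[OF lmap_der] lmap_scl[OF lmap_der]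
      falg.subspace_0 falg.subspace_add falg.subspace_scale I)
  then show "?D s \<in> ?I"
    by (simp add: s mult.assoc)
qed

section \<open>Quotients\<close>

lemma coset_eq_iff:
  assumes "falg.subspace N"
  shows "x +o N = y +o N \<longleftrightarrow> x - y \<in> N"
proof
  assume "x +o N = y +o N"
  then show "x - y \<in> N"
    using set_plus_intro2[OF falg.subspace_0[OF assms], of x] by (simp add: set_minus_plus)
next
  have le: "x +o N \<subseteq> y +o N" if "x - y \<in> N" for x y
  proof
    fix z assume "z \<in> x +o N"
    then have "(z - x) + (x - y) \<in> N"
      using that assms by (intro falg.subspace_add) (auto simp: set_minus_plus)
    then show "z \<in> y +o N" by (simp add: set_minus_plus)
  qed
  assume "x - y \<in> N"
  then show "x +o N = y +o N"
    using le[of x y] le[of y x] falg.subspace_neg[OF assms, of "x - y"] by simp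
qed

lemma coset_eq_self_iff: "falg.subspace N \<Longrightarrow> x +o N = N \<longleftrightarrow> x \<in> N"
  using coset_eq_iff[of N x 0] by simp

lemma coset_add:
  assumes "falg.subspace N"
  shows "(x +o N) + (y +o N) = (x + y) +o N"
proof -
  have "N + N \<subseteq> N"
    by (auto elim!: set_plus_elim intro: falg.subspace_add[OF assms])
  then have "N + N = N"
    using set_zero_plus2[OF falg.subspace_0[OF assms]] by blast
  then show ?thesis by (simp add: set_plus_rearrange)
qed

text \<open>The empty sum of sets is \<open>{0}\<close> rather than the zero coset \<open>N\<close>,
  hence the nonempty index set.\<close>

lemma coset_sum:
  assumes "falg.subspace N" "finite I" "I \<noteq> {}"
  shows "(\<Sum>i\<in>I. f i +o N) = (\<Sum>i\<in>I. f i) +o N"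
  using assms(2,3)
  by (induction I rule: finite_ne_induct) (simp_all add: coset_add assms(1))

lemma qmap_coset:
  assumes "lmap f" "falg.subspace N" "falg.subspace M" "\<And>x. x \<in> N \<Longrightarrow> f x \<in> M"
  shows "qmap M f (x +o N) = f x +o M"
proof -
  have "f y +o M = f x +o M" if "y \<in> x +o N" for y
  proof -
    have "f (y - x) \<in> M"
      using that assms(4) by (simp add: set_minus_plus)
    then show ?thesis
      by (simp add: coset_eq_iff assms(3) lmap_diff[OF assms(1)])
  qed
  moreover have "x \<in> x +o N"
    using falg.subspace_0[OF assms(2)] by (simp flip: set_minus_plus)
  ultimately show ?thesis
    unfolding qmap_def by blast
qed

lemma qmap_scl_coset: "falg.subspace N \<Longrightarrow> qmap N (scl c) (x +o N) = scl c x +o N"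
  by (rule qmap_coset) (auto simp: lmap_scale falg.subspace_scale)

lemma coset_in_quo: "x +o N \<in> quo N"
  by (simp add: quo_def)

lemma klinear_qmap:
  assumes "lmap f" "falg.subspace N" "falg.subspace M" "\<And>x. x \<in> N \<Longrightarrow> f x \<in> M"
    and "Q \<subseteq> quo N"
    and "\<And>X. X \<in> Q \<Longrightarrow> g X = qmap M f X"
    and "\<And>X Y. X \<in> Q \<Longrightarrow> Y \<in> Q \<Longrightarrow> X + Y \<in> Q"
    and "\<And>X c. X \<in> Q \<Longrightarrow> qmap N (scl c) X \<in> Q"
  shows "klinear Q N M g"
  unfolding klinear_def
proof (intro conjI ballI allI)
  have g: "g (x +o N) = f x +o M" if "x +o N \<in> Q" for x
    unfolding assms(6)[OF that] by (rule qmap_coset[OF assms(1-4)])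
  have Q: "\<exists>x. X = x +o N" if "X \<in> Q" for X
    using subsetD[OF assms(5) that] by (auto simp: quo_def)
  show "g ` Q \<subseteq> quo M"
  proof (rule image_subsetI)
    fix X assume "X \<in> Q"
    then show "g X \<in> quo M"
      using Q[of X] g coset_in_quo by auto
  qed
  fix X Y c assume X: "X \<in> Q" and Y: "Y \<in> Q"
  obtain x y where xy: "X = x +o N" "Y = y +o N"
    using Q[OF X] Q[OF Y] by blast
  have "(x + y) +o N \<in> Q"
    using assms(7)[OF X Y] by (simp add: xy coset_add[OF assms(2)])
  then show "g (X + Y) = g X + g Y"
    using X Y by (simp add: xy g coset_add[OF assms(2)] coset_add[OF assms(3)] lmap_add[OF assms(1)])
next
  have g: "g (x +o N) = f x +o M" if "x +o N \<in> Q" for x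
    unfolding assms(6)[OF that] by (rule qmap_coset[OF assms(1-4)])
  fix X c assume X: "X \<in> Q"
  then obtain x where x: "X = x +o N"
    using subsetD[OF assms(5) X] by (auto simp: quo_def)
  have "scl c x +o N \<in> Q"
    using assms(8)[OF X, of c] by (simp add: x qmap_scl_coset[OF assms(2)])
  then show "g (qmap N (scl c) X) = qmap M (scl c) (g X)"
    using X by (simp add: x g qmap_scl_coset[OF assms(2)] qmap_scl_coset[OF assms(3)] lmap_scl[OF assms(1)])
qed

lemma klinear_determined:
  assumes g: "klinear Q N M g" and f: "lmap f" and N: "falg.subspace N" and M: "falg.subspace M"
    and Q: "\<And>x. x \<in> falg.span S \<Longrightarrow> x +o N \<in> Q"
    and S: "\<And>s. s \<in> S \<Longrightarrow> g (s +o N) = f s +o M"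
    and x: "x \<in> falg.span S"
  shows "g (x +o N) = f x +o M"
proof -
  have "x \<in> falg.span S \<and> g (x +o N) = f x +o M"
    using x
  proof (induction rule: falg.span_induct_alt)
    case base
    have "N \<in> Q"
      using Q[OF falg.span_zero] by simp
    then have "g N \<in> quo M"
      using g unfolding klinear_def by blast
    then obtain y where y: "g N = y +o M"
      unfolding quo_def by blast
    \<comment> \<open>\<open>klinear\<close> does not mention the zero coset. Additivity at
      \<open>N + N = N\<close> gives \<open>y - (y + y) \<in> M\<close>, that is,
      \<open>g N = M\<close>.\<close>
    have "N + N = N"
      using coset_add[OF N, of 0 0] by simp
    moreover have "g (N + N) = g N + g N"
      using g \<open>N \<in> Q\<close> unfolding klinear_def by blast
    ultimately have "y +o M = (y + y) +o M"
      by (simp only: y coset_add[OF M])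
    then have "y - (y + y) \<in> M"
      by (simp only: coset_eq_iff[OF M])
    then have "g N = M"
      using falg.subspace_neg[OF M, of "- y"] by (simp add: y coset_eq_self_iff[OF M])
    then show ?case
      by (simp add: lmap_zero[OF f] falg.span_zero)
  next
    case (step c s y)
    have s: "s \<in> falg.span S" and y: "y \<in> falg.span S"
      using step(2) falg.span_base[OF step(1)] by auto
    have sQ: "s +o N \<in> Q" "y +o N \<in> Q" "scl c s +o N \<in> Q"
      using Q[OF s] Q[OF y] Q[OF falg.span_scale[OF s]] by simp_all
    have "g ((scl c s + y) +o N) = g (scl c s +o N) + g (y +o N)"
      using g sQ(2,3) unfolding coset_add[OF N, symmetric] klinear_def by blast
    also have "g (scl c s +o N) = qmap M (scl c) (g (s +o N))"
      using g sQ(1) unfolding qmap_scl_coset[OF N, symmetric] klinear_def by blast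
    also have "\<dots> = scl c (f s) +o M"
      by (simp only: S[OF step(1)] qmap_scl_coset[OF M])
    also have "g (y +o N) = f y +o M"
      using step(2) by simp
    finally have "g ((scl c s + y) +o N) = f (scl c s + y) +o M"
      by (simp only: coset_add[OF M] lmap_add[OF f] lmap_scl[OF f])
    then show ?case
      using s y by (simp add: falg.span_add falg.span_scale)
  qed
  then show ?thesis ..
qed

section \<open>Cochains and their action on forms\<close>

text \<open>
  A family \<open>\<phi> a\<^sub>0 [a\<^sub>1, \<dots>, a\<^sub>n]\<close> stands for a map on \<open>A \<otimes> (A/k)\<^sup>n\<close>, that is, on the
  normal forms \<open>a\<^sub>0 \<d>a\<^sub>1 \<dots> \<d>a\<^sub>n\<close>.  Left multiplication of normal forms by a generator induces
  a right action on such families, and the value of \<open>\<phi>\<close> on an arbitrary word is read off at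
  the normal form 1.  In this way maps on \<open>\<Omega>\<close> can be defined by their values on normal forms
  without proving that these are a basis.
\<close>

fun word_act :: "('a::ring_1 \<Rightarrow> 'a list \<Rightarrow> ('h, 'k::comm_ring_1) falg) \<Rightarrow> 'a gen list
    \<Rightarrow> 'a \<Rightarrow> 'a list \<Rightarrow> ('h, 'k) falg" where
  "word_act \<phi> [] = \<phi>"
| "word_act \<phi> (El b # w) = word_act (\<lambda>a0 as. \<phi> (b * a0) as) w"
| "word_act \<phi> (Df b # w) = word_act (\<lambda>a0 as. \<phi> 1 (b * a0 # as) - \<phi> b (a0 # as)) w"

definition form_act :: "('a::ring_1 \<Rightarrow> 'a list \<Rightarrow> ('h, 'k::comm_ring_1) falg) \<Rightarrow> ('a gen, 'k) falg
    \<Rightarrow> 'a \<Rightarrow> 'a list \<Rightarrow> ('h, 'k) falg" where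
  "form_act \<phi> x a0 as = lin (\<lambda>w. word_act \<phi> w a0 as) x"

abbreviation on_forms :: "('a::ring_1 \<Rightarrow> 'a list \<Rightarrow> ('h, 'k::comm_ring_1) falg) \<Rightarrow> ('a gen, 'k) falg \<Rightarrow> ('h, 'k) falg" where
  "on_forms \<phi> x \<equiv> form_act \<phi> x 1 []"

lemma word_act_append: "word_act \<phi> (u @ v) = word_act (word_act \<phi> u) v"
  by (induction \<phi> u rule: word_act.induct) simp_all

lemma word_act_closed:
  assumes "falg.subspace N" "\<And>a0 as. \<phi> a0 as \<in> N"
  shows "word_act \<phi> w a0 as \<in> N"
  using assms(2)
  by (induction \<phi> w arbitrary: a0 as rule: word_act.induct)
    (simp_all add: falg.subspace_diff[OF assms(1)])

lemma word_act_linear: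
  "word_act (\<lambda>a0 as. scl c (\<phi> a0 as) + \<psi> a0 as) w a0 as = scl c (word_act \<phi> w a0 as) + word_act \<psi> w a0 as"
proof (induction w arbitrary: \<phi> \<psi> a0 as)
  case (Cons g w)
  show ?case
  proof (cases g)
    case (El b)
    then show ?thesis using Cons by simp
  next
    case (Df b)
    have "(\<lambda>a0 as. (scl c (\<phi> 1 (b * a0 # as)) + \<psi> 1 (b * a0 # as)) - (scl c (\<phi> b (a0 # as)) + \<psi> b (a0 # as)))
       = (\<lambda>a0 as. scl c (\<phi> 1 (b * a0 # as) - \<phi> b (a0 # as)) + (\<psi> 1 (b * a0 # as) - \<psi> b (a0 # as)))"
      by (simp add: fun_eq_iff falg.scale_right_diff_distrib)
    then show ?thesis by (simp add: Df Cons)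
  qed
qed simp

lemma lmap_form_act: "lmap (\<lambda>x. form_act \<phi> x a0 as)"
  unfolding form_act_def by (rule lmap_lin)

lemma form_act_mon: "form_act \<phi> (mon w) = word_act \<phi> w"
  by (simp add: fun_eq_iff form_act_def lin_mon)

text \<open>The formula for \<open>df a\<close> is the identity
  \<open>da a0 = d(a a0) - a da0\<close> applied to the head of a normal form.\<close>

lemma form_act_el: "form_act \<phi> (el a) = (\<lambda>a0 as. \<phi> (a * a0) as)"
  and form_act_df: "form_act \<phi> (df a) = (\<lambda>a0 as. \<phi> 1 (a * a0 # as) - \<phi> a (a0 # as))"
  and form_act_1: "form_act \<phi> 1 = \<phi>"
  using form_act_mon[of \<phi> "[El a]"] form_act_mon[of \<phi> "[Df a]"] form_act_mon[of \<phi> "[]"]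
  by (simp_all add: mon_Cons mon_Nil)

lemma form_act_zero: "form_act \<phi> 0 = (\<lambda>a0 as. 0)"
  and form_act_add: "form_act \<phi> (x + y) = (\<lambda>a0 as. form_act \<phi> x a0 as + form_act \<phi> y a0 as)"
  and form_act_diff: "form_act \<phi> (x - y) = (\<lambda>a0 as. form_act \<phi> x a0 as - form_act \<phi> y a0 as)"
  and form_act_scl: "form_act \<phi> (scl c x) = (\<lambda>a0 as. scl c (form_act \<phi> x a0 as))"
  by (simp_all add: fun_eq_iff lmap_zero[OF lmap_form_act] lmap_add[OF lmap_form_act]
      lmap_diff[OF lmap_form_act] lmap_scl[OF lmap_form_act])

lemma form_act_linear:
  "form_act (\<lambda>a0 as. scl c (\<phi> a0 as) + \<psi> a0 as) x a0 as = scl c (form_act \<phi> x a0 as) + form_act \<psi> x a0 as"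
  by (induction x rule: falg_induct)
    (simp_all add: form_act_zero form_act_add form_act_scl form_act_mon word_act_linear
      falg.scale_right_distrib mult.commute)

lemma form_act_closed:
  assumes "falg.subspace N" "\<And>a0 as. \<phi> a0 as \<in> N"
  shows "form_act \<phi> x a0 as \<in> N"
  by (induction x rule: falg_induct)
    (simp_all add: form_act_zero form_act_add form_act_scl form_act_mon word_act_closed assms
      falg.subspace_0 falg.subspace_add falg.subspace_scale)

lemma form_act_null: "form_act (\<lambda>a0 as. 0) x = (\<lambda>a0 as. 0)"
  using form_act_closed[OF falg.subspace_single_0, of "\<lambda>a0 as. 0" x] by (auto simp: fun_eq_iff)

lemma form_act_mult: "form_act \<phi> (x * y) = form_act (form_act \<phi> x) y"
proof (induction x rule: falg_induct)
  case zero
  then show ?case by (simp add: form_act_zero form_act_null)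
next
  case (add x x')
  then show ?case
    using form_act_linear[of 1 "form_act \<phi> x" "form_act \<phi> x'" y]
    by (simp add: form_act_add distrib_right)
next
  case (scl c x)
  then show ?case
    using form_act_linear[of c "form_act \<phi> x" "\<lambda>a0 as. 0" y]
    by (simp add: form_act_scl scl_mult_left form_act_null)
next
  case (mon u)
  show ?case
    by (induction y rule: falg_induct)
      (simp_all add: form_act_zero form_act_add form_act_scl form_act_mon distrib_left scl_mult_right
        word_act_append flip: mon_append)
qed

text \<open>The de Rham degree counts how many list entries are consumed.\<close>

lemma word_act_degree:
  assumes "\<And>a0 as. length as \<noteq> p \<Longrightarrow> \<phi> a0 as = 0" "length as + sum_list (map gdeg w) \<noteq> p"
  shows "word_act \<phi> w a0 as = 0"
  using assms
proof (induction w arbitrary: \<phi> a0 as p)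
  case (Cons g w)
  show ?case
  proof (cases g)
    case (El b)
    then show ?thesis
      using Cons.prems Cons.IH[of p] by simp
  next
    case (Df b)
    show ?thesis
    \<comment> \<open>A differential consumes one list entry, so the new cochain lives on lists of
      length \<open>p - 1\<close>; for \<open>p = 0\<close> it vanishes.\<close>
    proof (cases p)
      case 0
      then show ?thesis
        using Df Cons.prems word_act_closed[OF falg.subspace_single_0, of "\<lambda>a0 as. \<phi> 1 (b * a0 # as) - \<phi> b (a0 # as)" w a0 as]
        by simp
    next
      case (Suc p')
      then show ?thesis
        using Df Cons.prems Cons.IH[of p' "\<lambda>a0 as. \<phi> 1 (b * a0 # as) - \<phi> b (a0 # as)" as a0] by simp
    qed
  qed
qed simp

context split_algebra
begin

abbreviation rels :: "('a \<Rightarrow> ('g, 'k) falg) \<Rightarrow> ('a \<Rightarrow> ('g, 'k) falg) \<Rightarrow> ('g, 'k) falg set" where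
  "rels \<equiv> form_rels \<iota>"

text \<open>Linearity holds only modulo relations, already for \<open>el\<close> and
  \<open>df\<close> themselves, so every notion is relative to a submodule of the free
  algebra.\<close>

definition linear_mod :: "('g, 'k) falg set \<Rightarrow> ('a \<Rightarrow> ('g, 'k) falg) \<Rightarrow> bool" where
  "linear_mod N f \<longleftrightarrow> (\<forall>a b. f (a + b) - (f a + f b) \<in> N) \<and> (\<forall>c a. f (\<iota> c * a) - scl c (f a) \<in> N)"

text \<open>One map from \<open>A \<otimes> (A/k)\<^sup>n\<close> to the quotient by
  \<open>N\<close> for each \<open>n\<close> at once. The last clause lets the entries after the
  first pass to the quotient by the ground ring.\<close>

definition cochain :: "('g, 'k) falg set \<Rightarrow> ('a \<Rightarrow> 'a list \<Rightarrow> ('g, 'k) falg) \<Rightarrow> bool" where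
  "cochain N \<phi> \<longleftrightarrow> (\<forall>as. linear_mod N (\<lambda>a. \<phi> a as)) \<and>
     (\<forall>a0 xs ys. linear_mod N (\<lambda>a. \<phi> a0 (xs @ a # ys))) \<and>
     (\<forall>a0 xs ys c. \<phi> a0 (xs @ \<iota> c # ys) \<in> N)"

lemma linear_mod_lmap:
  assumes "linear_mod N f" "lmap F" "\<And>x. x \<in> N \<Longrightarrow> F x \<in> M"
  shows "linear_mod M (\<lambda>a. F (f a))"
  using assms unfolding linear_mod_def
  by (metis lmap_add[OF assms(2)] lmap_scl[OF assms(2)] lmap_diff[OF assms(2)])

lemma linear_mod_add:
  assumes "falg.subspace N" "linear_mod N f" "linear_mod N g"
  shows "linear_mod N (\<lambda>a. f a + g a)"
proof -
  have *: "f (a + b) + g (a + b) - (f a + g a + (f b + g b)) = (f (a + b) - (f a + f b)) + (g (a + b) - (g a + g b))"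
    "f (\<iota> c * a) + g (\<iota> c * a) - scl c (f a + g a) = (f (\<iota> c * a) - scl c (f a)) + (g (\<iota> c * a) - scl c (g a))" for a b c
    by (simp_all add: algebra_simps falg.scale_right_distrib)
  then show ?thesis
    using assms(2,3) unfolding linear_mod_def * by (blast intro: falg.subspace_add[OF assms(1)])
qed

lemma linear_mod_neg:
  assumes "falg.subspace N" "linear_mod N f"
  shows "linear_mod N (\<lambda>a. - f a)"
  by (rule linear_mod_lmap[OF assms(2), of uminus]) (auto intro: lmapI falg.subspace_neg assms(1))

lemma linear_mod_diff:
  assumes "falg.subspace N" "linear_mod N f" "linear_mod N g"
  shows "linear_mod N (\<lambda>a. f a - g a)"
  using linear_mod_add[OF assms(1,2) linear_mod_neg[OF assms(1,3)]] by simp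

lemma linear_mod_null:
  assumes "falg.subspace N" "\<And>a. f a \<in> N"
  shows "linear_mod N f"
  using assms by (simp add: linear_mod_def falg.subspace_add falg.subspace_diff falg.subspace_scale)

lemma linear_mod_sum:
  assumes "falg.subspace N" "\<And>i. i \<in> I \<Longrightarrow> linear_mod N (f i)"
  shows "linear_mod N (\<lambda>a. \<Sum>i\<in>I. f i a)"
  using assms(2)
  by (induction I rule: infinite_finite_induct)
    (auto intro: linear_mod_add linear_mod_null assms(1) falg.subspace_0)

lemma linear_mod_mult_left: "linear_mod N f \<Longrightarrow> linear_mod N (\<lambda>a. f (b * a))"
  unfolding linear_mod_def by (metis \<iota>_central distrib_left mult.assoc)

lemma linear_mod_mult_right: "linear_mod N f \<Longrightarrow> linear_mod N (\<lambda>a. f (a * b))"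
  unfolding linear_mod_def by (metis distrib_right mult.assoc)

text \<open>The last four facts are the cases \<open>xs = []\<close> and \<open>b # xs\<close> of
  the preceding ones, in the shape in which \<open>word_act\<close> produces them.\<close>

lemma cochainD:
  assumes "cochain N \<phi>"
  shows "linear_mod N (\<lambda>a. \<phi> a as)" "linear_mod N (\<lambda>a. \<phi> a0 (xs @ a # ys))" "\<phi> a0 (xs @ \<iota> c # ys) \<in> N"
    "linear_mod N (\<lambda>a. \<phi> a0 (a # ys))" "linear_mod N (\<lambda>a. \<phi> a0 (b # xs @ a # ys))"
    "\<phi> a0 (\<iota> c # ys) \<in> N" "\<phi> a0 (b # xs @ \<iota> c # ys) \<in> N"
proof -
  show "linear_mod N (\<lambda>a. \<phi> a as)" and *: "linear_mod N (\<lambda>a. \<phi> a0 (xs @ a # ys))" "\<phi> a0 (xs @ \<iota> c # ys) \<in> N" for xs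
    using assms by (simp_all add: cochain_def)
  show "linear_mod N (\<lambda>a. \<phi> a0 (a # ys))" "linear_mod N (\<lambda>a. \<phi> a0 (b # xs @ a # ys))"
    "\<phi> a0 (\<iota> c # ys) \<in> N" "\<phi> a0 (b # xs @ \<iota> c # ys) \<in> N"
    using *[of "[]"] *[of "b # xs"] by simp_all
qed

text \<open>\<open>F\<close> may depend on the degree: B has a number of summands that does, and
  each component of the Tsygan map is supported in a single degree.\<close>

lemma cochain_map:
  assumes "cochain N \<phi>" "\<And>n. lmap (F n)" "\<And>n x. x \<in> N \<Longrightarrow> F n x \<in> M"
  shows "cochain M (\<lambda>a0 as. F (length as) (\<phi> a0 as))"
  unfolding cochain_def using assms
  by (auto intro!: linear_mod_lmap[of N _ "F _"] cochainD[OF assms(1)])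

lemma cochain_add:
  assumes "falg.subspace N" "cochain N \<phi>" "cochain N \<psi>"
  shows "cochain N (\<lambda>a0 as. \<phi> a0 as + \<psi> a0 as)"
  unfolding cochain_def using assms
  by (auto intro!: linear_mod_add falg.subspace_add cochainD[OF assms(2)] cochainD[OF assms(3)])

lemma cochain_sum:
  assumes "falg.subspace N" "\<And>i. i \<in> I \<Longrightarrow> cochain N (\<phi> i)"
  shows "cochain N (\<lambda>a0 as. \<Sum>i\<in>I. \<phi> i a0 as)"
  unfolding cochain_def
  by (intro conjI allI linear_mod_sum falg.subspace_sum assms(1); rule cochainD[OF assms(2)])

lemma cochain_word_act:
  assumes "falg.subspace N" "cochain N \<phi>"
  shows "cochain N (word_act \<phi> w)"
  using assms(2)
proof (induction w arbitrary: \<phi>)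
  case (Cons g w)
  show ?case
  proof (cases g)
    case (El b)
    have "cochain N (\<lambda>a0 as. \<phi> (b * a0) as)"
      unfolding cochain_def
      by (auto intro!: linear_mod_mult_left[of N "\<lambda>a. \<phi> a _"] cochainD[OF Cons.prems])
    then show ?thesis by (simp add: El Cons.IH)
  next
    case (Df b)
    have "cochain N (\<lambda>a0 as. \<phi> 1 (b * a0 # as) - \<phi> b (a0 # as))"
      unfolding cochain_def
      by (auto intro!: linear_mod_mult_left[of N "\<lambda>a. \<phi> 1 (a # _)"] linear_mod_diff assms(1)
          falg.subspace_diff cochainD[OF Cons.prems])
    then show ?thesis by (simp add: Df Cons.IH)
  qed
qed simp

lemma cochain_form_act:
  assumes "falg.subspace N" "cochain N \<phi>"
  shows "cochain N (form_act \<phi> x)"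
proof (induction x rule: falg_induct)
  case zero
  then show ?case
    using assms(1) by (simp add: form_act_zero cochain_def linear_mod_null falg.subspace_0)
next
  case (add x y)
  then show ?case
    by (simp add: form_act_add cochain_add assms(1))
next
  case (scl c x)
  then show ?case
    using cochain_map[OF scl, of "\<lambda>n. scl c" N] assms(1)
    by (simp add: form_act_scl lmap_scale falg.subspace_scale)
qed (simp add: form_act_mon cochain_word_act assms)

text \<open>The multiplicative relations, the unit relation and the Leibniz rule hold exactly, by
  associativity in \<open>'a\<close> and cancellation; the other relations hold by linearity modulo
  \<open>N\<close>.\<close>

lemma form_act_rels:
  assumes N: "falg.subspace N" and \<psi>: "cochain N \<psi>" and r: "r \<in> rels el df"
  shows "form_act \<psi> r a0 as \<in> N"
proof -
  have add: "linear_mod N f \<Longrightarrow> f (a + b) - (f a + f b) \<in> N"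
    and scl: "linear_mod N f \<Longrightarrow> f (\<iota> c * a) - scl c (f a) \<in> N" for f a b c
    by (simp_all add: linear_mod_def)
  note simps = form_act_el form_act_df form_act_1 form_act_add form_act_diff form_act_scl form_act_mult
  note lin = cochainD[OF \<psi>]
  from r consider a b where "r = el (a + b) - (el a + el b)" | c a where "r = el (\<iota> c * a) - scl c (el a)"
    | a b where "r = el (a * b) - el a * el b" | "r = el 1 - 1"
    | a b where "r = df (a + b) - (df a + df b)" | c a where "r = df (\<iota> c * a) - scl c (df a)"
    | c where "r = df (\<iota> c)" | a b where "r = df (a * b) - (df a * el b + el a * df b)"
    unfolding form_rels_def by blast
  then show ?thesis
  proof cases
    case (1 a b)
    show ?thesis
      unfolding 1 using add[OF linear_mod_mult_right[OF lin(1)]] by (simp add: simps)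
  next
    case (2 c a)
    show ?thesis
      unfolding 2 using scl[OF linear_mod_mult_right[OF lin(1)]] by (simp add: simps)
  next
    case 3
    show ?thesis unfolding 3 by (simp add: simps mult.assoc falg.subspace_0 N)
  next
    case 4
    show ?thesis unfolding 4 by (simp add: simps falg.subspace_0 N)
  next
    case (5 a b)
    show ?thesis
      unfolding 5 using falg.subspace_diff[OF N add[OF linear_mod_mult_right[OF lin(4)[of 1 as]], of a b a0] add[OF lin(1), of a b "a0 # as"]]
      by (simp add: simps algebra_simps)
  next
    case (6 c a)
    show ?thesis
      unfolding 6 using falg.subspace_diff[OF N scl[OF linear_mod_mult_right[OF lin(4)[of 1 as]], of c a a0] scl[OF lin(1), of c a "a0 # as"]]
      by (simp add: simps algebra_simps falg.scale_right_diff_distrib)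
  next
    \<comment> \<open>Linearity turns both terms, \<open>\<psi> 1 (\<iota> c * a0 # as)\<close> and
      \<open>\<psi> (\<iota> c) (a0 # as)\<close>, into \<open>c\<close> times
      \<open>\<psi> 1 (a0 # as)\<close>, so they cancel.\<close>
    case (7 c)
    show ?thesis
      unfolding 7 using falg.subspace_diff[OF N scl[OF lin(4)[of 1 as], of c a0] scl[OF lin(1), of c 1 "a0 # as"]]
      by (simp add: simps algebra_simps)
  next
    case (8 a b)
    show ?thesis unfolding 8 by (simp add: simps mult.assoc falg.subspace_0 N)
  qed
qed

text \<open>In \<open>u * r * v\<close> the factor \<open>u\<close> acts first and again yields a
  cochain, \<open>r\<close> sends that cochain into \<open>N\<close>, and \<open>v\<close> preserves
  having all values in \<open>N\<close>. So only the relations themselves have to be tested.\<close>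

lemma form_act_ideal:
  assumes N: "falg.subspace N" and \<phi>: "cochain N \<phi>" and x: "x \<in> lspan (two_sided (rels el df))"
  shows "form_act \<phi> x a0 as \<in> N"
  using lmap_form_act N _ x[unfolded lspan_eq]
proof (rule lmap_in_span)
  fix s :: "('a gen, 'k) falg" assume "s \<in> two_sided (rels el df)"
  then obtain u r v where "s = u * r * v" "r \<in> rels el df"
    unfolding two_sided_def by blast
  then show "form_act \<phi> s a0 as \<in> N"
    by (simp add: form_act_mult form_act_closed[OF N] form_act_rels[OF N] cochain_form_act[OF N] \<phi>)
qed

text \<open>Letting \<open>df a\<close> act at head 1 also produces
  \<open>\<phi> a (1 # ...)\<close>. Here 1 stands in a differential slot, so normalization puts
  this term into \<open>N\<close>.\<close>

lemma form_act_df_prod: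
  assumes N: "falg.subspace N" and \<phi>: "cochain N \<phi>"
  shows "form_act \<phi> (prod_list (map df as)) 1 bs - \<phi> 1 (as @ bs) \<in> N"
  using \<phi>
proof (induction as arbitrary: \<phi>)
  case Nil
  then show ?case by (simp add: form_act_1 falg.subspace_0 N)
next
  case (Cons a as)
  let ?\<psi> = "form_act \<phi> (df a)"
  have "form_act ?\<psi> (prod_list (map df as)) 1 bs - ?\<psi> 1 (as @ bs) \<in> N"
    using Cons by (simp add: cochain_form_act[OF N])
  moreover have "\<phi> a (1 # as @ bs) \<in> N"
    using cochainD(6)[OF Cons.prems, of a 1 "as @ bs"] by (simp add: \<iota>_one)
  ultimately show ?case
    using falg.subspace_diff[OF N] by (fastforce simp: form_act_mult form_act_df)
qed

text \<open>The existence half of the extension principle: together with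
  \<open>form_act_ideal\<close> it gives a map on all forms with the prescribed values on normal
  forms.\<close>

lemma on_forms_nform:
  assumes N: "falg.subspace N" and \<phi>: "cochain N \<phi>"
  shows "on_forms \<phi> (el a0 * prod_list (map df as)) - \<phi> a0 as \<in> N"
  using form_act_df_prod[OF N cochain_form_act[OF N \<phi>], of "el a0" as "[]"]
  by (simp add: form_act_mult form_act_el)

definition nform :: "nat \<Rightarrow> ('a gen, 'k) falg set" where
  "nform p = {el a0 * prod_list (map df as) | a0 as. length as = p}"

abbreviation ideal :: "('a gen, 'k) falg set" where
  "ideal \<equiv> lspan (two_sided (rels el df))"

lemma subspace_ideal: "falg.subspace (lspan R)"
  by (simp add: lspan_eq)

text \<open>Left multiplication by a generator preserves the span of normal forms modulo relations:
  \<open>b\<close> merges with the head, and \<open>db\<close> is moved past the head by the Leibniz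
  rule. The index \<open>p\<close> records that the degree is respected.\<close>

lemma mon_in_span_nform: "mon w \<in> falg.span (nform (sum_list (map gdeg w)) \<union> two_sided (rels el df))"
proof (induction w)
  let ?V = "\<lambda>p. falg.span (nform p \<union> two_sided (rels el df :: ('a gen, 'k) falg set))"
  have I: "x \<in> ?V p" if "x \<in> ideal" for x p
    using that falg.span_mono[of "two_sided (rels el df)" "nform p \<union> two_sided (rels el df)"]
    by (auto simp: lspan_eq)
  have nf: "el a * prod_list (map df as) \<in> ?V (length as)" for a as
    by (intro falg.span_base) (auto simp: nform_def)
  have r: "el 1 - 1 \<in> rels el df" "el (a * b) - el a * el b \<in> rels el df"
    "df (a * b) - (df a * el b + el a * df b) \<in> rels el df" for a b
    unfolding form_rels_def by blast+
  {
    case Nil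
    have "el 1 - (el 1 - 1) \<in> ?V 0"
      using falg.span_diff[OF nf[of 1 "[]"] I[OF ideal_base[OF r(1)]]] by simp
    then show ?case by (simp add: mon_Nil)
  next
    case (Cons g w)
    let ?n = "sum_list (map gdeg w)"
    have "var g * mon w \<in> ?V (gdeg g + ?n)"
    proof (rule lmap_in_span[OF lmap_mult_left falg.subspace_span _ Cons])
      fix s assume "s \<in> nform ?n \<union> two_sided (rels el df)"
      then show "var g * s \<in> ?V (gdeg g + ?n)"
      proof
        assume "s \<in> two_sided (rels el df)"
        then show ?thesis
          by (intro I ideal_mult) (simp add: lspan_eq falg.span_base)
      next
        assume "s \<in> nform ?n"
        then obtain a as where s: "s = el a * prod_list (map df as)" and n: "length as = ?n"
          by (auto simp: nform_def)
        show ?thesis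
        proof (cases g)
          case (El b)
          have "el (b * a) * prod_list (map df as) - (el (b * a) - el b * el a) * prod_list (map df as) \<in> ?V (length as)"
            by (intro falg.span_diff nf I ideal_mult ideal_base r)
          then show ?thesis
            by (simp add: El s n algebra_simps)
        next
          case (Df b)
          let ?P = "prod_list (map df as)"
          have nf': "el b * prod_list (map df (a # as)) \<in> ?V (Suc (length as))" for a b
            using nf[of b "a # as"] by simp
          \<comment> \<open>\<open>db a = d(ba) - b da\<close>. The form \<open>d(ba) ...\<close>
            has no head, so it is represented by the normal form with head 1, corrected by the unit
            relation.\<close>
          have "el 1 * prod_list (map df (b * a # as)) - (el 1 - 1) * prod_list (map df (b * a # as))
             - el b * prod_list (map df (a # as))
             - (df (b * a) - (df b * el a + el b * df a)) * ?P \<in> ?V (Suc (length as))"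
            by (intro falg.span_diff nf' I ideal_mult ideal_base r)
          then show ?thesis
            by (simp add: Df s n algebra_simps)
        qed
      qed
    qed
    then show ?case by (simp add: mon_Cons)
  }
qed

lemma homog_in_span_nform:
  assumes "x \<in> homog gdeg p"
  shows "x \<in> falg.span (nform p \<union> two_sided (rels el df))"
  using lmap_ident falg.subspace_span _ assms[unfolded homog_eq_span]
  by (rule lmap_in_span) (use mon_in_span_nform in auto)

lemma form_in_span_nform: "(x :: ('a gen, 'k) falg) \<in> falg.span ((\<Union>p. nform p) \<union> two_sided (rels el df))"
proof (rule lmap_in_span[OF lmap_ident falg.subspace_span _ in_span_mon])
  fix s :: "('a gen, 'k) falg" assume "s \<in> {mon (letters w) |w. w \<in> Poly_Mapping.keys x}"
  then obtain w where "s = mon w" by blast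
  then show "s \<in> falg.span ((\<Union>p. nform p) \<union> two_sided (rels el df))"
    using mon_in_span_nform[of w] falg.span_mono[of "nform (sum_list (map gdeg w)) \<union> two_sided (rels el df)"
      "(\<Union>p. nform p) \<union> two_sided (rels el df)"] by blast
qed

end

section \<open>The operators on reduced forms\<close>

text \<open>Packages what a definite description needs: the first three facts give existence, the
  fourth uniqueness from the values on a spanning set.\<close>

lemma klinear_restrict_qmap:
  assumes f: "lmap f" and N: "falg.subspace N" and M: "falg.subspace M" and fN: "\<forall>x\<in>N. f x \<in> M"
    and Q: "Q = (\<lambda>x. x +o N) ` falg.span S"
  defines "g \<equiv> restrict (qmap M f) Q"
  shows "g \<in> extensional Q" "klinear Q N M g" "\<And>x. x +o N \<in> Q \<Longrightarrow> g (x +o N) = f x +o M"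
    "\<And>h. h \<in> extensional Q \<Longrightarrow> klinear Q N M h \<Longrightarrow> (\<And>s. s \<in> S \<Longrightarrow> h (s +o N) = f s +o M) \<Longrightarrow> h = g"
proof -
  show "g \<in> extensional Q" by (simp add: g_def)
  show g: "g (x +o N) = f x +o M" if "x +o N \<in> Q" for x
    using that by (simp add: g_def qmap_coset[OF f N M] fN)
  show "klinear Q N M g"
    by (rule klinear_qmap[OF f N M])
      (auto simp: fN Q g_def quo_def coset_add[OF N] qmap_scl_coset[OF N] intro: falg.span_add falg.span_scale)
  fix h assume h: "h \<in> extensional Q" "klinear Q N M h" "\<And>s. s \<in> S \<Longrightarrow> h (s +o N) = f s +o M"
  show "h = g"
  proof (rule extensionalityI[OF h(1)])
    show "g \<in> extensional Q" by (simp add: g_def)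
    fix X assume "X \<in> Q"
    then obtain x where x: "x \<in> falg.span S" "X = x +o N"
      by (auto simp: Q)
    then have "h X = f x +o M"
      using klinear_determined[OF h(2) f N M _ h(3), of S x] by (simp add: Q)
    then show "h X = g X"
      using g[of x] \<open>X \<in> Q\<close> by (simp add: x)
  qed
qed

context split_algebra
begin

abbreviation ideal_t :: "('a tgen, 'k) falg set" where
  "ideal_t \<equiv> lspan (two_sided (rels elt dft))"

lemma subspace_Omega_null: "falg.subspace (Omega_null \<iota>)"
  and subspace_DR_null: "falg.subspace (DR_null \<iota>)"
  by (simp_all add: Omega_null_def DR_null_def lspan_eq)

lemma ideal_Omega_null: "x \<in> ideal \<Longrightarrow> x \<in> Omega_null \<iota>"
  and ideal_t_DR_null: "y \<in> ideal_t \<Longrightarrow> y \<in> DR_null \<iota>"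
  unfolding Omega_null_def DR_null_def lspan_eq by (auto elim: falg.span_mono[THEN subsetD, rotated])

lemma supercommutator_DR_null:
  "x \<in> homog fdeg p \<Longrightarrow> y \<in> homog fdeg q \<Longrightarrow> x * y - (- 1) ^ (p * q) * (y * x) \<in> DR_null \<iota>"
  unfolding DR_null_def lspan_eq supercommutators_def by (rule falg.span_base) blast

lemma power_DR_null: "tvar ^ n \<in> DR_null \<iota>"
  unfolding DR_null_def lspan_eq by (rule falg.span_base) blast

text \<open>\<open>Omega_null\<close> also contains the scalars, and a scalar is sent to a multiple
  of \<open>\<phi> 1 []\<close>.\<close>

lemma on_forms_Omega_null:
  assumes N: "falg.subspace K" and \<phi>: "cochain K \<phi>" "\<phi> 1 [] \<in> K" and x: "x \<in> Omega_null \<iota>"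
  shows "on_forms \<phi> x \<in> K"
  using lmap_form_act N _ x[unfolded Omega_null_def lspan_eq]
proof (rule lmap_in_span)
  fix s :: "('a gen, 'k) falg" assume "s \<in> two_sided (rels el df) \<union> range const"
  then show "on_forms \<phi> s \<in> K"
  proof
    assume "s \<in> range const"
    then obtain c where "s = scl c 1" by (auto simp: scl_def)
    then show ?thesis
      by (simp add: form_act_scl form_act_1 falg.subspace_scale N \<phi>(2))
  next
    assume "s \<in> two_sided (rels el df)"
    then show ?thesis
      by (intro form_act_ideal[OF N \<phi>(1)]) (simp add: lspan_eq falg.span_base)
  qed
qed

section \<open>Differentials and the defining relations\<close>

lemma form_rels_homog:
  assumes "\<And>a. e a \<in> homog \<delta> 0" "\<And>a. f a \<in> homog \<delta> n" "r \<in> rels e f"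
  shows "\<exists>p. r \<in> homog \<delta> p"
proof -
  have [intro]: "e a * f b \<in> homog \<delta> n" "f a * e b \<in> homog \<delta> n" "e a * e b \<in> homog \<delta> 0" for a b
    using homog_mult[OF assms(1) assms(2), of a b] homog_mult[OF assms(2) assms(1), of a b]
      homog_mult[OF assms(1) assms(1), of a b] by simp_all
  have "r \<in> homog \<delta> 0 \<or> r \<in> homog \<delta> n"
    using assms(3) unfolding form_rels_def
    by (auto intro!: falg.subspace_diff falg.subspace_add falg.subspace_scale subspace_homog assms(1,2) homog_1)
  then show ?thesis by blast
qed

lemma rels_cases [consumes 1]:
  assumes "r \<in> rels e f"
  obtains (el_add) a b where "r = e (a + b) - (e a + e b)"
  | (el_scl) c a where "r = e (\<iota> c * a) - scl c (e a)"
  | (el_mult) a b where "r = e (a * b) - e a * e b"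
  | (el_1) "r = e 1 - 1"
  | (df_add) a b where "r = f (a + b) - (f a + f b)"
  | (df_scl) c a where "r = f (\<iota> c * a) - scl c (f a)"
  | (df_const) c where "r = f (\<iota> c)"
  | (df_mult) a b where "r = f (a * b) - (f a * e b + e a * f b)"
  using assms unfolding form_rels_def by blast

lemma rels_intros:
  "e (a + b) - (e a + e b) \<in> rels e f" "e (\<iota> c * a) - scl c (e a) \<in> rels e f"
  "e (a * b) - e a * e b \<in> rels e f" "e 1 - 1 \<in> rels e f"
  "f (a + b) - (f a + f b) \<in> rels e f" "f (\<iota> c * a) - scl c (f a) \<in> rels e f"
  "f (\<iota> c) \<in> rels e f" "f (a * b) - (f a * e b + e a * f b) \<in> rels e f"
  unfolding form_rels_def by blast+

lemma el_\<iota>: "e (\<iota> c) - scl c 1 \<in> lspan (two_sided (rels e f))"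
proof -
  have "(e (\<iota> c * 1) - scl c (e 1)) + scl c (e 1 - 1) \<in> lspan (two_sided (rels e f))"
    by (intro falg.subspace_add falg.subspace_scale subspace_ideal ideal_base rels_intros)
  then show ?thesis by (simp add: falg.scale_right_diff_distrib)
qed

lemma linear_mod_generators:
  shows "linear_mod (lspan (two_sided (rels e f))) (\<lambda>a. u * e a * v)"
    and "linear_mod (lspan (two_sided (rels e f))) (\<lambda>a. u * f a * v)"
proof -
  have "u * (e (a + b) - (e a + e b)) * v \<in> lspan (two_sided (rels e f))"
    "u * (e (\<iota> c * a) - scl c (e a)) * v \<in> lspan (two_sided (rels e f))"
    "u * (f (a + b) - (f a + f b)) * v \<in> lspan (two_sided (rels e f))"
    "u * (f (\<iota> c * a) - scl c (f a)) * v \<in> lspan (two_sided (rels e f))" for a b c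
    by (intro ideal_mult_generator rels_intros)+
  then show "linear_mod (lspan (two_sided (rels e f))) (\<lambda>a. u * e a * v)"
    "linear_mod (lspan (two_sided (rels e f))) (\<lambda>a. u * f a * v)"
    unfolding linear_mod_def by (simp_all add: algebra_simps scl_mult_left scl_mult_right)
qed

text \<open>The relations for \<open>e\<close> are carried to those for \<open>f\<close>, in
  particular \<open>e 1 - 1\<close> to \<open>f (\<iota> 1)\<close>. The relations for
  \<open>f\<close> go to 0; in the Leibniz relation the two products \<open>f a * f b\<close> cancel
  by sign. The abstract \<open>e\<close> and \<open>f\<close> cover forms and extended forms
  together.\<close>

lemma der_rels_exterior:
  fixes \<delta> :: "'g \<Rightarrow> nat" and D :: "'g \<Rightarrow> ('g, 'k) falg"
  defines "d \<equiv> der (\<lambda>g. (- 1) ^ \<delta> g) D"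
  assumes e: "\<And>a. e a \<in> homog \<delta> 0" "\<And>a. d (e a) = f a" and f: "\<And>a. f a \<in> homog \<delta> 1" "\<And>a. d (f a) = 0"
    and r: "r \<in> rels e f"
  shows "d r \<in> lspan (two_sided (rels e f))"
proof -
  have d: "lmap d" by (simp add: d_def lmap_der)
  note simps = lmap_add[OF d] lmap_scl[OF d] lmap_diff[OF d] e f der_1[of "\<lambda>g. (- 1) ^ \<delta> g" D, folded d_def]
    der_mult[OF e(1), of D, folded d_def] der_mult[OF f(1), of D, folded d_def]
  show ?thesis
    using r
  proof (cases rule: rels_cases)
    case el_1
    then show ?thesis
      using ideal_base[OF rels_intros(7)[of f 1 e]] by (simp add: simps \<iota>_one)
  qed (auto simp: simps intro: ideal_base rels_intros falg.subspace_0 subspace_ideal)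
qed

lemma homog_forms: "el a \<in> homog gdeg 0" "df a \<in> homog gdeg 1"
  "elt a \<in> homog fdeg 0" "dft a \<in> homog fdeg 1" "tvar \<in> homog fdeg 0"
  "elt a \<in> homog tdeg 0" "dft a \<in> homog tdeg 0" "tvar \<in> homog tdeg 1"
  by (simp_all add: homog_var)

lemma d_form_ideal:
  assumes "x \<in> ideal"
  shows "d_form x \<in> ideal"
  unfolding d_form_def
proof (rule der_ideal[OF _ assms])
  fix r :: "('a gen, 'k) falg" assume "r \<in> rels el df"
  then show "(\<exists>p. r \<in> homog gdeg p) \<and> der (\<lambda>g. (- 1) ^ gdeg g) (case_gen df (\<lambda>a. 0)) r \<in> ideal"
    by (intro conjI form_rels_homog[OF homog_forms(1,2)] der_rels_exterior[OF homog_forms(1) _ homog_forms(2)])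
      (simp_all add: der_var)
qed

lemma dt_form_ideal:
  assumes "x \<in> ideal_t"
  shows "dt_form x \<in> ideal_t"
  unfolding dt_form_def
proof (rule der_ideal[OF _ assms])
  fix r :: "('a tgen, 'k) falg" assume "r \<in> rels elt dft"
  then show "(\<exists>p. r \<in> homog fdeg p) \<and>
      der (\<lambda>g. (- 1) ^ fdeg g) (case_tgen (case_gen dft (\<lambda>a. 0)) 0) r \<in> ideal_t"
    by (intro conjI form_rels_homog[OF homog_forms(3,4)] der_rels_exterior[OF homog_forms(3) _ homog_forms(4)])
      (simp_all add: der_var)
qed

lemma lmap_d_form: "lmap d_form" and lmap_dt_form: "lmap dt_form"
  and lmap_ddt_form: "lmap ddt_form" and lmap_it_form: "lmap it_form"
  by (simp_all add: d_form_def dt_form_def ddt_form_def it_form_def lmap_der)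

lemma form_1: "d_form 1 = 0" "dt_form 1 = 0" "ddt_form 1 = 0" "it_form 1 = 0"
  by (simp_all add: d_form_def dt_form_def ddt_form_def it_form_def der_1)

lemma d_form_Omega_null: "x \<in> Omega_null \<iota> \<Longrightarrow> d_form x \<in> Omega_null \<iota>"
  unfolding Omega_null_def lspan_eq
proof (rule lmap_in_span[OF lmap_d_form falg.subspace_span])
  fix s :: "('a gen, 'k) falg" assume "s \<in> two_sided (rels el df) \<union> range const"
  then show "d_form s \<in> falg.span (two_sided (rels el df) \<union> range const)"
  proof
    assume "s \<in> range const"
    then obtain c where "s = scl c 1" by (auto simp: scl_def)
    then show ?thesis
      by (simp add: lmap_scl[OF lmap_d_form] form_1 falg.span_zero)
  next
    assume "s \<in> two_sided (rels el df)"
    then have "d_form s \<in> ideal"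
      by (intro d_form_ideal) (simp add: lspan_eq falg.span_base)
    then show ?thesis
      using falg.span_mono[of "two_sided (rels el df)" "two_sided (rels el df) \<union> range const"]
      unfolding lspan_eq by blast
  qed
qed

subsection \<open>Normal forms and submodules\<close>

text \<open>The tautological cochain; composing it with linear maps yields further cochains without
  checking multilinearity again.\<close>

lemma nform_cochain: "cochain ideal (\<lambda>a0 as. el a0 * prod_list (map df as))"
  unfolding cochain_def
proof (intro conjI allI)
  show "linear_mod ideal (\<lambda>a. el a * prod_list (map df as))" for as
    using linear_mod_generators(1)[where e = el and f = df and u = 1] by simp
  show "linear_mod ideal (\<lambda>a. el a0 * prod_list (map df (xs @ a # ys)))" for a0 xs ys
    using linear_mod_generators(2)[where e = el and f = df and u = "el a0 * prod_list (map df xs)" and v = "prod_list (map df ys)"]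
    by (simp add: mult.assoc)
  show "el a0 * prod_list (map df (xs @ \<iota> c # ys)) \<in> ideal" for a0 xs ys c
    using ideal_mult_generator[OF rels_intros(7)[where f = df and e = el and c = c], of "el a0 * prod_list (map df xs)" "prod_list (map df ys)"]
    by (simp add: mult.assoc)
qed

lemma nform_homog: "el a0 * prod_list (map df as) \<in> homog gdeg (length as)"
proof -
  have "prod_list (map df as) \<in> homog gdeg (length as)"
    by (induction as) (use homog_mult[OF homog_forms(2)] homog_1 in auto)
  from homog_mult[OF homog_forms(1)[of a0] this] show ?thesis by simp
qed

lemma Omega_bar_eq: "Omega_bar \<iota> = (\<lambda>x. x +o Omega_null \<iota>) ` falg.span (\<Union>p. nform p)"
proof -
  have "x +o Omega_null \<iota> \<in> (\<lambda>x. x +o Omega_null \<iota>) ` falg.span (\<Union>p. nform p)" for x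
  proof -
    obtain y z where "x = y + z" "y \<in> falg.span (\<Union>p. nform p)" "z \<in> ideal"
      using form_in_span_nform[of x] by (auto simp: falg.span_Un lspan_eq)
    moreover from this have "x +o Omega_null \<iota> = y +o Omega_null \<iota>"
      by (simp add: coset_eq_iff[OF subspace_Omega_null] ideal_Omega_null)
    ultimately show ?thesis by blast
  qed
  then show ?thesis
    by (auto simp: Omega_bar_def quo_def)
qed

lemma subspace_pos: "falg.subspace {x :: ('a gen, 'k) falg. \<forall>w\<in>Poly_Mapping.keys x. 1 \<le> wdeg gdeg w}"
proof (rule falg.subspaceI)
  fix x y :: "('a gen, 'k) falg" and c :: 'k
  assume x: "x \<in> {x. \<forall>w\<in>Poly_Mapping.keys x. 1 \<le> wdeg gdeg w}"
  then show "scl c x \<in> {x. \<forall>w\<in>Poly_Mapping.keys x. 1 \<le> wdeg gdeg w}"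
    using keys_mult[of "const c" x] by (fastforce simp: scl_def const_def split: if_splits)
  assume "y \<in> {x. \<forall>w\<in>Poly_Mapping.keys x. 1 \<le> wdeg gdeg w}"
  with x show "x + y \<in> {x. \<forall>w\<in>Poly_Mapping.keys x. 1 \<le> wdeg gdeg w}"
    using keys_add[of x y] by auto
qed simp

lemma homog_pos: "x \<in> homog gdeg (Suc p) \<Longrightarrow> \<forall>w\<in>Poly_Mapping.keys x. 1 \<le> wdeg gdeg w"
  by (simp add: homog_def)

lemma homog_Omega_pos: "x \<in> homog gdeg (Suc p) \<Longrightarrow> x +o Omega_null \<iota> \<in> Omega_pos \<iota>"
  unfolding Omega_pos_def using homog_pos by blast

lemma Omega_pos_eq: "Omega_pos \<iota> = (\<lambda>x. x +o Omega_null \<iota>) ` falg.span (\<Union>p. nform (Suc p))"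
proof (intro equalityI subsetI)
  fix X assume "X \<in> Omega_pos \<iota>"
  then obtain x where X: "X = x +o Omega_null \<iota>" and x: "\<forall>w\<in>Poly_Mapping.keys x. 1 \<le> wdeg gdeg w"
    by (auto simp: Omega_pos_def)
  have "x \<in> falg.span ((\<Union>p. nform (Suc p)) \<union> two_sided (rels el df))"
  proof (rule lmap_in_span[OF lmap_ident falg.subspace_span _ in_span_mon])
    fix s :: "('a gen, 'k) falg" assume "s \<in> {mon (letters w) |w. w \<in> Poly_Mapping.keys x}"
    then obtain v where "s = mon (letters v)" "v \<in> Poly_Mapping.keys x"
      by blast
    with x obtain w where w: "s = mon w" "1 \<le> sum_list (map gdeg w)"
      unfolding wdeg_def by blast
    then have "nform (sum_list (map gdeg w)) \<subseteq> (\<Union>p. nform (Suc p))"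
      by (cases "sum_list (map gdeg w)") auto
    then show "s \<in> falg.span ((\<Union>p. nform (Suc p)) \<union> two_sided (rels el df))"
      using mon_in_span_nform[of w] falg.span_mono[of "nform (sum_list (map gdeg w)) \<union> two_sided (rels el df)"
        "(\<Union>p. nform (Suc p)) \<union> two_sided (rels el df)"] w(1) by blast
  qed
  then obtain y z where "x = y + z" "y \<in> falg.span (\<Union>p. nform (Suc p))" "z \<in> ideal"
    by (auto simp: falg.span_Un lspan_eq)
  moreover from this have "X = y +o Omega_null \<iota>"
    by (simp add: X coset_eq_iff[OF subspace_Omega_null] ideal_Omega_null)
  ultimately show "X \<in> (\<lambda>x. x +o Omega_null \<iota>) ` falg.span (\<Union>p. nform (Suc p))" by blast
next
  fix X assume "X \<in> (\<lambda>x. x +o Omega_null \<iota>) ` falg.span (\<Union>p. nform (Suc p))"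
  then obtain x where X: "X = x +o Omega_null \<iota>" and x: "x \<in> falg.span (\<Union>p. nform (Suc p))"
    by blast
  have "x \<in> {x. \<forall>w\<in>Poly_Mapping.keys x. 1 \<le> wdeg gdeg w}"
  proof (rule lmap_in_span[OF lmap_ident subspace_pos _ x])
    fix s :: "('a gen, 'k) falg" assume "s \<in> (\<Union>p. nform (Suc p))"
    then obtain p a0 as where "s = el a0 * prod_list (map df as)" "length as = Suc p"
      unfolding nform_def by blast
    then show "s \<in> {x. \<forall>w\<in>Poly_Mapping.keys x. 1 \<le> wdeg gdeg w}"
      using nform_homog[of a0 as] homog_pos by simp
  qed
  then show "X \<in> Omega_pos \<iota>"
    by (auto simp: Omega_pos_def X)
qed

subsection \<open>Maps defined through the last differential\<close>

text \<open>Both b and kappa are prescribed on products \<open>\<alpha> da\<close>, so the last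
  entry is split off. The numerical argument of \<open>T\<close> is the degree of
  \<open>\<alpha>\<close>, on which the signs depend; degree 0 is sent to 0.\<close>

definition snoc_cochain :: "(nat \<Rightarrow> 'a \<Rightarrow> ('a gen, 'k) falg \<Rightarrow> ('g, 'k) falg) \<Rightarrow> 'a \<Rightarrow> 'a list \<Rightarrow> ('g, 'k) falg" where
  "snoc_cochain T a0 as =
     (if as = [] then 0 else T (length as - 1) (last as) (el a0 * prod_list (map df (butlast as))))"

context
  fixes T :: "nat \<Rightarrow> 'a \<Rightarrow> ('a gen, 'k) falg \<Rightarrow> ('g, 'k) falg" and K
  assumes K: "falg.subspace K"
    and T_lmap: "\<And>n a. lmap (T n a)"
    and T_ideal: "\<forall>n a. \<forall>x\<in>ideal. T n a x \<in> K"
    and T_linear: "\<And>n x. linear_mod K (\<lambda>a. T n a x)"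
    and T_const: "\<And>n c x. T n (\<iota> c) x \<in> K"
begin

text \<open>The last slot is governed by \<open>T_linear\<close> and \<open>T_const\<close>. All
  other slots sit inside the form argument of \<open>T\<close>, where multilinearity comes from
  \<open>nform_cochain\<close> and \<open>T_ideal\<close>.\<close>

lemma cochain_snoc: "cochain K (snoc_cochain T)"
  unfolding cochain_def
proof (intro conjI allI)
  show "linear_mod K (\<lambda>a. snoc_cochain T a as)" for as
    by (cases "as = []")
      (auto simp: snoc_cochain_def K falg.subspace_0 intro: linear_mod_null
        linear_mod_lmap[OF cochainD(1)[OF nform_cochain] T_lmap] T_ideal[rule_format])
  show "linear_mod K (\<lambda>a. snoc_cochain T a0 (xs @ a # ys))" for a0 xs ys
  proof (cases "ys = []")
    case True
    then show ?thesis by (simp add: snoc_cochain_def T_linear)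
  next
    case False
    then show ?thesis
      using linear_mod_lmap[OF cochainD(2)[OF nform_cochain, where ?a0.0 = a0 and xs = xs and ys = "butlast ys"] T_lmap, where M = K] T_ideal
      by (simp add: snoc_cochain_def butlast_append)
  qed
  show "snoc_cochain T a0 (xs @ \<iota> c # ys) \<in> K" for a0 xs ys c
    using T_ideal[rule_format, OF cochainD(3)[OF nform_cochain, where ?a0.0 = a0 and xs = xs and c = c and ys = "butlast ys"]]
    by (cases "ys = []") (auto simp: snoc_cochain_def butlast_append T_const)
qed

text \<open>The cochain fixes the values on normal forms only, but b and kappa are specified for
  every homogeneous \<open>\<alpha>\<close>; both sides are linear in \<open>\<alpha>\<close> and
  send the ideal into \<open>K\<close>.\<close>

lemma on_forms_snoc:
  assumes "\<alpha> \<in> homog gdeg p"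
  shows "on_forms (snoc_cochain T) (\<alpha> * df a) - T p a \<alpha> \<in> K"
proof (rule lmap_in_span[OF lmap_minus[OF lmap_compose[OF lmap_form_act lmap_mult_right] T_lmap] K _
      homog_in_span_nform[OF assms]])
  fix s :: "('a gen, 'k) falg" assume "s \<in> nform p \<union> two_sided (rels el df)"
  then show "on_forms (snoc_cochain T) (s * df a) - T p a s \<in> K"
  proof
    assume "s \<in> nform p"
    then obtain a0 as where "s = el a0 * prod_list (map df as)" "p = length as"
      by (auto simp: nform_def)
    then show ?thesis
      using on_forms_nform[OF K cochain_snoc, where ?a0.0 = a0 and as = "as @ [a]"]
      by (simp add: snoc_cochain_def mult.assoc)
  next
    assume "s \<in> two_sided (rels el df)"
    then have "s \<in> ideal" by (simp add: lspan_eq falg.span_base)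
    then show ?thesis
      by (intro falg.subspace_diff K form_act_ideal cochain_snoc T_ideal[rule_format] ideal_mult)
  qed
qed

end

subsection \<open>The operators \<open>\<kappa>\<close>, \<open>b\<close> and \<open>B\<close>\<close>

definition kappa_last :: "nat \<Rightarrow> 'a \<Rightarrow> ('a gen, 'k) falg \<Rightarrow> ('a gen, 'k) falg" where
  "kappa_last p a x = (- 1) ^ p * (df a * x)"

definition b_last :: "nat \<Rightarrow> 'a \<Rightarrow> ('a gen, 'k) falg \<Rightarrow> ('a gen, 'k) falg" where
  "b_last p a x = (- 1) ^ p * (x * el a - el a * x)"

abbreviation kappa_form :: "('a gen, 'k) falg \<Rightarrow> ('a gen, 'k) falg" where
  "kappa_form \<equiv> on_forms (snoc_cochain kappa_last)"

abbreviation b_form :: "('a gen, 'k) falg \<Rightarrow> ('a gen, 'k) falg" where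
  "b_form \<equiv> on_forms (snoc_cochain b_last)"

lemma lmap_sign: "lmap f \<Longrightarrow> lmap (\<lambda>x. (- 1) ^ n * f x)"
  using lmap_compose[OF lmap_scale] by (simp flip: scl_minus_one_power)

lemma linear_mod_sign: "falg.subspace N \<Longrightarrow> linear_mod N f \<Longrightarrow> linear_mod N (\<lambda>a. (- 1) ^ n * f a)"
  by (erule linear_mod_lmap) (auto intro: lmap_sign lmap_ident subspace_sign)

lemma kappa_last_properties:
  "lmap (kappa_last n a)" "\<forall>n a. \<forall>x\<in>ideal. kappa_last n a x \<in> ideal" "linear_mod ideal (\<lambda>a. kappa_last n a y)"
  "kappa_last n (\<iota> c) y \<in> ideal"
proof -
  show "lmap (kappa_last n a)" for n a
    unfolding kappa_last_def by (intro lmap_sign lmap_mult_left)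
  show "\<forall>n a. \<forall>x\<in>ideal. kappa_last n a x \<in> ideal"
    unfolding kappa_last_def by (intro allI ballI subspace_sign subspace_ideal ideal_mult)
  show "linear_mod ideal (\<lambda>a. kappa_last n a y)" for n y
    unfolding kappa_last_def using linear_mod_generators(2)[where e = el and f = df and u = 1 and v = y]
    by (intro linear_mod_sign subspace_ideal) simp
  show "kappa_last n (\<iota> c) y \<in> ideal" for n c y
    unfolding kappa_last_def by (intro subspace_sign subspace_ideal ideal_mult ideal_base rels_intros)
qed

lemma b_last_properties:
  "lmap (b_last n a)" "\<forall>n a. \<forall>x\<in>ideal. b_last n a x \<in> ideal" "linear_mod ideal (\<lambda>a. b_last n a y)"
  "b_last n (\<iota> c) y \<in> ideal"
proof -
  show "lmap (b_last n a)" for n a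
    unfolding b_last_def by (intro lmap_sign lmap_minus lmap_mult_left lmap_mult_right)
  show "\<forall>n a. \<forall>x\<in>ideal. b_last n a x \<in> ideal"
    unfolding b_last_def by (intro allI ballI subspace_sign falg.subspace_diff subspace_ideal ideal_mult)
  show "linear_mod ideal (\<lambda>a. b_last n a y)" for n y
    unfolding b_last_def using linear_mod_generators(1)[where e = el and f = df and u = 1 and v = y] linear_mod_generators(1)[where e = el and f = df and u = y and v = 1]
    by (intro linear_mod_sign linear_mod_diff subspace_ideal) simp_all
  \<comment> \<open>Modulo the ideal \<open>el (\<iota> c)\<close> is a scalar, so its commutator
    with \<open>y\<close> vanishes.\<close>
  have "(- 1) ^ n * (y * (el (\<iota> c) - scl c 1) - (el (\<iota> c) - scl c 1) * y) \<in> ideal" for n c y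
    by (intro subspace_sign falg.subspace_diff subspace_ideal ideal_mult el_\<iota>)
  then show "b_last n (\<iota> c) y \<in> ideal" for n c y
    by (simp add: b_last_def algebra_simps scl_mult_left scl_mult_right)
qed

lemmas cochain_kappa = cochain_snoc[OF subspace_ideal kappa_last_properties]
  and cochain_b = cochain_snoc[OF subspace_ideal b_last_properties]
  and kappa_form_snoc = on_forms_snoc[OF subspace_ideal kappa_last_properties]
  and b_form_snoc = on_forms_snoc[OF subspace_ideal b_last_properties]

lemma cochain_mono:
  assumes "cochain N \<phi>" "\<And>x. x \<in> N \<Longrightarrow> x \<in> M"
  shows "cochain M \<phi>"
  using cochain_map[OF assms(1) lmap_ident assms(2)] by simp

lemma kappa_form_Omega_null: "\<forall>x\<in>Omega_null \<iota>. kappa_form x \<in> Omega_null \<iota>"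
proof (intro ballI on_forms_Omega_null[OF subspace_Omega_null cochain_mono[OF cochain_kappa ideal_Omega_null]])
  show "snoc_cochain kappa_last 1 [] \<in> Omega_null \<iota>"
    by (simp add: snoc_cochain_def falg.subspace_0 subspace_Omega_null)
qed

lemma b_form_Omega_null: "\<forall>x\<in>Omega_null \<iota>. b_form x \<in> Omega_null \<iota>"
proof (intro ballI on_forms_Omega_null[OF subspace_Omega_null cochain_mono[OF cochain_b ideal_Omega_null]])
  show "snoc_cochain b_last 1 [] \<in> Omega_null \<iota>"
    by (simp add: snoc_cochain_def falg.subspace_0 subspace_Omega_null)
qed

lemma nform_SucE:
  assumes "s \<in> nform (Suc p)"
  obtains \<alpha> a where "s = \<alpha> * df a" "\<alpha> \<in> homog gdeg p"
proof -
  obtain a0 as where s: "s = el a0 * prod_list (map df as)" "length as = Suc p"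
    using assms by (auto simp: nform_def)
  then obtain bs a where as: "as = bs @ [a]"
    by (cases as rule: rev_cases) auto
  show ?thesis
  proof (rule that)
    show "s = (el a0 * prod_list (map df bs)) * df a"
      by (simp add: s as mult.assoc)
    show "el a0 * prod_list (map df bs) \<in> homog gdeg p"
      using nform_homog[of a0 bs] s(2) by (simp add: as)
  qed
qed

lemma kappa_last_coset:
  assumes "\<alpha> \<in> homog gdeg p"
  shows "kappa_form (\<alpha> * df a) +o Omega_null \<iota> = (- 1) ^ p * (df a * \<alpha>) +o Omega_null \<iota>"
  using ideal_Omega_null[OF kappa_form_snoc[OF assms]]
  by (simp add: coset_eq_iff[OF subspace_Omega_null] flip: kappa_last_def)

lemma snoc_Omega_pos: "\<alpha> \<in> homog gdeg p \<Longrightarrow> \<alpha> * df a +o Omega_null \<iota> \<in> Omega_pos \<iota>"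
  using homog_mult[OF _ homog_forms(2), of \<alpha> p a] by (auto intro: homog_Omega_pos)

lemma kappa_coset:
  assumes "x +o Omega_null \<iota> \<in> Omega_pos \<iota>"
  shows "kappa \<iota> (x +o Omega_null \<iota>) = kappa_form x +o Omega_null \<iota>"
proof -
  note * = klinear_restrict_qmap[OF lmap_form_act subspace_Omega_null subspace_Omega_null
      kappa_form_Omega_null Omega_pos_eq]
  have "kappa \<iota> = restrict (qmap (Omega_null \<iota>) kappa_form) (Omega_pos \<iota>)"
    unfolding kappa_def
  proof (rule the_equality, intro conjI allI ballI)
    fix p a and \<alpha> :: "('a gen, 'k) falg" assume \<alpha>: "\<alpha> \<in> homog gdeg p"
    show "restrict (qmap (Omega_null \<iota>) kappa_form) (Omega_pos \<iota>) (\<alpha> * df a +o Omega_null \<iota>)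
      = (- 1) ^ p * (df a * \<alpha>) +o Omega_null \<iota>"
      using *(3)[OF snoc_Omega_pos[OF \<alpha>]] kappa_last_coset[OF \<alpha>] by simp
  next
    fix k assume k: "k \<in> extensional (Omega_pos \<iota>) \<and> klinear (Omega_pos \<iota>) (Omega_null \<iota>) (Omega_null \<iota>) k \<and>
     (\<forall>p. \<forall>\<alpha>\<in>homog gdeg p. \<forall>a. k (\<alpha> * df a +o Omega_null \<iota>) = (-1) ^ p * (df a * \<alpha>) +o Omega_null \<iota>)"
    show "k = restrict (qmap (Omega_null \<iota>) kappa_form) (Omega_pos \<iota>)"
    proof (rule *(4))
      fix s assume "s \<in> (\<Union>p. nform (Suc p))"
      then obtain p \<alpha> a where "s = \<alpha> * df a" "\<alpha> \<in> homog gdeg p"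
        by (auto elim: nform_SucE)
      then show "k (s +o Omega_null \<iota>) = kappa_form s +o Omega_null \<iota>"
        using k kappa_last_coset by simp
    qed (use k in auto)
  qed (use *(1,2) in auto)
  then show ?thesis
    using *(3)[OF assms] by simp
qed

text \<open>Makes iteration possible, since kappa is specified only on
  \<open>Omega_pos\<close>.\<close>

lemma kappa_form_pos:
  assumes "x +o Omega_null \<iota> \<in> Omega_pos \<iota>"
  shows "kappa_form x +o Omega_null \<iota> \<in> Omega_pos \<iota>"
proof -
  obtain y where y: "y \<in> falg.span (\<Union>p. nform (Suc p))" "x +o Omega_null \<iota> = y +o Omega_null \<iota>"
    using assms by (auto simp: Omega_pos_eq)
  have "kappa_form x +o Omega_null \<iota> = kappa_form y +o Omega_null \<iota>"
    using y(2) kappa_form_Omega_null[rule_format, of "x - y"]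
    by (simp add: coset_eq_iff[OF subspace_Omega_null] form_act_diff)
  moreover have "kappa_form y \<in> {z. z +o Omega_null \<iota> \<in> Omega_pos \<iota>}"
  proof (rule lmap_in_span[OF lmap_form_act _ _ y(1)])
    show "falg.subspace {z. z +o Omega_null \<iota> \<in> Omega_pos \<iota>}"
    proof (rule falg.subspaceI)
      fix x y :: "('a gen, 'k) falg" and c :: 'k
      show "0 \<in> {z. z +o Omega_null \<iota> \<in> Omega_pos \<iota>}"
        using homog_Omega_pos[OF falg.subspace_0[OF subspace_homog]] by simp
      assume x: "x \<in> {z. z +o Omega_null \<iota> \<in> Omega_pos \<iota>}"
      then obtain x' where x': "x' \<in> falg.span (\<Union>p. nform (Suc p))" "x +o Omega_null \<iota> = x' +o Omega_null \<iota>"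
        by (auto simp: Omega_pos_eq)
      have "scl c x +o Omega_null \<iota> = scl c x' +o Omega_null \<iota>"
        using qmap_scl_coset[OF subspace_Omega_null] x'(2) by metis
      then show "scl c x \<in> {z. z +o Omega_null \<iota> \<in> Omega_pos \<iota>}"
        using x'(1) by (auto simp: Omega_pos_eq falg.span_scale)
      assume "y \<in> {z. z +o Omega_null \<iota> \<in> Omega_pos \<iota>}"
      then obtain y' where y': "y' \<in> falg.span (\<Union>p. nform (Suc p))" "y +o Omega_null \<iota> = y' +o Omega_null \<iota>"
        by (auto simp: Omega_pos_eq)
      have "(x + y) +o Omega_null \<iota> = (x' + y') +o Omega_null \<iota>"
        using coset_add[OF subspace_Omega_null] x'(2) y'(2) by metis
      then show "x + y \<in> {z. z +o Omega_null \<iota> \<in> Omega_pos \<iota>}"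
        using x'(1) y'(1) by (auto simp: Omega_pos_eq falg.span_add)
    qed
    fix s assume "s \<in> (\<Union>p. nform (Suc p))"
    then obtain p \<alpha> a where s: "s = \<alpha> * df a" and \<alpha>: "\<alpha> \<in> homog gdeg p"
      by (auto elim: nform_SucE)
    have "(- 1) ^ p * (df a * \<alpha>) \<in> homog gdeg (Suc p)"
      using homog_mult[OF homog_forms(2) \<alpha>, of a] by (auto intro: subspace_sign[OF subspace_homog])
    then show "kappa_form s \<in> {z. z +o Omega_null \<iota> \<in> Omega_pos \<iota>}"
      using homog_Omega_pos by (simp add: s kappa_last_coset[OF \<alpha>])
  qed
  ultimately show ?thesis by simp
qed

lemma kappa_funpow_coset:
  assumes "x +o Omega_null \<iota> \<in> Omega_pos \<iota>"
  shows "(kappa \<iota> ^^ i) (x +o Omega_null \<iota>) = (kappa_form ^^ i) x +o Omega_null \<iota>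
    \<and> (kappa_form ^^ i) x +o Omega_null \<iota> \<in> Omega_pos \<iota>"
  by (induction i) (simp_all add: assms kappa_coset kappa_form_pos)

lemma b_bar_coset: "b_bar \<iota> (x +o Omega_null \<iota>) = b_form x +o Omega_null \<iota>"
proof -
  note * = klinear_restrict_qmap[OF lmap_form_act subspace_Omega_null subspace_Omega_null
      b_form_Omega_null Omega_bar_eq]
  have b0: "b_form x +o Omega_null \<iota> = Omega_null \<iota>" if "x \<in> homog gdeg 0" for x
  proof -
    have "b_form x \<in> ideal"
    proof (rule lmap_in_span[OF lmap_form_act subspace_ideal _ homog_in_span_nform[OF that]])
      fix s :: "('a gen, 'k) falg" assume "s \<in> nform 0 \<union> two_sided (rels el df)"
      then show "b_form s \<in> ideal"
        using on_forms_nform[OF subspace_ideal cochain_b, where as = "[]"]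
        by (auto simp: nform_def lspan_eq snoc_cochain_def
          intro: form_act_ideal[OF subspace_ideal cochain_b, unfolded lspan_eq] falg.span_base)
    qed
    then show ?thesis
      by (simp add: coset_eq_self_iff[OF subspace_Omega_null] ideal_Omega_null)
  qed
  have b1: "b_form (\<alpha> * df a) +o Omega_null \<iota> = (- 1) ^ p * (\<alpha> * el a - el a * \<alpha>) +o Omega_null \<iota>"
    if "\<alpha> \<in> homog gdeg p" for \<alpha> p a
    using ideal_Omega_null[OF b_form_snoc[OF that]]
    by (simp add: coset_eq_iff[OF subspace_Omega_null] flip: b_last_def)
  have bar: "x +o Omega_null \<iota> \<in> Omega_bar \<iota>" for x
    by (simp add: Omega_bar_def coset_in_quo)
  have "b_bar \<iota> = restrict (qmap (Omega_null \<iota>) b_form) (Omega_bar \<iota>)"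
    unfolding b_bar_def
  proof (rule the_equality, intro conjI allI ballI)
    fix p a and \<alpha> :: "('a gen, 'k) falg" assume \<alpha>: "\<alpha> \<in> homog gdeg p"
    show "restrict (qmap (Omega_null \<iota>) b_form) (Omega_bar \<iota>) (\<alpha> * df a +o Omega_null \<iota>)
      = (- 1) ^ p * (\<alpha> * el a - el a * \<alpha>) +o Omega_null \<iota>"
      using *(3)[OF bar] b1[OF \<alpha>] by simp
  next
    fix x :: "('a gen, 'k) falg" assume "x \<in> homog gdeg 0"
    then show "restrict (qmap (Omega_null \<iota>) b_form) (Omega_bar \<iota>) (x +o Omega_null \<iota>) = Omega_null \<iota>"
      using *(3)[OF bar] b0 by simp
  next
    fix k assume k: "k \<in> extensional (Omega_bar \<iota>) \<and> klinear (Omega_bar \<iota>) (Omega_null \<iota>) (Omega_null \<iota>) k \<and>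
     (\<forall>x\<in>homog gdeg 0. k (x +o Omega_null \<iota>) = Omega_null \<iota>) \<and>
     (\<forall>p. \<forall>\<alpha>\<in>homog gdeg p. \<forall>a. k (\<alpha> * df a +o Omega_null \<iota>) = (-1) ^ p * (\<alpha> * el a - el a * \<alpha>) +o Omega_null \<iota>)"
    show "k = restrict (qmap (Omega_null \<iota>) b_form) (Omega_bar \<iota>)"
    proof (rule *(4))
      fix s assume "s \<in> (\<Union>p. nform p)"
      then obtain p where p: "s \<in> nform p" by blast
      show "k (s +o Omega_null \<iota>) = b_form s +o Omega_null \<iota>"
      proof (cases p)
        case 0
        then have "s \<in> homog gdeg 0"
          using p nform_homog[of _ "[]"] by (auto simp: nform_def)
        then show ?thesis using k b0 by simp
      next
        case (Suc p')
        then obtain \<alpha> a where "s = \<alpha> * df a" "\<alpha> \<in> homog gdeg p'"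
          using p by (auto elim: nform_SucE)
        then show ?thesis using k b1 by simp
      qed
    qed (use k in auto)
  qed (use *(1,2) in auto)
  then show ?thesis
    using *(3)[OF bar] by simp
qed

definition B_last :: "nat \<Rightarrow> ('a gen, 'k) falg \<Rightarrow> ('a gen, 'k) falg" where
  "B_last n x = (\<Sum>i\<le>n. (kappa_form ^^ i) (d_form x))"

text \<open>The number of summands of B depends on the degree of its argument. Reading that degree
  off the list length gives one linear map for inhomogeneous forms.\<close>

abbreviation B_form :: "('a gen, 'k) falg \<Rightarrow> ('a gen, 'k) falg" where
  "B_form \<equiv> on_forms (\<lambda>a0 as. B_last (length as) (el a0 * prod_list (map df as)))"

lemma lmap_B_last: "lmap (B_last n)"
  unfolding B_last_def by (intro lmap_summation lmap_compose[OF lmap_funpow lmap_d_form] lmap_form_act)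

lemma B_last_ideal: "x \<in> ideal \<Longrightarrow> B_last n x \<in> ideal"
proof -
  have k: "kappa_form y \<in> ideal" if "y \<in> ideal" for y
    by (rule form_act_ideal[OF subspace_ideal cochain_kappa that])
  assume "x \<in> ideal"
  then have "(kappa_form ^^ i) (d_form x) \<in> ideal" for i
    by (induction i) (simp_all add: k d_form_ideal)
  then show ?thesis
    unfolding B_last_def by (intro falg.subspace_sum subspace_ideal)
qed

lemma cochain_B: "cochain ideal (\<lambda>a0 as. B_last (length as) (el a0 * prod_list (map df as)))"
  by (rule cochain_map[OF nform_cochain lmap_B_last B_last_ideal])

lemma B_form_homog:
  assumes "x \<in> homog gdeg n"
  shows "B_form x - B_last n x \<in> ideal"
proof (rule lmap_in_span[OF lmap_minus[OF lmap_form_act lmap_B_last] subspace_ideal _ homog_in_span_nform[OF assms]])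
  fix s :: "('a gen, 'k) falg" assume "s \<in> nform n \<union> two_sided (rels el df)"
  then show "B_form s - B_last n s \<in> ideal"
  proof
    assume "s \<in> nform n"
    then show ?thesis
      using on_forms_nform[OF subspace_ideal cochain_B] by (auto simp: nform_def)
  next
    assume "s \<in> two_sided (rels el df)"
    then have "s \<in> ideal" by (simp add: lspan_eq falg.span_base)
    then show ?thesis
      by (intro falg.subspace_diff subspace_ideal form_act_ideal cochain_B B_last_ideal)
  qed
qed

lemma B_form_Omega_null: "\<forall>x\<in>Omega_null \<iota>. B_form x \<in> Omega_null \<iota>"
proof (intro ballI on_forms_Omega_null[OF subspace_Omega_null cochain_mono[OF cochain_B ideal_Omega_null]])
  have "df (\<iota> 1) \<in> ideal"
    by (intro ideal_base rels_intros)
  then show "B_last (length []) (el 1 * prod_list (map df [])) \<in> Omega_null \<iota>"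
    by (simp add: B_last_def d_form_def der_var \<iota>_one ideal_Omega_null)
qed

lemma d_form_homog:
  fixes x :: "('a gen, 'k) falg"
  assumes "x \<in> homog gdeg n"
  shows "d_form x \<in> homog gdeg (Suc n)"
proof -
  have "case_gen df (\<lambda>a. 0) g \<in> (homog gdeg (gdeg g + 1) :: ('a gen, 'k) falg set)" for g :: "'a gen"
    using homog_forms(2) by (cases g) (simp_all add: falg.subspace_0 subspace_homog)
  from der_homog_raise[where \<delta> = gdeg and k = 1 and D = "case_gen df (\<lambda>a. 0)", OF homog_sign this assms] show ?thesis
    by (simp add: d_form_def)
qed

lemma B_bar_coset: "B_bar \<iota> (x +o Omega_null \<iota>) = B_form x +o Omega_null \<iota>"
proof -
  note * = klinear_restrict_qmap[OF lmap_form_act subspace_Omega_null subspace_Omega_null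
      B_form_Omega_null Omega_bar_eq]
  have B: "(\<Sum>i\<le>n. (kappa \<iota> ^^ i) (d_bar \<iota> (x +o Omega_null \<iota>))) = B_form x +o Omega_null \<iota>"
    if "x \<in> homog gdeg n" for x n
  proof -
    have d: "d_bar \<iota> (x +o Omega_null \<iota>) = d_form x +o Omega_null \<iota>"
      unfolding d_bar_def
      by (rule qmap_coset[OF lmap_d_form subspace_Omega_null subspace_Omega_null d_form_Omega_null])
    have pos: "d_form x +o Omega_null \<iota> \<in> Omega_pos \<iota>"
      by (rule homog_Omega_pos[OF d_form_homog[OF that]])
    have "(\<Sum>i\<le>n. (kappa \<iota> ^^ i) (d_bar \<iota> (x +o Omega_null \<iota>)))
        = (\<Sum>i\<le>n. (kappa_form ^^ i) (d_form x) +o Omega_null \<iota>)"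
      unfolding d by (intro sum.cong refl conjunct1[OF kappa_funpow_coset[OF pos]])
    also have "\<dots> = B_last n x +o Omega_null \<iota>"
      unfolding B_last_def by (rule coset_sum[OF subspace_Omega_null]) auto
    also have "\<dots> = B_form x +o Omega_null \<iota>"
      unfolding coset_eq_iff[OF subspace_Omega_null]
      using falg.subspace_neg[OF subspace_Omega_null ideal_Omega_null[OF B_form_homog[OF that]]] by simp
    finally show ?thesis .
  qed
  have bar: "x +o Omega_null \<iota> \<in> Omega_bar \<iota>" for x
    by (simp add: Omega_bar_def coset_in_quo)
  have "B_bar \<iota> = restrict (qmap (Omega_null \<iota>) B_form) (Omega_bar \<iota>)"
    unfolding B_bar_def
  proof (rule the_equality, intro conjI allI ballI)
    fix n and x :: "('a gen, 'k) falg" assume x: "x \<in> homog gdeg n"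
    show "restrict (qmap (Omega_null \<iota>) B_form) (Omega_bar \<iota>) (x +o Omega_null \<iota>)
      = (\<Sum>i\<le>n. (kappa \<iota> ^^ i) (d_bar \<iota> (x +o Omega_null \<iota>)))"
      unfolding B[OF x] by (rule *(3)[OF bar])
  next
    fix k assume "k \<in> extensional (Omega_bar \<iota>) \<and> klinear (Omega_bar \<iota>) (Omega_null \<iota>) (Omega_null \<iota>) k \<and>
     (\<forall>n. \<forall>x\<in>homog gdeg n. k (x +o Omega_null \<iota>) = (\<Sum>i\<le>n. (kappa \<iota> ^^ i) (d_bar \<iota> (x +o Omega_null \<iota>))))"
    note k = conjunct1[OF this] conjunct1[OF conjunct2[OF this]] conjunct2[OF conjunct2[OF this]]
    show "k = restrict (qmap (Omega_null \<iota>) B_form) (Omega_bar \<iota>)"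
    proof (rule *(4)[OF k(1,2)])
      fix s assume "s \<in> (\<Union>p. nform p)"
      then obtain a0 as where s: "s = el a0 * prod_list (map df as)"
        unfolding nform_def by blast
      show "k (s +o Omega_null \<iota>) = B_form s +o Omega_null \<iota>"
        unfolding s by (rule trans[OF k(3)[rule_format, OF nform_homog] B[OF nform_homog]])
    qed
  qed (fact *(1), fact *(2))
  then show ?thesis
    by (simp only: *(3)[OF bar])
qed

section \<open>The operators on extended forms\<close>

lemma lmap_DR_null:
  assumes D: "lmap D"
    and ideal: "\<And>x. x \<in> ideal_t \<Longrightarrow> D x \<in> DR_null \<iota>"
    and comm: "\<And>x y p q. x \<in> homog fdeg p \<Longrightarrow> y \<in> homog fdeg q \<Longrightarrow> D (x * y - (- 1) ^ (p * q) * (y * x)) \<in> DR_null \<iota>"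
    and pow: "\<And>n. D (tvar ^ n) \<in> DR_null \<iota>"
    and x: "x \<in> DR_null \<iota>"
  shows "D x \<in> DR_null \<iota>"
proof (rule lmap_in_span[OF D subspace_DR_null _ x[unfolded DR_null_def lspan_eq]])
  fix s :: "('a tgen, 'k) falg"
  assume "s \<in> two_sided (rels elt dft) \<union> supercommutators \<union> range (\<lambda>n. tvar ^ n)"
  then consider "s \<in> two_sided (rels elt dft)" | "s \<in> supercommutators" | n where "s = tvar ^ n"
    by blast
  then show "D s \<in> DR_null \<iota>"
  proof cases
    case 1
    then show ?thesis by (intro ideal) (simp add: lspan_eq falg.span_base)
  next
    case 2
    then show ?thesis unfolding supercommutators_def using comm by blast
  qed (simp add: pow)
qed

text \<open>\<open>D\<close> of a supercommutator is a signed sum of the supercommutators with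
  \<open>D x\<close> and with \<open>D y\<close>. Only the parity of the new degree is prescribed,
  so the same argument serves d, which raises degrees, and i_t, which lowers them.\<close>

lemma odd_der_supercommutator:
  assumes D: "lmap D"
    and Leibniz: "\<And>x y p. x \<in> homog fdeg p \<Longrightarrow> D (x * y) = D x * y + (- 1) ^ p * (x * D y)"
    and deg: "\<And>x p. x \<in> homog fdeg p \<Longrightarrow> \<exists>p'. odd (p + p') \<and> D x \<in> homog fdeg p'"
    and x: "x \<in> homog fdeg p" and y: "y \<in> homog fdeg q"
  shows "D (x * y - (- 1) ^ (p * q) * (y * x)) \<in> DR_null \<iota>"
proof -
  obtain p' q' where p': "odd (p + p')" "D x \<in> homog fdeg p'" and q': "odd (q + q')" "D y \<in> homog fdeg q'"
    using deg[OF x] deg[OF y] by blast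
  have "(D x * y - (- 1) ^ (p' * q) * (y * D x)) + (- 1) ^ p * (x * D y - (- 1) ^ (p * q') * (D y * x)) \<in> DR_null \<iota>"
    by (intro falg.subspace_add subspace_sign subspace_DR_null supercommutator_DR_null x y p' q')
  moreover have eq: "D (x * y - (- 1) ^ (p * q) * (y * x)) =
      D x * y + (- 1) ^ p * (x * D y) - (- 1) ^ (p * q) * (D y * x + (- 1) ^ q * (y * D x))"
    using lmap_scl[OF D, of "(- 1) ^ (p * q)" "y * x"]
    by (simp add: lmap_diff[OF D] scl_minus_one_power Leibniz[OF x] Leibniz[OF y])
  ultimately show ?thesis
    unfolding eq using p'(1) q'(1)
    by (cases "even p"; cases "even q"; cases "even p'"; cases "even q'")
      (simp_all add: algebra_simps)
qed

lemma dt_form_mult: "x \<in> homog fdeg p \<Longrightarrow> dt_form (x * y) = dt_form x * y + (- 1) ^ p * (x * dt_form y)"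
  unfolding dt_form_def by (rule der_mult)

lemma dt_form_generators: "dt_form (elt a) = dft a" "dt_form (dft a) = 0" "dt_form tvar = 0"
  by (simp_all add: dt_form_def der_var)

lemma dt_form_power: "dt_form (tvar ^ n) = 0"
  by (induction n) (simp_all add: form_1 dt_form_mult[OF homog_forms(5)] dt_form_generators)

lemma dt_form_DR_null: "x \<in> DR_null \<iota> \<Longrightarrow> dt_form x \<in> DR_null \<iota>"
proof (erule lmap_DR_null[OF lmap_dt_form, rotated 3])
  fix x y :: "('a tgen, 'k) falg" and p q n
  show "x \<in> ideal_t \<Longrightarrow> dt_form x \<in> DR_null \<iota>"
    by (intro ideal_t_DR_null dt_form_ideal)
  have D: "case_tgen (case_gen dft (\<lambda>a. 0)) 0 g \<in> (homog fdeg (fdeg g + 1) :: ('a tgen, 'k) falg set)" for g :: "'a tgen"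
    using homog_forms(4) by (auto simp: falg.subspace_0 subspace_homog split: tgen.split gen.split)
  show "dt_form (x * y - (- 1) ^ (p * q) * (y * x)) \<in> DR_null \<iota>" if "x \<in> homog fdeg p" "y \<in> homog fdeg q"
  proof (rule odd_der_supercommutator[OF lmap_dt_form dt_form_mult _ that])
    fix x :: "('a tgen, 'k) falg" and p assume x: "x \<in> homog fdeg p"
    from der_homog_raise[where \<delta> = fdeg and k = 1, OF homog_sign D x]
    show "\<exists>p'. odd (p + p') \<and> dt_form x \<in> homog fdeg p'"
      by (intro exI[of _ "p + 1"]) (simp add: dt_form_def)
  qed
  show "dt_form (tvar ^ n) \<in> DR_null \<iota>"
    by (simp add: dt_form_power falg.subspace_0 subspace_DR_null)
qed

text \<open>The derivation \<open>d/dt\<close> is even, so its Leibniz rule is that of the trivial grading.\<close>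

lemma ddt_form_mult: "ddt_form (x * y) = ddt_form x * y + x * ddt_form y"
proof -
  have "x \<in> homog (\<lambda>_. 0) 0"
    by (simp add: homog_def wdeg_def)
  from der_mult[OF this] show ?thesis
    by (simp add: ddt_form_def)
qed

lemma ddt_form_generators: "ddt_form (elt a) = 0" "ddt_form (dft a) = 0" "ddt_form tvar = 1"
  by (simp_all add: ddt_form_def der_var)

lemma ddt_form_power: "ddt_form (tvar ^ n :: ('a tgen, 'k) falg) = of_nat n * tvar ^ (n - 1)"
proof (induction n)
  case (Suc n)
  have "tvar * (of_nat n * tvar ^ (n - 1)) = of_nat n * (tvar * tvar ^ (n - 1) :: ('a tgen, 'k) falg)"
    by (metis mult.assoc mult_of_nat_commute)
  then show ?case
    using Suc by (cases n) (simp_all add: ddt_form_mult ddt_form_generators algebra_simps)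
qed (simp add: form_1)

lemma ddt_form_ideal:
  assumes "x \<in> ideal_t"
  shows "ddt_form x \<in> ideal_t"
proof -
  have "der (\<lambda>g. (- 1) ^ 0) (case_tgen (\<lambda>g. 0) 1) x \<in> ideal_t"
  proof (rule der_ideal[OF _ assms, where \<delta> = "\<lambda>_. 0"])
    fix r :: "('a tgen, 'k) falg" assume "r \<in> rels elt dft"
    then have "ddt_form r = 0"
      by (cases rule: rels_cases)
        (simp_all add: lmap_add[OF lmap_ddt_form] lmap_scl[OF lmap_ddt_form] lmap_diff[OF lmap_ddt_form]
          ddt_form_mult ddt_form_generators form_1)
    then show "(\<exists>p. r \<in> homog (\<lambda>_. 0) p) \<and> der (\<lambda>g. (- 1) ^ 0) (case_tgen (\<lambda>g. 0) 1) r \<in> ideal_t"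
      by (auto simp: ddt_form_def homog_def wdeg_def falg.subspace_0 subspace_ideal)
  qed
  then show ?thesis by (simp add: ddt_form_def)
qed

lemma ddt_form_DR_null: "x \<in> DR_null \<iota> \<Longrightarrow> ddt_form x \<in> DR_null \<iota>"
proof (erule lmap_DR_null[OF lmap_ddt_form, rotated 3])
  fix x y :: "('a tgen, 'k) falg" and p q n
  show "x \<in> ideal_t \<Longrightarrow> ddt_form x \<in> DR_null \<iota>"
    by (intro ideal_t_DR_null ddt_form_ideal)
  have D: "case_tgen (\<lambda>g. 0) 1 g \<in> (homog fdeg (fdeg g + 0) :: ('a tgen, 'k) falg set)" for g :: "'a tgen"
    by (cases g) (simp_all add: falg.subspace_0 subspace_homog homog_1)
  have deg: "ddt_form x \<in> homog fdeg p" if "x \<in> homog fdeg p" for p and x :: "('a tgen, 'k) falg"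
    using der_homog_raise[where \<delta> = fdeg and k = 0, OF homog_1 D that] by (simp add: ddt_form_def)
  show "ddt_form (x * y - (- 1) ^ (p * q) * (y * x)) \<in> DR_null \<iota>" if x: "x \<in> homog fdeg p" and y: "y \<in> homog fdeg q"
  proof -
    have "(ddt_form x * y - (- 1) ^ (p * q) * (y * ddt_form x))
       + (x * ddt_form y - (- 1) ^ (p * q) * (ddt_form y * x)) \<in> DR_null \<iota>"
      by (intro falg.subspace_add subspace_DR_null supercommutator_DR_null x y deg)
    then show ?thesis
      using lmap_scl[OF lmap_ddt_form, of "(- 1) ^ (p * q)" "y * x"]
      by (simp add: lmap_diff[OF lmap_ddt_form] scl_minus_one_power ddt_form_mult algebra_simps)
  qed
  show "ddt_form (tvar ^ n) \<in> DR_null \<iota>"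
    unfolding ddt_form_power
    by (simp add: falg.subspace_scale subspace_DR_null power_DR_null flip: scl_of_nat)
qed

lemma it_form_mult: "x \<in> homog fdeg p \<Longrightarrow> it_form (x * y) = it_form x * y + (- 1) ^ p * (x * it_form y)"
  unfolding it_form_def by (rule der_mult)

lemma it_form_generators: "it_form (elt a) = 0" "it_form (dft a) = elt a * tvar - tvar * elt a" "it_form tvar = 0"
  by (simp_all add: it_form_def der_var)

lemma it_form_power: "it_form (tvar ^ n) = 0"
  by (induction n) (simp_all add: form_1 it_form_mult[OF homog_forms(5)] it_form_generators)

text \<open>i_t kills the relations for \<open>elt\<close> and sends each relation for
  \<open>dft\<close> into a commutator of \<open>tvar\<close> with the corresponding relation for
  \<open>elt\<close>. For the Leibniz relation this rests on
  \<open>[ab, t] = [a, t] b + a [b, t]\<close>.\<close>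

lemma it_form_ideal:
  assumes "x \<in> ideal_t"
  shows "it_form x \<in> ideal_t"
  unfolding it_form_def
proof (rule der_ideal[OF _ assms])
  fix r :: "('a tgen, 'k) falg" assume r: "r \<in> rels elt dft"
  have comm: "y * tvar - tvar * y \<in> ideal_t" if "y \<in> ideal_t" for y
    using that by (intro falg.subspace_diff subspace_ideal ideal_mult)
  note simps = lmap_add[OF lmap_it_form] lmap_scl[OF lmap_it_form] lmap_diff[OF lmap_it_form]
    it_form_mult[OF homog_forms(3)] it_form_mult[OF homog_forms(4)] it_form_generators form_1
  have "it_form r \<in> ideal_t"
    using r
  proof (cases rule: rels_cases)
    case (df_add a b)
    show ?thesis
      unfolding df_add using comm[OF ideal_base[OF rels_intros(1)[where f = dft]], of a b] by (simp add: simps algebra_simps)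
  next
    case (df_scl c a)
    show ?thesis
      unfolding df_scl using comm[OF ideal_base[OF rels_intros(2)[where f = dft]], of c a]
      by (simp add: simps algebra_simps scl_mult_left scl_mult_right falg.scale_right_diff_distrib)
  next
    case (df_const c)
    show ?thesis
      unfolding df_const using comm[OF el_\<iota>[where f = dft], of c]
      by (simp add: simps algebra_simps scl_mult_left scl_mult_right)
  next
    case (df_mult a b)
    show ?thesis
      unfolding df_mult using comm[OF ideal_base[OF rels_intros(3)[where f = dft]], of a b] by (simp add: simps algebra_simps)
  qed (simp_all add: simps falg.subspace_0 subspace_ideal)
  then show "(\<exists>p. r \<in> homog fdeg p) \<and> der (\<lambda>g. (- 1) ^ fdeg g)
     (case_tgen (case_gen (\<lambda>a. 0) (\<lambda>a. elt a * tvar - tvar * elt a)) 0) r \<in> ideal_t"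
    using form_rels_homog[OF homog_forms(3,4) r] by (simp add: it_form_def)
qed

lemma it_form_DR_null: "x \<in> DR_null \<iota> \<Longrightarrow> it_form x \<in> DR_null \<iota>"
proof (erule lmap_DR_null[OF lmap_it_form, rotated 3])
  fix x y :: "('a tgen, 'k) falg" and p q n
  show "x \<in> ideal_t \<Longrightarrow> it_form x \<in> DR_null \<iota>"
    by (intro ideal_t_DR_null it_form_ideal)
  let ?D = "case_tgen (case_gen (\<lambda>a. 0) (\<lambda>a. elt a * tvar - tvar * elt a)) 0 :: 'a tgen \<Rightarrow> ('a tgen, 'k) falg"
  have "elt a * tvar - tvar * elt a \<in> (homog fdeg 0 :: ('a tgen, 'k) falg set)" for a :: 'a
    using homog_mult[OF homog_forms(3) homog_forms(5)] homog_mult[OF homog_forms(5) homog_forms(3)]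
    by (intro falg.subspace_diff subspace_homog) simp_all
  then have D: "?D g \<in> homog fdeg (fdeg g - 1)" "fdeg g = 0 \<Longrightarrow> ?D g = 0" for g
    by (auto simp: falg.subspace_0 subspace_homog split: tgen.split gen.split)
  show "it_form (x * y - (- 1) ^ (p * q) * (y * x)) \<in> DR_null \<iota>" if "x \<in> homog fdeg p" "y \<in> homog fdeg q"
  proof (rule odd_der_supercommutator[OF lmap_it_form it_form_mult _ that])
    fix x y :: "('a tgen, 'k) falg" and p assume x: "x \<in> homog fdeg p"
    note lower = der_homog_lower[where \<delta> = fdeg and D = ?D and \<sigma> = "\<lambda>g. (- 1) ^ fdeg g", OF homog_sign D x, folded it_form_def]
    show "\<exists>p'. odd (p + p') \<and> it_form x \<in> homog fdeg p'"
    proof (cases p)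
      case 0
      then show ?thesis
        \<comment> \<open>The image is 0 in this case, hence also of the odd degree 1.\<close>
        using lower(2) by (intro exI[of _ 1]) (simp add: falg.subspace_0 subspace_homog)
    next
      case (Suc p')
      then show ?thesis
        using lower(1) by (intro exI[of _ p']) simp
    qed
  qed
  show "it_form (tvar ^ n) \<in> DR_null \<iota>"
    by (simp add: it_form_power falg.subspace_0 subspace_DR_null)
qed

section \<open>The Tsygan map\<close>

text \<open>Weak compositions of \<open>q\<close> into \<open>n + 1\<close> parts: the exponents of
  \<open>t\<close> available to a form of degree \<open>n\<close>.\<close>

definition compositions :: "nat \<Rightarrow> nat \<Rightarrow> nat list set" where
  "compositions n q = {ks. length ks = Suc n \<and> sum_list ks = q}"

lemma finite_compositions: "finite (compositions n q)"
proof (rule finite_subset)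
  show "compositions n q \<subseteq> {ks. set ks \<subseteq> {..q} \<and> length ks = Suc n}"
    using member_le_sum_list by (fastforce simp: compositions_def)
qed (simp add: finite_lists_length_eq)

definition tsygan_sum :: "nat \<Rightarrow> 'a \<Rightarrow> 'a list \<Rightarrow> ('a tgen, 'k) falg" where
  "tsygan_sum q a0 as = (\<Sum>ks\<in>compositions (length as) q. tsygan_term a0 as ks)"

text \<open>Zero outside degree \<open>p\<close>, so that the component of E in bidegree
  \<open>(p, q)\<close> is a single map on all forms.\<close>

definition tsygan_cochain :: "nat \<Rightarrow> nat \<Rightarrow> 'a \<Rightarrow> 'a list \<Rightarrow> ('a tgen, 'k) falg" where
  "tsygan_cochain p q a0 as =
    (if length as = p then scl (\<rho> (1 / fact (q + p))) (tsygan_sum q a0 as) else 0)"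

abbreviation tsygan_form :: "nat \<Rightarrow> nat \<Rightarrow> ('a gen, 'k) falg \<Rightarrow> ('a tgen, 'k) falg" where
  "tsygan_form p q \<equiv> on_forms (tsygan_cochain p q)"

lemma tsygan_value_eq: "tsygan_value \<rho> \<iota> a0 as p q = tsygan_cochain p q a0 as +o DR_null \<iota>"
  by (auto simp: tsygan_value_def tsygan_cochain_def tsygan_sum_def compositions_def falg.scale_sum_right intro!: arg_cong[where f = "\<lambda>x. x +o _"] sum.cong)

text \<open>The guard on lengths matters because \<open>map2\<close> truncates: entries of a longer
  list would be dropped, and the term would be neither linear nor normalized in them.\<close>

lemma tsygan_term_cochain:
  "cochain ideal_t (\<lambda>a0 as. if Suc (length as) = length ks then tsygan_term a0 as ks else 0)"
    (is "cochain ideal_t ?\<phi>")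
  unfolding cochain_def
proof (intro conjI allI)
  let ?P = "\<lambda>as ks. prod_list (map2 (\<lambda>a k. dft a * tvar ^ k) as ks) :: ('a tgen, 'k) falg"
  show "linear_mod ideal_t (\<lambda>a. ?\<phi> a as)" for as
    by (cases "Suc (length as) = length ks")
      (use linear_mod_generators(1)[where e = elt and f = dft and u = 1 and v = "tvar ^ hd ks * ?P as (tl ks)"]
        in \<open>simp_all add: tsygan_term_def mult.assoc linear_mod_null falg.subspace_0 subspace_ideal\<close>)
  fix a0 xs ys
  have slot: "linear_mod ideal_t (\<lambda>a. ?\<phi> a0 (xs @ a # ys)) \<and> (\<forall>c. ?\<phi> a0 (xs @ \<iota> c # ys) \<in> ideal_t)"
  proof (cases "Suc (Suc (length xs + length ys)) = length ks")
    case False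
    then show ?thesis by (simp add: linear_mod_null falg.subspace_0 subspace_ideal)
  next
    case True
    define k1 k k2 where "k1 = take (length xs) (tl ks)" and "k = tl ks ! length xs"
      and "k2 = drop (Suc (length xs)) (tl ks)"
    have ks: "tl ks = k1 @ k # k2" "length k1 = length xs"
      using True id_take_nth_drop[of "length xs" "tl ks"] by (auto simp: k1_def k_def k2_def)
    have "?\<phi> a0 (xs @ a # ys) = (elt a0 * tvar ^ hd ks * ?P xs k1) * dft a * (tvar ^ k * ?P ys k2)" for a
      using True ks(2) by (simp add: tsygan_term_def ks(1) mult.assoc)
    then show ?thesis
      using linear_mod_generators(2)[where e = elt and f = dft] ideal_mult_generator[OF rels_intros(7)[where e = elt and f = dft]]
      by presburger
  qed
  show "linear_mod ideal_t (\<lambda>a. ?\<phi> a0 (xs @ a # ys))" "?\<phi> a0 (xs @ \<iota> c # ys) \<in> ideal_t" for c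
    using slot by blast+
qed

lemma cochain_tsygan_sum: "cochain ideal_t (tsygan_sum q)"
proof -
  let ?\<phi> = "\<lambda>p a0 as. \<Sum>ks\<in>compositions p q. if Suc (length as) = length ks then tsygan_term a0 as ks else 0"
  have \<phi>: "cochain ideal_t (?\<phi> p)" for p
    by (intro cochain_sum subspace_ideal tsygan_term_cochain)
  have eq: "tsygan_sum q a0 as = ?\<phi> p a0 as" if "length as = p" for a0 as p
    using that by (auto simp: tsygan_sum_def compositions_def intro!: sum.cong)
  show ?thesis
    unfolding cochain_def
  proof (intro conjI allI)
    show "linear_mod ideal_t (\<lambda>a. tsygan_sum q a as)" for as
      using cochainD(1)[OF \<phi>] by (simp only: eq[OF refl])
    show "linear_mod ideal_t (\<lambda>a. tsygan_sum q a0 (xs @ a # ys))" for a0 xs ys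
    proof -
      have "(\<lambda>a. tsygan_sum q a0 (xs @ a # ys)) = (\<lambda>a. ?\<phi> (Suc (length xs + length ys)) a0 (xs @ a # ys))"
        by (intro ext eq) simp
      then show ?thesis
        using cochainD(2)[OF \<phi>] by (simp only:)
    qed
    show "tsygan_sum q a0 (xs @ \<iota> c # ys) \<in> ideal_t" for a0 xs ys c
      using cochainD(3)[OF \<phi>] by (simp only: eq[OF refl])
  qed
qed

lemma cochain_tsygan: "cochain ideal_t (tsygan_cochain p q)"
proof -
  have "cochain ideal_t (\<lambda>a0 as. (if length as = p then scl (\<rho> (1 / fact (q + p))) else (\<lambda>x. 0)) (tsygan_sum q a0 as))"
    by (rule cochain_map[where F = "\<lambda>n. if n = p then scl _ else (\<lambda>x. 0)", OF cochain_tsygan_sum])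
      (auto intro: lmap_scale lmap_0 falg.subspace_scale falg.subspace_0 subspace_ideal)
  also have "(\<lambda>a0 as. (if length as = p then scl (\<rho> (1 / fact (q + p))) else (\<lambda>x. 0)) (tsygan_sum q a0 as)) = tsygan_cochain p q"
    by (auto simp: fun_eq_iff tsygan_cochain_def)
  finally show ?thesis .
qed

text \<open>The form 1 goes to a multiple of a power of \<open>t\<close>, which is zero because the
  target is reduced by the polynomials in \<open>t\<close>.\<close>

lemma tsygan_form_Omega_null: "\<forall>x\<in>Omega_null \<iota>. tsygan_form p q x \<in> DR_null \<iota>"
proof (intro ballI on_forms_Omega_null[OF subspace_DR_null cochain_mono[OF cochain_tsygan ideal_t_DR_null]])
  have "tsygan_term 1 [] ks \<in> DR_null \<iota>" for ks
  proof -
    have "(elt 1 - 1) * tvar ^ hd ks + tvar ^ hd ks \<in> DR_null \<iota>"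
      by (intro falg.subspace_add subspace_DR_null power_DR_null ideal_t_DR_null ideal_mult ideal_base rels_intros)
    then show ?thesis by (simp add: tsygan_term_def algebra_simps)
  qed
  then show "tsygan_cochain p q 1 [] \<in> DR_null \<iota>"
    by (auto simp: tsygan_cochain_def tsygan_sum_def intro!: falg.subspace_sum falg.subspace_scale subspace_DR_null falg.subspace_0)
qed

lemma tsygan_term_homog:
  assumes "length ks = Suc (length as)"
  shows "tsygan_term a0 as ks \<in> homog fdeg (length as)" "tsygan_term a0 as ks \<in> homog tdeg (sum_list ks)"
proof -
  have t: "tvar ^ k \<in> homog fdeg 0" "tvar ^ k \<in> homog tdeg k" for k
    using homog_power[OF homog_forms(5), of k] homog_power[OF homog_forms(8), of k] by simp_all
  have P: "length as = length l \<Longrightarrow> prod_list (map2 (\<lambda>a k. dft a * tvar ^ k) as l) \<in> homog fdeg (length as)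
      \<and> prod_list (map2 (\<lambda>a k. dft a * tvar ^ k) as l) \<in> homog tdeg (sum_list l)" for l
  proof (induction as l rule: list_induct2)
    case (Cons a as k l)
    then show ?case
      using homog_mult[OF homog_mult[OF homog_forms(4) t(1)]] homog_mult[OF homog_mult[OF homog_forms(7) t(2)]]
      by fastforce
  qed (simp add: homog_1)
  obtain k0 l where ks: "ks = k0 # l" and l: "length as = length l"
    using assms by (cases ks) auto
  have P: "prod_list (map2 (\<lambda>a k. dft a * tvar ^ k) as l) \<in> homog fdeg (length as)"
    "prod_list (map2 (\<lambda>a k. dft a * tvar ^ k) as l) \<in> homog tdeg (sum_list l)"
    using P[OF l] by auto
  from homog_mult[OF homog_mult[OF homog_forms(3) t(1)] P(1)]
  show "tsygan_term a0 as ks \<in> homog fdeg (length as)"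
    by (simp add: tsygan_term_def ks)
  from homog_mult[OF homog_mult[OF homog_forms(6) t(2)] P(2)]
  show "tsygan_term a0 as ks \<in> homog tdeg (sum_list ks)"
    by (simp add: tsygan_term_def ks)
qed

lemma tsygan_form_homog: "tsygan_form p q x \<in> homog fdeg p \<inter> homog tdeg q"
proof (rule form_act_closed)
  show sub: "falg.subspace (homog fdeg p \<inter> homog tdeg q)"
    by (intro falg.subspace_inter subspace_homog)
  show "tsygan_cochain p q a0 as \<in> homog fdeg p \<inter> homog tdeg q" for a0 as
    unfolding tsygan_cochain_def tsygan_sum_def
    using tsygan_term_homog[of _ as a0]
    by (auto simp: compositions_def intro!: falg.subspace_sum falg.subspace_scale subspace_homog falg.subspace_0)
qed

text \<open>Supplies the finiteness in the de Rham degree that \<open>DR_hat\<close>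
  demands.\<close>

lemma tsygan_form_eq_0:
  assumes "p \<notin> wdeg gdeg ` Poly_Mapping.keys x"
  shows "tsygan_form p q x = 0"
  unfolding form_act_def lin_def
proof (rule sum.neutral, rule ballI)
  fix w assume "w \<in> Poly_Mapping.keys x"
  then have "word_act (tsygan_cochain p q) (letters w) 1 [] = 0"
    using assms by (intro word_act_degree[of p]) (auto simp: tsygan_cochain_def wdeg_def)
  then show "scl (Poly_Mapping.lookup x w) (word_act (tsygan_cochain p q) (letters w) 1 []) = 0"
    by simp
qed

text \<open>From here on, statements about E are congruences for \<open>tsygan_form\<close> modulo
  \<open>DR_null\<close>.\<close>

lemma tsygan_coset: "tsygan \<rho> \<iota> (x +o Omega_null \<iota>) p q = tsygan_form p q x +o DR_null \<iota>"
proof -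
  note * = klinear_restrict_qmap[OF lmap_form_act subspace_Omega_null subspace_DR_null
      tsygan_form_Omega_null Omega_bar_eq]
  define E where "E = restrict (\<lambda>\<omega> p q. qmap (DR_null \<iota>) (tsygan_form p q) \<omega>) (Omega_bar \<iota>)"
  have bar: "x +o Omega_null \<iota> \<in> Omega_bar \<iota>" for x
    by (simp add: Omega_bar_def coset_in_quo)
  have E: "E (x +o Omega_null \<iota>) p q = tsygan_form p q x +o DR_null \<iota>" for x p q
    using *(3)[OF bar, of p q x] bar[of x] by (simp add: E_def)
  have nf: "tsygan_form p q (el a0 * prod_list (map df as)) +o DR_null \<iota> = tsygan_value \<rho> \<iota> a0 as p q" for a0 as p q
    using ideal_t_DR_null[OF on_forms_nform[OF subspace_ideal cochain_tsygan]]
    by (simp add: tsygan_value_eq coset_eq_iff[OF subspace_DR_null])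
  have "tsygan \<rho> \<iota> = E"
    unfolding tsygan_def
  proof (rule the_equality, intro conjI allI)
    show "E \<in> extensional (Omega_bar \<iota>)" by (simp add: E_def)
    show "E ` Omega_bar \<iota> \<subseteq> DR_hat \<iota>"
    proof (rule image_subsetI)
      fix X assume "X \<in> Omega_bar \<iota>"
      then obtain x where X: "X = x +o Omega_null \<iota>"
        by (auto simp: Omega_bar_def quo_def)
      have "{p. \<exists>q. E X p q \<noteq> DR_null \<iota>} \<subseteq> wdeg gdeg ` Poly_Mapping.keys x"
        using tsygan_form_eq_0[of _ x] by (auto simp: X E)
      then have "finite {p. \<exists>q. E X p q \<noteq> DR_null \<iota>}"
        by (rule finite_subset) simp
      moreover have "E X p q \<in> DR_bar \<iota> p q" for p q
        unfolding X E DR_bar_def by (rule CollectI, rule exI, rule conjI[OF refl tsygan_form_homog])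
      ultimately show "E X \<in> DR_hat \<iota>"
        by (simp add: DR_hat_def)
    qed
    show "klinear (Omega_bar \<iota>) (Omega_null \<iota>) (DR_null \<iota>) (\<lambda>\<omega>. E \<omega> p q)" for p q
      by (rule klinear_qmap[where f = "tsygan_form p q", OF lmap_form_act subspace_Omega_null subspace_DR_null
            bspec[OF tsygan_form_Omega_null]])
        (auto simp: E_def Omega_bar_def quo_def coset_add[OF subspace_Omega_null] qmap_scl_coset[OF subspace_Omega_null])
    show "E (el a0 * prod_list (map df as) +o Omega_null \<iota>) = tsygan_value \<rho> \<iota> a0 as" for a0 as
      by (intro ext) (simp add: E nf)
  next
    fix E' assume "E' \<in> extensional (Omega_bar \<iota>) \<and> E' ` Omega_bar \<iota> \<subseteq> DR_hat \<iota> \<and>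
      (\<forall>p q. klinear (Omega_bar \<iota>) (Omega_null \<iota>) (DR_null \<iota>) (\<lambda>\<omega>. E' \<omega> p q)) \<and>
      (\<forall>a0 as. E' (el a0 * prod_list (map df as) +o Omega_null \<iota>) = tsygan_value \<rho> \<iota> a0 as)"
    note E' = conjunct1[OF this] conjunct1[OF conjunct2[OF conjunct2[OF this]], rule_format]
      conjunct2[OF conjunct2[OF conjunct2[OF this]], rule_format]
    show "E' = E"
    proof (rule extensionalityI[of _ "Omega_bar \<iota>"])
      fix X assume "X \<in> Omega_bar \<iota>"
      then obtain x where x: "x \<in> falg.span (\<Union>p. nform p)" "X = x +o Omega_null \<iota>"
        by (auto simp: Omega_bar_eq)
      have "E' (x +o Omega_null \<iota>) p q = tsygan_form p q x +o DR_null \<iota>" for p q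
      proof (rule klinear_determined[where g = "\<lambda>X. E' X p q", OF _ lmap_form_act subspace_Omega_null subspace_DR_null bar _ x(1)])
        show "klinear (Omega_bar \<iota>) (Omega_null \<iota>) (DR_null \<iota>) (\<lambda>\<omega>. E' \<omega> p q)"
          by (rule E'(2))
        fix s assume "s \<in> (\<Union>p. nform p)"
        then obtain a0 as where "s = el a0 * prod_list (map df as)"
          unfolding nform_def by blast
        then show "E' (s +o Omega_null \<iota>) p q = tsygan_form p q s +o DR_null \<iota>"
          using nf[of p q a0 as] by (simp add: E'(3))
      qed
      then show "E' X = E X"
        by (intro ext) (simp add: x(2) E)
    qed (simp_all add: E'(1) E_def)
  qed
  then show ?thesis by (simp add: E)
qed

section \<open>The three identities\<close>

lemma compositions_0: "compositions 0 q = {[q]}"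
  by (auto simp: compositions_def length_Suc_conv)

lemma compositions_Suc_0: "compositions (Suc n) 0 = (\<lambda>ks. ks @ [0]) ` compositions n 0"
proof (intro equalityI subsetI)
  fix ks assume "ks \<in> compositions (Suc n) 0"
  then show "ks \<in> (\<lambda>ks. ks @ [0]) ` compositions n 0"
    by (cases ks rule: rev_cases) (auto simp: compositions_def)
qed (auto simp: compositions_def)

text \<open>Split by the last part. If it is zero, the word ends in a differential; if it is
  positive, lowering it by one strips a final \<open>t\<close>. These are the two terms of
  \<open>tsygan_sum_snoc_Suc\<close>.\<close>

lemma compositions_Suc_Suc:
  "compositions (Suc n) (Suc q) =
    (\<lambda>ks. ks @ [0]) ` compositions n (Suc q) \<union> (\<lambda>ks. butlast ks @ [Suc (last ks)]) ` compositions (Suc n) q"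
proof (intro equalityI subsetI)
  fix ks assume ks: "ks \<in> compositions (Suc n) (Suc q)"
  then obtain ls k where ls: "ks = ls @ [k]"
    by (cases ks rule: rev_cases) (auto simp: compositions_def)
  show "ks \<in> (\<lambda>ks. ks @ [0]) ` compositions n (Suc q) \<union> (\<lambda>ks. butlast ks @ [Suc (last ks)]) ` compositions (Suc n) q"
  proof (cases k)
    case 0
    then show ?thesis using ks ls by (auto simp: compositions_def)
  next
    case (Suc k')
    then have "ks = butlast (ls @ [k']) @ [Suc (last (ls @ [k']))]" "ls @ [k'] \<in> compositions (Suc n) q"
      using ks ls by (auto simp: compositions_def)
    then show ?thesis by blast
  qed
next
  fix ks assume "ks \<in> (\<lambda>ks. ks @ [0]) ` compositions n (Suc q) \<union> (\<lambda>ks. butlast ks @ [Suc (last ks)]) ` compositions (Suc n) q"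
  then consider ls where "ks = ls @ [0]" "ls \<in> compositions n (Suc q)"
    | ls where "ks = butlast ls @ [Suc (last ls)]" "ls \<in> compositions (Suc n) q"
    by blast
  then show "ks \<in> compositions (Suc n) (Suc q)"
  proof cases
    case (2 ls)
    then show ?thesis
      by (cases ls rule: rev_cases) (auto simp: compositions_def)
  qed (auto simp: compositions_def)
qed

lemma tsygan_term_snoc:
  "length ks = Suc (length as) \<Longrightarrow> tsygan_term a0 (as @ [a]) (ks @ [k]) = tsygan_term a0 as ks * (dft a * tvar ^ k)"
  by (cases ks) (simp_all add: tsygan_term_def mult.assoc)

lemma tsygan_sum_Nil: "tsygan_sum q a0 [] = elt a0 * tvar ^ q"
  by (simp add: tsygan_sum_def compositions_0 tsygan_term_def)

lemma tsygan_sum_snoc_0: "tsygan_sum 0 a0 (as @ [a]) = tsygan_sum 0 a0 as * dft a"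
proof -
  have "tsygan_sum 0 a0 (as @ [a]) = (\<Sum>ks\<in>compositions (length as) 0. tsygan_term a0 (as @ [a]) (ks @ [0]))"
    unfolding tsygan_sum_def by (simp add: compositions_Suc_0 sum.reindex inj_on_def)
  also have "\<dots> = (\<Sum>ks\<in>compositions (length as) 0. tsygan_term a0 as ks * dft a)"
    by (rule sum.cong) (auto simp: tsygan_term_snoc compositions_def)
  finally show ?thesis
    by (simp add: tsygan_sum_def sum_distrib_right)
qed

lemma tsygan_sum_snoc_Suc:
  "tsygan_sum (Suc q) a0 (as @ [a]) = tsygan_sum q a0 (as @ [a]) * tvar + tsygan_sum (Suc q) a0 as * dft a"
proof -
  let ?b = "\<lambda>ks. butlast ks @ [Suc (last ks)]" and ?z = "\<lambda>ks. ks @ [0 :: nat]"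
  let ?C = "compositions (length as) (Suc q)" and ?C' = "compositions (Suc (length as)) q"
  have b: "tsygan_term a0 (as @ [a]) (?b ks) = tsygan_term a0 (as @ [a]) ks * tvar" if ks: "ks \<in> ?C'" for ks
  proof -
    obtain ls k where "ks = ls @ [k]" "length ls = Suc (length as)"
      using ks by (cases ks rule: rev_cases) (auto simp: compositions_def)
    then show ?thesis
      by (simp add: tsygan_term_snoc mult.assoc flip: power_Suc2)
  qed
  have inj: "inj_on ?b ?C'"
  proof (rule inj_onI)
    fix ks ls assume "ks \<in> ?C'" "ls \<in> ?C'" "?b ks = ?b ls"
    then show "ks = ls"
      by (cases ks rule: rev_cases; cases ls rule: rev_cases) (auto simp: compositions_def)
  qed
  have "tsygan_sum (Suc q) a0 (as @ [a]) = (\<Sum>ks\<in>?z ` ?C \<union> ?b ` ?C'. tsygan_term a0 (as @ [a]) ks)"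
    by (simp add: tsygan_sum_def compositions_Suc_Suc)
  also have "\<dots> = (\<Sum>ks\<in>?C. tsygan_term a0 (as @ [a]) (?z ks)) + (\<Sum>ks\<in>?C'. tsygan_term a0 (as @ [a]) (?b ks))"
    by (subst sum.union_disjoint) (auto simp: finite_compositions sum.reindex[OF inj] sum.reindex[of ?z] inj_on_def)
  also have "(\<Sum>ks\<in>?C. tsygan_term a0 (as @ [a]) (?z ks)) = (\<Sum>ks\<in>?C. tsygan_term a0 as ks * dft a)"
    by (rule sum.cong) (auto simp: tsygan_term_snoc compositions_def)
  also have "(\<Sum>ks\<in>?C'. tsygan_term a0 (as @ [a]) (?b ks)) = (\<Sum>ks\<in>?C'. tsygan_term a0 (as @ [a]) ks * tvar)"
    by (rule sum.cong) (auto simp: b)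
  finally show ?thesis
    by (simp add: tsygan_sum_def sum_distrib_right add.commute)
qed

lemma \<rho>_0: "\<rho> 0 = 0"
  using \<rho>_add[of 0 0] by simp

lemma \<rho>_of_nat: "\<rho> (of_nat n) = of_nat n"
  by (induction n) (simp_all add: \<rho>_0 \<rho>_add \<rho>_one)

text \<open>Absorbs the multiplicity \<open>q + n + 1\<close> produced by d/dt and by B into the
  factorial.\<close>

lemma scl_fact_Suc: "scl (\<rho> (1 / fact (Suc n))) (of_nat (Suc n) * x) = scl (\<rho> (1 / fact n)) x"
proof -
  have "\<rho> (1 / fact (Suc n)) * of_nat (Suc n) = \<rho> (1 / fact (Suc n) * of_nat (Suc n))"
    by (simp only: \<rho>_mult \<rho>_of_nat)
  also have "1 / fact (Suc n) * of_nat (Suc n) = (1 / fact n :: rat)"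
    by (simp add: divide_simps)
  finally show ?thesis
    by (simp only: falg.scale_scale flip: scl_of_nat)
qed

lemma forms_agree:
  assumes F: "lmap F" and G: "lmap G" and M: "falg.subspace M"
    and null: "\<And>x. x \<in> ideal \<Longrightarrow> F x \<in> M" "\<And>x. x \<in> ideal \<Longrightarrow> G x \<in> M"
    and nf: "\<And>a0 as. F (el a0 * prod_list (map df as)) - G (el a0 * prod_list (map df as)) \<in> M"
  shows "F x - G x \<in> M"
proof (rule lmap_in_span[OF lmap_minus[OF F G] M _ form_in_span_nform])
  fix s :: "('a gen, 'k) falg" assume "s \<in> (\<Union>p. nform p) \<union> two_sided (rels el df)"
  then consider "s \<in> (\<Union>p. nform p)" | "s \<in> two_sided (rels el df)" by blast
  then show "F s - G s \<in> M"
  proof cases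
    case 1
    then obtain a0 as where "s = el a0 * prod_list (map df as)"
      unfolding nform_def by blast
    then show ?thesis using nf[of a0 as] by simp
  next
    case 2
    then have "s \<in> ideal" by (simp add: lspan_eq falg.span_base)
    then show ?thesis by (intro falg.subspace_diff M null)
  qed
qed

lemma tsygan_form_nform:
  "tsygan_form p q (el a0 * prod_list (map df as)) - tsygan_cochain p q a0 as \<in> ideal_t"
  by (rule on_forms_nform[OF subspace_ideal cochain_tsygan])

lemma tsygan_form_ideal: "x \<in> ideal \<Longrightarrow> tsygan_form p q x \<in> ideal_t"
  by (rule form_act_ideal[OF subspace_ideal cochain_tsygan])

subsection \<open>The derivation \<open>d/dt\<close>\<close>

text \<open>In the recursion both terms acquire the same factor from the induction hypotheses and
  recombine; the extra copy due to the derivative of the final \<open>t\<close> raises the factor by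
  one. The inner induction on \<open>q\<close> is there because the recursion lowers
  \<open>q\<close> for an unchanged list.\<close>

lemma ddt_tsygan_sum:
  "ddt_form (tsygan_sum 0 a0 as) = 0
    \<and> (\<forall>q. ddt_form (tsygan_sum (Suc q) a0 as) = of_nat (Suc (q + length as)) * tsygan_sum q a0 as)"
proof (induction as rule: rev_induct)
  case Nil
  show ?case
    by (simp add: tsygan_sum_Nil ddt_form_mult ddt_form_generators ddt_form_power form_1 algebra_simps mult_of_nat_commute
        del: power_Suc of_nat_Suc)
next
  case (snoc a as)
  have 0: "ddt_form (tsygan_sum 0 a0 (as @ [a])) = 0"
    using snoc by (simp add: tsygan_sum_snoc_0 ddt_form_mult ddt_form_generators)
  have "ddt_form (tsygan_sum (Suc q) a0 (as @ [a])) = of_nat (Suc (q + length (as @ [a]))) * tsygan_sum q a0 (as @ [a])" for q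
  proof (induction q)
    case 0
    have "ddt_form (tsygan_sum (Suc 0) a0 (as @ [a]))
        = tsygan_sum 0 a0 (as @ [a]) + of_nat (Suc (length as)) * tsygan_sum 0 a0 as * dft a"
      using snoc 0 by (simp add: tsygan_sum_snoc_Suc lmap_add[OF lmap_ddt_form] ddt_form_mult ddt_form_generators \<open>ddt_form (tsygan_sum 0 a0 (as @ [a])) = 0\<close>)
    then show ?case
      by (simp add: tsygan_sum_snoc_0 algebra_simps)
  next
    case (Suc q)
    have "ddt_form (tsygan_sum (Suc (Suc q)) a0 (as @ [a]))
        = of_nat (Suc (Suc (q + length as))) * tsygan_sum q a0 (as @ [a]) * tvar + tsygan_sum (Suc q) a0 (as @ [a])
          + of_nat (Suc (Suc (q + length as))) * tsygan_sum (Suc q) a0 as * dft a"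
      using snoc Suc unfolding tsygan_sum_snoc_Suc[of "Suc q"]
      by (simp add: lmap_add[OF lmap_ddt_form] ddt_form_mult ddt_form_generators del: of_nat_Suc)
    also have "\<dots> = of_nat (Suc (Suc (q + length as))) * (tsygan_sum q a0 (as @ [a]) * tvar + tsygan_sum (Suc q) a0 as * dft a)
         + tsygan_sum (Suc q) a0 (as @ [a])"
      by (simp only: distrib_left mult.assoc add_ac)
    also have "\<dots> = of_nat (Suc (Suc q + length (as @ [a]))) * tsygan_sum (Suc q) a0 (as @ [a])"
      unfolding tsygan_sum_snoc_Suc[symmetric] by (simp add: algebra_simps)
    finally show ?case .
  qed
  with 0 show ?case by blast
qed

lemma ddt_tsygan_form: "ddt_form (tsygan_form p (Suc q) x) - tsygan_form p q x \<in> ideal_t"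
proof (rule forms_agree[OF lmap_compose[OF lmap_ddt_form lmap_form_act] lmap_form_act subspace_ideal])
  fix a0 :: 'a and as
  let ?x = "el a0 * prod_list (map df as)"
  have "ddt_form (tsygan_cochain p (Suc q) a0 as) = tsygan_cochain p q a0 as"
    using ddt_tsygan_sum[of a0 as] scl_fact_Suc[of "q + length as"]
    by (auto simp add: tsygan_cochain_def lmap_scl[OF lmap_ddt_form] lmap_zero[OF lmap_ddt_form] del: fact_Suc of_nat_Suc)
  moreover have "ddt_form (tsygan_form p (Suc q) ?x - tsygan_cochain p (Suc q) a0 as)
      - (tsygan_form p q ?x - tsygan_cochain p q a0 as) \<in> ideal_t"
    by (intro falg.subspace_diff subspace_ideal ddt_form_ideal tsygan_form_nform)
  ultimately show "ddt_form (tsygan_form p (Suc q) ?x) - tsygan_form p q ?x \<in> ideal_t"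
    by (simp add: lmap_diff[OF lmap_ddt_form])
qed (auto intro: ddt_form_ideal tsygan_form_ideal)

subsection \<open>The superderivation \<open>i\<^sub>t\<close>\<close>

text \<open>Unnormalized and defined in all degrees at once, so that recursions which change the
  degree carry no factorials.\<close>

abbreviation T :: "nat \<Rightarrow> ('a gen, 'k) falg \<Rightarrow> ('a tgen, 'k) falg" where
  "T q \<equiv> on_forms (tsygan_sum q)"

lemma T_ideal: "x \<in> ideal \<Longrightarrow> T q x \<in> ideal_t"
  by (rule form_act_ideal[OF subspace_ideal cochain_tsygan_sum])

lemma T_nform: "T q (el a0 * prod_list (map df as)) - tsygan_sum q a0 as \<in> ideal_t"
  by (rule on_forms_nform[OF subspace_ideal cochain_tsygan_sum])

lemma T_el: "T q (el a) = elt a * tvar ^ q"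
  by (simp add: form_act_el tsygan_sum_Nil)

text \<open>Here and in \<open>T_df_Suc\<close> the recursion is extended from normal forms to
  arbitrary \<open>x\<close>, since it is applied to forms such as \<open>\<beta> a' da\<close>,
  which are not in normal form.\<close>

lemma T_df_0: "T 0 (x * df a) - T 0 x * dft a \<in> ideal_t"
proof (rule forms_agree[OF lmap_compose[OF lmap_form_act lmap_mult_right] lmap_compose[OF lmap_mult_right lmap_form_act] subspace_ideal])
  fix a0 :: 'a and as
  have "(T 0 (el a0 * prod_list (map df (as @ [a]))) - tsygan_sum 0 a0 (as @ [a]))
      - (T 0 (el a0 * prod_list (map df as)) - tsygan_sum 0 a0 as) * dft a \<in> ideal_t"
    by (intro falg.subspace_diff subspace_ideal ideal_mult T_nform)
  then show "T 0 (el a0 * prod_list (map df as) * df a) - T 0 (el a0 * prod_list (map df as)) * dft a \<in> ideal_t"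
    by (simp add: tsygan_sum_snoc_0 algebra_simps)
qed (auto intro: T_ideal ideal_mult)

lemma T_df_Suc: "T (Suc q) (x * df a) - (T q (x * df a) * tvar + T (Suc q) x * dft a) \<in> ideal_t"
proof (rule forms_agree[OF lmap_compose[OF lmap_form_act lmap_mult_right]
    lmap_plus[OF lmap_compose[OF lmap_mult_right lmap_compose[OF lmap_form_act lmap_mult_right]] lmap_compose[OF lmap_mult_right lmap_form_act]] subspace_ideal])
  fix a0 :: 'a and as
  have "(T (Suc q) (el a0 * prod_list (map df (as @ [a]))) - tsygan_sum (Suc q) a0 (as @ [a]))
      - (T q (el a0 * prod_list (map df (as @ [a]))) - tsygan_sum q a0 (as @ [a])) * tvar
      - (T (Suc q) (el a0 * prod_list (map df as)) - tsygan_sum (Suc q) a0 as) * dft a \<in> ideal_t"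
    by (intro falg.subspace_diff subspace_ideal ideal_mult T_nform)
  then show "T (Suc q) (el a0 * prod_list (map df as) * df a)
      - (T q (el a0 * prod_list (map df as) * df a) * tvar + T (Suc q) (el a0 * prod_list (map df as)) * dft a) \<in> ideal_t"
    by (simp add: tsygan_sum_snoc_Suc algebra_simps)
qed (auto intro!: falg.subspace_add subspace_ideal T_ideal ideal_mult)

lemma el_mult: "elt (a * b) - elt a * elt b \<in> ideal_t" and dft_mult: "dft (a * b) - (dft a * elt b + elt a * dft b) \<in> ideal_t"
  by (intro ideal_base rels_intros)+

text \<open>\<open>da b = d(ab) - a db\<close> makes the differential the last factor again, so that
  the recursion applies.\<close>

lemma T_mult_df:
  "T q (x * df a * el b) - (T q (x * df (a * b)) - T q (x * el a * df b)) \<in> ideal_t"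
proof -
  have "x * (df (a * b) - (df a * el b + el a * df b)) \<in> ideal"
    by (intro ideal_mult ideal_base rels_intros)
  from falg.subspace_neg[OF subspace_ideal T_ideal[OF this, of q]]
  show ?thesis
    by (simp add: algebra_simps form_act_add form_act_diff)
qed

text \<open>The signed term of the Leibniz rule contains \<open>it_form tvar = 0\<close>, so the
  rule holds for inhomogeneous \<open>x\<close>.\<close>

lemma it_form_mult_t: "it_form (x * tvar) = it_form x * tvar"
  by (induction x rule: falg_induct)
    (simp_all add: lmap_add[OF lmap_it_form] lmap_scl[OF lmap_it_form] lmap_zero[OF lmap_it_form] distrib_right scl_mult_left
      it_form_mult[OF homog_mon[OF refl]] it_form_generators)

lemma tsygan_sum_homog: "tsygan_sum q a0 as \<in> homog fdeg (length as)"
  unfolding tsygan_sum_def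
  by (intro falg.subspace_sum subspace_homog tsygan_term_homog) (simp add: compositions_def)

text \<open>The Leibniz rule is applied to the congruent element \<open>tsygan_sum q a0 as\<close>,
  whose degree is known.\<close>

lemma it_T_mult_dft:
  fixes a0 :: 'a and as :: "'a list"
  defines "\<alpha> \<equiv> el a0 * prod_list (map df as) :: ('a gen, 'k) falg"
  shows "it_form (T q \<alpha> * dft a) - (it_form (T q \<alpha>) * dft a + (- 1) ^ length as * (T q \<alpha> * (elt a * tvar - tvar * elt a))) \<in> ideal_t"
proof -
  let ?S = "tsygan_sum q a0 as" and ?c = "elt a * tvar - tvar * elt a"
  have S: "T q \<alpha> - ?S \<in> ideal_t"
    unfolding \<alpha>_def by (rule T_nform)
  have "it_form ((T q \<alpha> - ?S) * dft a) = it_form (T q \<alpha> * dft a) - (it_form ?S * dft a + (- 1) ^ length as * (?S * ?c))"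
    by (simp add: left_diff_distrib lmap_diff[OF lmap_it_form] it_form_mult[OF tsygan_sum_homog] it_form_generators)
  moreover have "it_form ((T q \<alpha> - ?S) * dft a) - it_form (T q \<alpha> - ?S) * dft a - (- 1) ^ length as * ((T q \<alpha> - ?S) * ?c) \<in> ideal_t"
    by (intro falg.subspace_diff[of ideal_t] subspace_ideal it_form_ideal ideal_mult(2) subspace_sign S)
  ultimately have "it_form (T q \<alpha> * dft a) - (it_form ?S * dft a + (- 1) ^ length as * (?S * ?c))
      - it_form (T q \<alpha> - ?S) * dft a - (- 1) ^ length as * ((T q \<alpha> - ?S) * ?c) \<in> ideal_t"
    by (simp only:)
  then show ?thesis
    by (cases "even (length as)") (simp_all add: lmap_diff[OF lmap_it_form] algebra_simps)
qed

text \<open>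
  The defect \<open>D\<^sub>q = T\<^sub>q(\<alpha> a) - T\<^sub>q(\<alpha>) a\<close> of right linearity of \<open>T\<^sub>q\<close> satisfies
  \<open>i\<^sub>t T\<^sub>q(\<alpha> \<d>a) = (-1)\<^sup>n D\<^sub>q\<^sub>+\<^sub>1\<close> already in \<open>\<Omega>\<^sub>t\<close>, before commutators are divided out.
\<close>

definition T_defect :: "nat \<Rightarrow> ('a gen, 'k) falg \<Rightarrow> 'a \<Rightarrow> ('a tgen, 'k) falg" where
  "T_defect q \<alpha> a = T q (\<alpha> * el a) - T q \<alpha> * elt a"

text \<open>By \<open>D\<close>, i_t of the summand \<open>T q \<alpha> * dft a\<close> is, up to
  sign, \<open>T_defect (Suc q) - T_defect q * t\<close>. Along the recursion in \<open>q\<close>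
  these expressions telescope, starting from the vanishing defect for \<open>q = 0\<close>.\<close>

lemma it_T_step:
  fixes a0 :: 'a and as :: "'a list"
  defines "\<alpha> \<equiv> el a0 * prod_list (map df as) :: ('a gen, 'k) falg"
  assumes D0: "T_defect 0 \<alpha> a \<in> ideal_t"
    and D: "\<And>q. it_form (T q \<alpha>) * dft a + (- 1) ^ length as * (T q \<alpha> * (elt a * tvar - tvar * elt a))
        - (- 1) ^ length as * (T_defect (Suc q) \<alpha> a - T_defect q \<alpha> a * tvar) \<in> ideal_t"
  shows "it_form (T q (\<alpha> * df a)) - (- 1) ^ length as * T_defect (Suc q) \<alpha> a \<in> ideal_t"
proof -
  let ?s = "(- 1) ^ length as :: ('a tgen, 'k) falg"
  have E: "it_form (T q \<alpha> * dft a) - ?s * (T_defect (Suc q) \<alpha> a - T_defect q \<alpha> a * tvar) \<in> ideal_t" for q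
    using falg.subspace_add[OF subspace_ideal it_T_mult_dft[where ?a0.0 = a0 and as = as and q = q and a = a, folded \<alpha>_def] D[of q]]
    by simp
  show ?thesis
  proof (induction q)
    case 0
    have "it_form (T 0 (\<alpha> * df a) - T 0 \<alpha> * dft a) + (it_form (T 0 \<alpha> * dft a) - ?s * (T_defect (Suc 0) \<alpha> a - T_defect 0 \<alpha> a * tvar))
       - ?s * (T_defect 0 \<alpha> a * tvar) \<in> ideal_t"
      by (intro falg.subspace_diff[of ideal_t] falg.subspace_add[of ideal_t] subspace_ideal subspace_sign ideal_mult(2) D0 it_form_ideal T_df_0 E)
    then show ?case
      by (simp add: lmap_diff[OF lmap_it_form] algebra_simps)
  next
    case (Suc q)
    have "it_form (T (Suc q) (\<alpha> * df a) - (T q (\<alpha> * df a) * tvar + T (Suc q) \<alpha> * dft a))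
       + (it_form (T q (\<alpha> * df a)) - ?s * T_defect (Suc q) \<alpha> a) * tvar
       + (it_form (T (Suc q) \<alpha> * dft a) - ?s * (T_defect (Suc (Suc q)) \<alpha> a - T_defect (Suc q) \<alpha> a * tvar)) \<in> ideal_t"
      by (intro falg.subspace_add[of ideal_t] subspace_ideal ideal_mult(2) Suc it_form_ideal T_df_Suc E)
    then show ?case
      by (simp add: lmap_diff[OF lmap_it_form] lmap_add[OF lmap_it_form] it_form_mult_t algebra_simps)
  qed
qed

text \<open>Both claims are carried together through the induction on the last differential: for
  \<open>\<beta> da'\<close> the two hypotheses of \<open>it_T_step\<close> follow from the claims
  for \<open>\<beta>\<close>.\<close>

lemma it_T:
  fixes a0 :: 'a and as :: "'a list"
  defines "\<alpha> \<equiv> el a0 * prod_list (map df as) :: ('a gen, 'k) falg"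
  shows "T_defect 0 \<alpha> a \<in> ideal_t"
    and "it_form (T q (\<alpha> * df a)) - (- 1) ^ length as * T_defect (Suc q) \<alpha> a \<in> ideal_t"
proof -
  have "T_defect 0 \<alpha> a \<in> ideal_t \<and>
    (\<forall>q. it_form (T q (\<alpha> * df a)) - (- 1) ^ length as * T_defect (Suc q) \<alpha> a \<in> ideal_t)"
    unfolding \<alpha>_def
  proof (induction as arbitrary: a rule: rev_induct)
    case Nil
    let ?d = "elt (a0 * a) - elt a0 * elt a :: ('a tgen, 'k) falg"
    have T: "T q (el a0 * el a) = elt (a0 * a) * tvar ^ q" for q
      by (simp add: form_act_mult form_act_el tsygan_sum_Nil)
    have it: "it_form (elt a0 * tvar ^ q) = 0" for q
      by (simp add: it_form_mult[OF homog_forms(3)] it_form_generators it_form_power)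
    have t: "tvar * (tvar ^ q * x) = tvar ^ q * (tvar * x)" for q and x :: "('a tgen, 'k) falg"
      by (metis mult.assoc power_commutes)
    have D0: "T_defect 0 (el a0 * prod_list (map df [])) a \<in> ideal_t"
      by (simp add: T_defect_def T T_el el_mult)
    have "it_form (T q (el a0)) * dft a + T q (el a0) * (elt a * tvar - tvar * elt a)
        - (T_defect (Suc q) (el a0) a - T_defect q (el a0) a * tvar) = 0" for q
      by (simp add: T_defect_def T T_el it algebra_simps t power_commutes)
    then show ?case
      using it_T_step[OF D0] D0 by (simp add: falg.subspace_0 subspace_ideal)
  next
    case (snoc a' as)
    let ?\<beta> = "el a0 * prod_list (map df as) :: ('a gen, 'k) falg"
    let ?\<alpha> = "?\<beta> * df a'"
    have \<alpha>: "el a0 * prod_list (map df (as @ [a'])) = ?\<alpha>"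
      by (simp add: mult.assoc)
    have D0: "T_defect 0 ?\<alpha> a \<in> ideal_t"
    proof -
      \<comment> \<open>The sum collapses to the defect of \<open>?\<alpha>\<close>: moving
        \<open>a\<close> to the left through \<open>da'\<close> shows that it is congruent to
        \<open>- T_defect 0 ?\<beta> a' * dft a\<close>.\<close>
      have "(T 0 (?\<beta> * df a' * el a) - (T 0 (?\<beta> * df (a' * a)) - T 0 (?\<beta> * el a' * df a)))
        + (T 0 (?\<beta> * df (a' * a)) - T 0 ?\<beta> * dft (a' * a))
        - (T 0 (?\<beta> * el a' * df a) - T 0 (?\<beta> * el a') * dft a)
        + T 0 ?\<beta> * (dft (a' * a) - (dft a' * elt a + elt a' * dft a))
        - T_defect 0 ?\<beta> a' * dft a
        - (T 0 (?\<beta> * df a') - T 0 ?\<beta> * dft a') * elt a \<in> ideal_t"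
        by (intro falg.subspace_diff[of ideal_t] falg.subspace_add[of ideal_t] subspace_ideal T_mult_df T_df_0
            ideal_mult(2)[of _ "rels elt dft" "elt a"] ideal_mult(2)[of _ "rels elt dft" "dft a"]
            ideal_mult(1) dft_mult conjunct1[OF snoc])
      then show ?thesis
        by (simp add: T_defect_def algebra_simps)
    qed
    have D: "it_form (T q ?\<alpha>) * dft a + (- 1) ^ length (as @ [a']) * (T q ?\<alpha> * (elt a * tvar - tvar * elt a))
        - (- 1) ^ length (as @ [a']) * (T_defect (Suc q) ?\<alpha> a - T_defect q ?\<alpha> a * tvar) \<in> ideal_t" for q
    proof -
      let ?s = "(- 1) ^ length as :: ('a tgen, 'k) falg"
      have IH: "it_form (T q ?\<alpha>) - ?s * T_defect (Suc q) ?\<beta> a' \<in> ideal_t"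
        using snoc by blast
      \<comment> \<open>Writing \<open>D\<close> for the defect, \<open>?r\<close> expands to
        \<open>D (Suc q) \<alpha> a - D q \<alpha> a * t - T q \<alpha> * [a, t] + D (Suc q) \<beta>
        a' * da\<close>. The induction hypothesis replaces its last term by i_t of
        \<open>T q \<alpha>\<close>, up to sign.\<close>
      have "(T (Suc q) (?\<beta> * df a' * el a) - (T (Suc q) (?\<beta> * df (a' * a)) - T (Suc q) (?\<beta> * el a' * df a)))
        - (T q (?\<beta> * df a' * el a) - (T q (?\<beta> * df (a' * a)) - T q (?\<beta> * el a' * df a))) * tvar
        + (T (Suc q) (?\<beta> * df (a' * a)) - (T q (?\<beta> * df (a' * a)) * tvar + T (Suc q) ?\<beta> * dft (a' * a)))
        - (T (Suc q) (?\<beta> * el a' * df a) - (T q (?\<beta> * el a' * df a) * tvar + T (Suc q) (?\<beta> * el a') * dft a))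
        + T (Suc q) ?\<beta> * (dft (a' * a) - (dft a' * elt a + elt a' * dft a))
        - (T (Suc q) (?\<beta> * df a') - (T q (?\<beta> * df a') * tvar + T (Suc q) ?\<beta> * dft a')) * elt a \<in> ideal_t" (is "?r \<in> _")
        by (intro falg.subspace_diff[of ideal_t] falg.subspace_add[of ideal_t] subspace_ideal T_mult_df T_df_Suc
            ideal_mult(2)[of _ "rels elt dft" "elt a"] ideal_mult(2)[of _ "rels elt dft" tvar]
            ideal_mult(1) dft_mult)
      then have "(it_form (T q ?\<alpha>) - ?s * T_defect (Suc q) ?\<beta> a') * dft a + ?s * ?r \<in> ideal_t"
        by (intro falg.subspace_add[of ideal_t] subspace_ideal ideal_mult(2) IH subspace_sign)
      then show ?thesis
        by (cases "even (length as)") (simp_all add: T_defect_def algebra_simps)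
    qed
    show ?case
      using it_T_step[where ?a0.0 = a0 and as = "as @ [a']", unfolded \<alpha>, OF D0 D] D0 by (simp only: \<alpha>) blast
  qed
  then show "T_defect 0 \<alpha> a \<in> ideal_t"
    "it_form (T q (\<alpha> * df a)) - (- 1) ^ length as * T_defect (Suc q) \<alpha> a \<in> ideal_t"
    by blast+
qed

text \<open>On the left there is no defect: \<open>a\<close> merges with the head \<open>a0\<close>,
  before any \<open>t\<close> or differential.\<close>

lemma T_el_mult: "T q (el a * x) - elt a * T q x \<in> ideal_t"
proof (rule forms_agree[OF lmap_compose[OF lmap_form_act lmap_mult_left] lmap_compose[OF lmap_mult_left lmap_form_act] subspace_ideal])
  fix a0 :: 'a and as
  have "(elt (a * a0) - elt a * elt a0) * v \<in> ideal_t" for v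
    by (rule ideal_mult(2)[OF el_mult])
  then have "(\<Sum>ks\<in>compositions (length as) q. tsygan_term (a * a0) as ks - elt a * tsygan_term a0 as ks) \<in> ideal_t"
    by (intro falg.subspace_sum subspace_ideal) (simp add: tsygan_term_def left_diff_distrib mult.assoc)
  then have 1: "tsygan_sum q (a * a0) as - elt a * tsygan_sum q a0 as \<in> ideal_t"
    by (simp add: tsygan_sum_def sum_subtractf sum_distrib_left)
  have 2: "T q ((el (a * a0) - el a * el a0) * prod_list (map df as)) \<in> ideal_t"
    by (intro T_ideal ideal_mult(2) ideal_base rels_intros)
  have 3: "T q (el (a * a0) * prod_list (map df as)) - tsygan_sum q (a * a0) as
      - elt a * (T q (el a0 * prod_list (map df as)) - tsygan_sum q a0 as) \<in> ideal_t"
    by (intro falg.subspace_diff[of ideal_t] subspace_ideal T_nform ideal_mult(1))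
  from falg.subspace_diff[OF subspace_ideal falg.subspace_add[OF subspace_ideal 3 1] 2]
show "T q (el a * (el a0 * prod_list (map df as))) - elt a * T q (el a0 * prod_list (map df as)) \<in> ideal_t"
    by (simp add: left_diff_distrib form_act_diff algebra_simps)
qed (auto intro: T_ideal ideal_mult)

lemma tsygan_form_homog_eq_0:
  assumes "x \<in> homog gdeg n" "p \<noteq> n"
  shows "tsygan_form p q x = 0"
  using assms by (intro tsygan_form_eq_0) (auto simp: homog_def)

lemma tsygan_form_eq_T:
  assumes "x \<in> homog gdeg p"
  shows "tsygan_form p q x - scl (\<rho> (1 / fact (q + p))) (T q x) \<in> ideal_t"
proof (rule lmap_in_span[OF lmap_minus[OF lmap_form_act lmap_compose[OF lmap_scale lmap_form_act]] subspace_ideal _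
      homog_in_span_nform[OF assms]])
  fix s :: "('a gen, 'k) falg" assume "s \<in> nform p \<union> two_sided (rels el df)"
  then consider "s \<in> nform p" | "s \<in> two_sided (rels el df)" by blast
  then show "tsygan_form p q s - scl (\<rho> (1 / fact (q + p))) (T q s) \<in> ideal_t"
  proof cases
    case 1
    then obtain a0 as where s: "s = el a0 * prod_list (map df as)" "length as = p"
      unfolding nform_def by blast
    have "(tsygan_form p q s - tsygan_cochain p q a0 as) - scl (\<rho> (1 / fact (q + p))) (T q s - tsygan_sum q a0 as) \<in> ideal_t"
      unfolding s(1) by (intro falg.subspace_diff[of ideal_t] falg.subspace_scale subspace_ideal tsygan_form_nform T_nform)
    then show ?thesis
      using s(2) by (simp add: tsygan_cochain_def falg.scale_right_diff_distrib)
  next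
    case 2
    then have "s \<in> ideal" by (simp add: lspan_eq falg.span_base)
    then show ?thesis
      by (intro falg.subspace_diff falg.subspace_scale subspace_ideal tsygan_form_ideal T_ideal)
  qed
qed

text \<open>Up to sign, b of \<open>\<alpha> da\<close> is \<open>\<alpha> a - a \<alpha>\<close>.
  Left linearity gives \<open>T q (a \<alpha>) = a T q \<alpha>\<close>, a commutator moves
  \<open>a\<close> to the right, and the defect remains.\<close>

lemma b_tsygan_snoc:
  fixes a0 :: 'a and as :: "'a list"
  defines "\<alpha> \<equiv> el a0 * prod_list (map df as) :: ('a gen, 'k) falg"
  shows "tsygan_form p q (b_form (\<alpha> * df a)) -
    (if p = length as then scl (\<rho> (1 / fact (q + p))) ((- 1) ^ p * T_defect q \<alpha> a) else 0) \<in> DR_null \<iota>"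
proof -
  let ?n = "length as"
  let ?y = "(- 1) ^ ?n * (\<alpha> * el a - el a * \<alpha>)"
  have \<alpha>: "\<alpha> \<in> homog gdeg ?n"
    unfolding \<alpha>_def by (rule nform_homog)
  have y: "?y \<in> homog gdeg ?n"
    using homog_mult[OF \<alpha> homog_forms(1)] homog_mult[OF homog_forms(1) \<alpha>]
    by (intro subspace_sign falg.subspace_diff subspace_homog) simp_all
  have b: "tsygan_form p q (b_form (\<alpha> * df a)) - tsygan_form p q ?y \<in> DR_null \<iota>"
    using ideal_t_DR_null[OF tsygan_form_ideal[OF b_form_snoc[OF \<alpha>]]]
    by (simp add: form_act_diff flip: b_last_def)
  show ?thesis
  proof (cases "p = ?n")
    case False
    then show ?thesis
      using b tsygan_form_homog_eq_0[OF y False] by simp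
  next
    case True
    let ?c = "\<rho> (1 / fact (q + p))"
    let ?S = "tsygan_sum q a0 as"
    have 1: "?S * elt a - elt a * ?S \<in> DR_null \<iota>"
      using supercommutator_DR_null[OF tsygan_sum_homog homog_forms(3), of q a0 as a] by simp
    have S: "T q \<alpha> - ?S \<in> ideal_t"
      unfolding \<alpha>_def by (rule T_nform)
    have 2: "(T q \<alpha> - ?S) * elt a - elt a * (T q \<alpha> - ?S) \<in> DR_null \<iota>"
      by (rule ideal_t_DR_null[OF falg.subspace_diff[OF subspace_ideal ideal_mult(2)[OF S] ideal_mult(1)[OF S]]])
    from falg.subspace_diff[OF subspace_DR_null falg.subspace_add[OF subspace_DR_null 2 1] ideal_t_DR_null[OF T_el_mult[where q = q and a = a and x = \<alpha>]]]
    have 3: "T q \<alpha> * elt a - T q (el a * \<alpha>) \<in> DR_null \<iota>"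
      by (simp add: algebra_simps)
    have 4: "tsygan_form p q ?y - scl ?c (T q ?y) \<in> DR_null \<iota>"
      using ideal_t_DR_null[OF tsygan_form_eq_T[OF y, of q]] by (simp add: True)
    have 5: "scl ?c ((- 1) ^ p * (T q \<alpha> * elt a - T q (el a * \<alpha>))) \<in> DR_null \<iota>"
      by (rule falg.subspace_scale[OF subspace_DR_null subspace_sign[OF subspace_DR_null 3]])
    have "(tsygan_form p q (b_form (\<alpha> * df a)) - tsygan_form p q ?y) + (tsygan_form p q ?y - scl ?c (T q ?y))
        + scl ?c ((- 1) ^ p * (T q \<alpha> * elt a - T q (el a * \<alpha>))) \<in> DR_null \<iota>"
      by (rule falg.subspace_add[OF subspace_DR_null falg.subspace_add[OF subspace_DR_null b 4] 5])
    moreover have "T q ?y = (- 1) ^ p * (T q (\<alpha> * el a) - T q (el a * \<alpha>))"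
      by (simp add: True form_act_diff form_act_scl flip: scl_minus_one_power)
    ultimately show ?thesis
      by (cases "even p") (simp_all add: True T_defect_def form_act_diff lmap_neg[OF lmap_form_act] algebra_simps falg.scale_right_diff_distrib falg.scale_right_distrib)
  qed
qed

lemma b_tsygan_form:
  "tsygan_form p q (b_form x) - (case q of 0 \<Rightarrow> 0 | Suc q' \<Rightarrow> it_form (tsygan_form (Suc p) q' x)) \<in> DR_null \<iota>"
proof (rule forms_agree[OF _ _ subspace_DR_null])
  show "lmap (\<lambda>x. tsygan_form p q (b_form x))"
    by (rule lmap_compose[OF lmap_form_act lmap_form_act])
  show "lmap (\<lambda>x. case q of 0 \<Rightarrow> 0 | Suc q' \<Rightarrow> it_form (tsygan_form (Suc p) q' x))"
    by (cases q) (simp_all add: lmap_0 lmap_compose[OF lmap_it_form lmap_form_act])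
  show "tsygan_form p q (b_form x) \<in> DR_null \<iota>" if "x \<in> ideal" for x
    by (rule ideal_t_DR_null[OF tsygan_form_ideal[OF form_act_ideal[OF subspace_ideal cochain_b that]]])
  show "(case q of 0 \<Rightarrow> 0 | Suc q' \<Rightarrow> it_form (tsygan_form (Suc p) q' x)) \<in> DR_null \<iota>" if "x \<in> ideal" for x
    using ideal_t_DR_null[OF it_form_ideal[OF tsygan_form_ideal[OF that]]]
    by (cases q) (simp_all add: falg.subspace_0 subspace_DR_null)
  fix a0 :: 'a and as :: "'a list"
  show "tsygan_form p q (b_form (el a0 * prod_list (map df as)))
    - (case q of 0 \<Rightarrow> 0 | Suc q' \<Rightarrow> it_form (tsygan_form (Suc p) q' (el a0 * prod_list (map df as)))) \<in> DR_null \<iota>"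
  proof (cases as rule: rev_cases)
    case Nil
    have "b_form (el a0) \<in> ideal"
      using on_forms_nform[OF subspace_ideal cochain_b, where ?a0.0 = a0 and as = "[]"] by (simp add: snoc_cochain_def)
    then have "tsygan_form p q (b_form (el a0)) \<in> DR_null \<iota>"
      by (intro ideal_t_DR_null tsygan_form_ideal)
    then show ?thesis
      using tsygan_form_homog_eq_0[OF homog_forms(1), of "Suc p"]
      by (cases q) (simp_all add: Nil lmap_zero[OF lmap_it_form])
  next
    case (snoc bs a)
    let ?\<alpha> = "el a0 * prod_list (map df bs) :: ('a gen, 'k) falg"
    have as: "el a0 * prod_list (map df as) = ?\<alpha> * df a"
      by (simp add: snoc mult.assoc)
    have h: "?\<alpha> * df a \<in> homog gdeg (Suc (length bs))"
      using homog_mult[OF nform_homog homog_forms(2), of a0 bs a] by simp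
    note b = b_tsygan_snoc[where ?a0.0 = a0 and as = bs and a = a and p = p and q = q]
    show ?thesis
    proof (cases "p = length bs")
      case False
      then have "tsygan_form (Suc p) q' (?\<alpha> * df a) = 0" for q'
        by (intro tsygan_form_homog_eq_0[OF h]) simp
      then show ?thesis
        using b False unfolding as by (cases q) (simp_all add: lmap_zero[OF lmap_it_form])
    next
      case True
      let ?c = "\<rho> (1 / fact (q + p))"
      show ?thesis
      proof (cases q)
        case 0
        \<comment> \<open>i_t always produces a \<open>t\<close>, so the component
          \<open>q = 0\<close> requires \<open>T 0\<close> to be right linear.\<close>
        have "scl ?c ((- 1) ^ p * T_defect q ?\<alpha> a) \<in> DR_null \<iota>"
          unfolding 0 by (intro falg.subspace_scale subspace_sign subspace_DR_null ideal_t_DR_null it_T(1))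
        from falg.subspace_add[OF subspace_DR_null b this] show ?thesis
          unfolding as by (simp add: True 0)
      next
        case (Suc q')
        \<comment> \<open>As \<open>q = Suc q'\<close>, the numbers \<open>q' + Suc p\<close> and
          \<open>q + p\<close> agree, and \<open>?c\<close> is the normalization on both
          sides.\<close>
        have 1: "it_form (tsygan_form (Suc p) q' (?\<alpha> * df a) - scl ?c (T q' (?\<alpha> * df a))) \<in> DR_null \<iota>"
          using tsygan_form_eq_T[OF h, of q'] by (intro ideal_t_DR_null it_form_ideal) (simp add: True Suc)
        have 2: "scl ?c (it_form (T q' (?\<alpha> * df a)) - (- 1) ^ p * T_defect (Suc q') ?\<alpha> a) \<in> DR_null \<iota>"
          using it_T(2)[where ?a0.0 = a0 and as = bs and a = a and q = q']
          by (intro falg.subspace_scale subspace_DR_null ideal_t_DR_null) (simp add: True)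
        have 3: "tsygan_form p q (b_form (?\<alpha> * df a)) - scl ?c ((- 1) ^ p * T_defect q ?\<alpha> a) \<in> DR_null \<iota>"
          using b by (simp add: True)
        from falg.subspace_diff[OF subspace_DR_null falg.subspace_diff[OF subspace_DR_null 3 1] 2]
        have "(tsygan_form p q (b_form (?\<alpha> * df a)) - scl ?c ((- 1) ^ p * T_defect q ?\<alpha> a))
            - it_form (tsygan_form (Suc p) q' (?\<alpha> * df a) - scl ?c (T q' (?\<alpha> * df a)))
            - scl ?c (it_form (T q' (?\<alpha> * df a)) - (- 1) ^ p * T_defect (Suc q') ?\<alpha> a) \<in> DR_null \<iota>" .
        then show ?thesis
          unfolding as
          by (simp add: Suc lmap_diff[OF lmap_it_form] lmap_scl[OF lmap_it_form] falg.scale_right_diff_distrib)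
      qed
    qed
  qed
qed

subsection \<open>The de Rham differential\<close>

abbreviation tword :: "'a list \<Rightarrow> nat list \<Rightarrow> ('a tgen, 'k) falg" where
  "tword bs ls \<equiv> prod_list (map2 (\<lambda>a k. dft a * tvar ^ k) bs ls)"

text \<open>
  Modulo commutators \<open>1 \<d>b\<^sub>0 \<dots> \<d>b\<^sub>n\<close> is sent to a sum weighted by the number \<open>l\<^sub>n + 1\<close> of ways
  to split \<open>t\<^sup>l\<close> after the last differential, and the cyclic rotations in \<open>B\<close> move the weight
  to each of the \<open>n + 1\<close> exponents in turn.
\<close>

definition weighted_sum :: "nat \<Rightarrow> nat \<Rightarrow> 'a list \<Rightarrow> ('a tgen, 'k) falg" where
  "weighted_sum j q bs = (\<Sum>ls\<in>compositions (length bs - 1) q. of_nat (Suc (ls ! j)) * tword bs ls)"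

definition cyclic_sum :: "nat \<Rightarrow> 'a list \<Rightarrow> ('a tgen, 'k) falg" where
  "cyclic_sum q bs = (\<Sum>ls\<in>compositions (length bs - 1) q. tword bs ls)"

text \<open>Inverse of \<open>rotate1\<close> on nonempty lists; up to sign, the effect of kappa on
  a product of differentials.\<close>

definition rotr :: "'b list \<Rightarrow> 'b list" where
  "rotr xs = last xs # butlast xs"

lemma t_power_homog: "tvar ^ k \<in> homog fdeg 0"
  using homog_power[OF homog_forms(5), of k] by simp

lemma tword_homog: "length bs = length ls \<Longrightarrow> tword bs ls \<in> homog fdeg (length bs)"
proof (induction bs ls rule: list_induct2)
  case (Cons b bs l ls)
  from homog_mult[OF homog_mult[OF homog_forms(4) t_power_homog] Cons.IH, of b l] show ?case by simp
qed (simp add: homog_1)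

lemma dt_tword: "dt_form (tword bs ls) = 0"
proof (induction bs arbitrary: ls)
  case (Cons b bs)
  show ?case
  proof (cases ls)
    case (Cons l ls')
    have "dt_form (dft b * (tvar ^ l * tword bs ls')) = 0"
      by (simp add: dt_form_mult[OF homog_forms(4)] dt_form_mult[OF t_power_homog] dt_form_generators
          dt_form_power Cons.IH)
    then show ?thesis by (simp add: Cons mult.assoc)
  qed (simp add: form_1)
qed (simp add: form_1)

lemma dt_tsygan_sum: "dt_form (tsygan_sum q a0 as) = cyclic_sum q (a0 # as)"
proof -
  have "dt_form (tsygan_term a0 as ks) = tword (a0 # as) ks" if C: "ks \<in> compositions (length as) q" for ks
  proof -
    obtain k l where ks: "ks = k # l"
      using C by (cases ks) (auto simp: compositions_def)
    have "dt_form (elt a0 * (tvar ^ k * tword as l)) = dft a0 * (tvar ^ k * tword as l)"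
      by (simp add: dt_form_mult[OF homog_forms(3)] dt_form_mult[OF t_power_homog] dt_form_generators
          dt_form_power dt_tword)
    then show ?thesis
      by (simp add: ks tsygan_term_def mult.assoc)
  qed
  then show ?thesis
    by (simp add: tsygan_sum_def cyclic_sum_def lmap_sum[OF lmap_dt_form])
qed

lemma subspace_sum_diff:
  assumes "falg.subspace N" "\<And>i. i \<in> I \<Longrightarrow> f i - g i \<in> N"
  shows "sum f I - sum g I \<in> N"
  using falg.subspace_sum[OF assms(1), of I "\<lambda>i. f i - g i"] assms(2) by (simp add: sum_subtractf)

lemma sum_compositions_rotate1:
  "(\<Sum>ls\<in>compositions n q. f (rotate1 ls)) = (\<Sum>ls\<in>compositions n q. f ls)"
proof (rule sum.reindex_bij_witness[where i = rotr and j = rotate1])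
  fix ls assume ls: "ls \<in> compositions n q"
  then obtain l ls' where l: "ls = l # ls'"
    by (cases ls) (auto simp: compositions_def)
  show "rotr (rotate1 ls) = ls"
    by (simp add: l rotr_def)
  show "rotate1 ls \<in> compositions n q"
    using ls by (simp add: l compositions_def)
  obtain k ks where k: "ls = ks @ [k]"
    using ls by (cases ls rule: rev_cases) (auto simp: compositions_def)
  show "rotate1 (rotr ls) = ls"
    by (simp add: k rotr_def)
  show "rotr ls \<in> compositions n q"
    using ls by (simp add: k rotr_def compositions_def)
qed simp

text \<open>The supercommutator carries \<open>dc t^l\<close> past the remaining differentials,
  whence the sign. The weighted exponent stays with its differential, so its index drops by one;
  \<open>j < length cs\<close> leaves it at a factor that is not moved.\<close>

lemma weighted_sum_rotate:
  assumes "j < length cs"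
  shows "weighted_sum (Suc j) q (c # cs) - (- 1) ^ length cs * weighted_sum j q (cs @ [c]) \<in> DR_null \<iota>"
proof -
  let ?C = "compositions (length cs) q" and ?s = "(- 1) ^ length cs :: ('a tgen, 'k) falg"
  have "of_nat (Suc (ls ! Suc j)) * tword (c # cs) ls - ?s * (of_nat (Suc (rotate1 ls ! j)) * tword (cs @ [c]) (rotate1 ls)) \<in> DR_null \<iota>"
    if ls: "ls \<in> ?C" for ls
  proof -
    obtain l ls' where l: "ls = l # ls'" and len: "length cs = length ls'"
      using ls by (cases ls) (auto simp: compositions_def)
    have "dft c * tvar ^ l \<in> homog fdeg (1 + 0)"
      by (rule homog_mult[OF homog_forms(4) t_power_homog])
    from supercommutator_DR_null[OF this tword_homog[OF len]]
    have "(dft c * tvar ^ l) * tword cs ls' - ?s * (tword cs ls' * (dft c * tvar ^ l)) \<in> DR_null \<iota>"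
      by simp
    from falg.subspace_scale[OF subspace_DR_null this, of "of_nat (Suc (ls' ! j))"]
    have "of_nat (Suc (ls' ! j)) * ((dft c * tvar ^ l) * tword cs ls' - ?s * (tword cs ls' * (dft c * tvar ^ l))) \<in> DR_null \<iota>"
      by (simp only: scl_of_nat)
    moreover have "rotate1 ls ! j = ls' ! j"
      using assms len by (simp add: l nth_append)
    moreover have "tword (cs @ [c]) (rotate1 ls) = tword cs ls' * (dft c * tvar ^ l)"
      using len by (simp add: l)
    ultimately show ?thesis
      by (cases "even (length cs)") (simp_all add: l right_diff_distrib distrib_left del: of_nat_Suc)
  qed
  then have "(\<Sum>ls\<in>?C. of_nat (Suc (ls ! Suc j)) * tword (c # cs) ls)
      - (\<Sum>ls\<in>?C. ?s * (of_nat (Suc (rotate1 ls ! j)) * tword (cs @ [c]) (rotate1 ls))) \<in> DR_null \<iota>"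
    by (rule subspace_sum_diff[OF subspace_DR_null])
  then show ?thesis
    unfolding sum_compositions_rotate1[of "\<lambda>ls. ?s * (of_nat (Suc (ls ! j)) * tword (cs @ [c]) ls)"]
    by (simp only: weighted_sum_def sum_distrib_left[symmetric] length_Cons length_append list.size add_0_right
        add_Suc_right diff_Suc_1)
qed

lemma length_rotr_funpow: "length bs = Suc n \<Longrightarrow> length ((rotr ^^ i) bs) = Suc n"
  by (induction i) (simp_all add: rotr_def)

lemma weighted_sum_rotr:
  assumes "length bs = Suc n" "j + i \<le> n"
  shows "weighted_sum j q bs - (- 1) ^ (n * i) * weighted_sum (j + i) q ((rotr ^^ i) bs) \<in> DR_null \<iota>"
  using assms(2)
proof (induction i)
  case 0
  then show ?case by (simp add: falg.subspace_0 subspace_DR_null)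
next
  case (Suc i)
  let ?bs = "(rotr ^^ i) bs"
  obtain cs c where bs: "?bs = cs @ [c]"
    using length_rotr_funpow[OF assms(1), of i] by (cases ?bs rule: rev_cases) auto
  have n: "length cs = n"
    using length_rotr_funpow[OF assms(1), of i] by (simp add: bs)
  have rot: "(rotr ^^ Suc i) bs = c # cs"
    by (simp add: bs rotr_def)
  have "weighted_sum (Suc (j + i)) q (c # cs) - (- 1) ^ n * weighted_sum (j + i) q (cs @ [c]) \<in> DR_null \<iota>"
    using weighted_sum_rotate[of "j + i" cs q c] Suc.prems by (simp add: n)
  from subspace_sign[OF subspace_DR_null this, of "n * Suc i"]
  have 1: "(- 1) ^ (n * Suc i) * (weighted_sum (Suc (j + i)) q (c # cs) - (- 1) ^ n * weighted_sum (j + i) q (cs @ [c])) \<in> DR_null \<iota>" .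
  have 2: "weighted_sum j q bs - (- 1) ^ (n * i) * weighted_sum (j + i) q (cs @ [c]) \<in> DR_null \<iota>"
    using Suc by (simp add: bs)
  have "(- 1) ^ (n * Suc i) * ((- 1) ^ n * weighted_sum (j + i) q (cs @ [c])) = (- 1) ^ (n * i) * weighted_sum (j + i) q (cs @ [c])"
    by (cases "even n") (simp_all add: power_add power_mult)
  then have "weighted_sum j q bs - (- 1) ^ (n * i) * weighted_sum (j + i) q (cs @ [c])
     - (- 1) ^ (n * Suc i) * (weighted_sum (Suc (j + i)) q (c # cs) - (- 1) ^ n * weighted_sum (j + i) q (cs @ [c]))
     = weighted_sum j q bs - (- 1) ^ (n * Suc i) * weighted_sum (j + Suc i) q ((rotr ^^ Suc i) bs)"
    unfolding rot by (simp add: right_diff_distrib)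
  with falg.subspace_diff[OF subspace_DR_null 2 1] show ?case
    by (simp only:)
qed

lemma sum_weighted_sum:
  assumes "length bs = Suc n"
  shows "(\<Sum>j\<le>n. weighted_sum j q bs) = of_nat (Suc (q + n)) * cyclic_sum q bs"
proof -
  have "(\<Sum>j\<le>n. of_nat (Suc (ls ! j)) * tword bs ls) = of_nat (Suc (q + n)) * tword bs ls"
    if "ls \<in> compositions n q" for ls
  proof -
    have "sum_list ls = (\<Sum>j\<le>n. ls ! j)" "sum_list ls = q"
      using that sum_list_sum_nth[of ls] by (auto simp: compositions_def atLeast0LessThan lessThan_Suc_atMost)
    then have "(\<Sum>j\<le>n. Suc (ls ! j)) = Suc (q + n)"
      by (simp only: sum_Suc card_atMost add_Suc_right)
    then show ?thesis
      by (simp only: sum_distrib_right[symmetric] of_nat_sum[symmetric])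
  qed
  then show ?thesis
    using assms unfolding weighted_sum_def cyclic_sum_def
    by (subst sum.swap) (simp add: sum_distrib_left)
qed

lemma tsygan_sum_1:
  assumes "length bs = Suc n"
  shows "tsygan_sum q 1 bs - weighted_sum n q bs \<in> DR_null \<iota>"
proof -
  define merge :: "nat list \<Rightarrow> nat list" where "merge = (\<lambda>ks. butlast (tl ks) @ [last (tl ks) + hd ks])"
  let ?C = "compositions (Suc n) q" and ?D = "SIGMA ls:compositions n q. {..ls ! n}"
  have summand: "tsygan_term 1 bs ks - tword bs (merge ks) \<in> DR_null \<iota>" if ks: "ks \<in> ?C" for ks
  proof -
    obtain k ls l where k: "ks = k # ls @ [l]"
    proof -
      obtain k ks' where "ks = k # ks'" "length ks' = Suc n"
        using ks by (cases ks) (auto simp: compositions_def)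
      then show ?thesis
        using that by (cases ks' rule: rev_cases) auto
    qed
    then have len: "length bs = length (ls @ [l])"
      using ks assms by (simp add: compositions_def)
    obtain cs c where bs: "bs = cs @ [c]"
      using assms by (cases bs rule: rev_cases) auto
    have "(elt 1 - 1) * (tvar ^ k * tword bs (ls @ [l])) \<in> DR_null \<iota>"
      by (intro ideal_t_DR_null ideal_mult(2) ideal_base rels_intros)
    moreover have "tvar ^ k * tword bs (ls @ [l]) - tword bs (ls @ [l]) * tvar ^ k \<in> DR_null \<iota>"
      using supercommutator_DR_null[OF t_power_homog tword_homog[OF len], of k] by simp
    ultimately have "(elt 1 - 1) * (tvar ^ k * tword bs (ls @ [l]))
        + (tvar ^ k * tword bs (ls @ [l]) - tword bs (ls @ [l]) * tvar ^ k) \<in> DR_null \<iota>"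
      by (rule falg.subspace_add[OF subspace_DR_null])
    moreover have "tword bs (ls @ [l]) * tvar ^ k = tword bs (merge ks)"
      using len by (simp add: bs merge_def k mult.assoc power_add)
    ultimately show ?thesis
      by (simp add: k tsygan_term_def left_diff_distrib mult.assoc)
  qed
  \<comment> \<open>A composition is recovered from its merged form \<open>ls\<close> and its head,
    and the head can be any number from 0 to \<open>ls ! n\<close>. These \<open>ls ! n + 1\<close>
    choices are the weight.\<close>
  have "(\<Sum>ks\<in>?C. tword bs (merge ks)) = (\<Sum>(ls, k)\<in>?D. tword bs ls)"
  proof (rule sum.reindex_bij_witness[where j = "\<lambda>ks. (merge ks, hd ks)" and i = "\<lambda>(ls, k). k # butlast ls @ [last ls - k]"])
    fix ks assume ks: "ks \<in> ?C"
    then obtain k ks' where k: "ks = k # ks'" "length ks' = Suc n"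
      by (cases ks) (auto simp: compositions_def)
    then obtain ls l where ls: "ks' = ls @ [l]"
      by (cases ks' rule: rev_cases) auto
    show "(case (merge ks, hd ks) of (ls, k) \<Rightarrow> k # butlast ls @ [last ls - k]) = ks"
      by (simp add: merge_def k ls)
    show "(merge ks, hd ks) \<in> ?D"
      using ks k by (auto simp: merge_def compositions_def ls nth_append)
  next
    fix x assume "x \<in> ?D"
    then obtain ls k where x: "x = (ls, k)" "ls \<in> compositions n q" "k \<le> ls ! n"
      by auto
    then obtain ls' l where ls: "ls = ls' @ [l]"
      by (cases ls rule: rev_cases) (auto simp: compositions_def)
    then have l: "k \<le> l"
      using x by (simp add: compositions_def nth_append)
    show "(merge (case x of (ls, k) \<Rightarrow> k # butlast ls @ [last ls - k]), hd (case x of (ls, k) \<Rightarrow> k # butlast ls @ [last ls - k])) = x"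
      using l by (simp add: x(1) merge_def ls)
    show "(case x of (ls, k) \<Rightarrow> k # butlast ls @ [last ls - k]) \<in> ?C"
      using x(2) l by (simp add: x(1) ls compositions_def)
  qed simp
  also have "\<dots> = weighted_sum n q bs"
    by (simp add: weighted_sum_def assms finite_compositions flip: sum.Sigma)
  finally have "(\<Sum>ks\<in>?C. tword bs (merge ks)) = weighted_sum n q bs" .
  moreover have "(\<Sum>ks\<in>?C. tsygan_term 1 bs ks) - (\<Sum>ks\<in>?C. tword bs (merge ks)) \<in> DR_null \<iota>"
    by (rule subspace_sum_diff[OF subspace_DR_null summand])
  ultimately show ?thesis
    by (simp add: tsygan_sum_def assms)
qed

lemma T_df_prod:
  assumes "length bs = Suc n"
  shows "T q (prod_list (map df bs)) - weighted_sum n q bs \<in> DR_null \<iota>"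
proof -
  have "T q (prod_list (map df bs)) - tsygan_sum q 1 bs \<in> DR_null \<iota>"
    using ideal_t_DR_null[OF form_act_df_prod[OF subspace_ideal cochain_tsygan_sum, of q bs "[]"]] by simp
  from falg.subspace_add[OF subspace_DR_null this tsygan_sum_1[OF assms, of q]] show ?thesis
    by simp
qed

lemma df_prod_homog: "prod_list (map df bs) \<in> homog gdeg (length bs)"
proof (induction bs)
  case (Cons b bs)
  from homog_mult[OF homog_forms(2) this, of b] show ?case by simp
qed (simp add: homog_1)

lemma d_form_mult: "x \<in> homog gdeg p \<Longrightarrow> d_form (x * y) = d_form x * y + (- 1) ^ p * (x * d_form y)"
  unfolding d_form_def by (rule der_mult)

lemma d_form_generators: "d_form (el a) = df a" "d_form (df a) = 0"
  by (simp_all add: d_form_def der_var)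

lemma d_form_nform: "d_form (el a0 * prod_list (map df as)) = (prod_list (map df (a0 # as)) :: ('a gen, 'k) falg)"
proof -
  have "d_form (prod_list (map df as)) = (0 :: ('a gen, 'k) falg)"
    by (induction as) (simp_all add: form_1 d_form_mult[OF homog_forms(2)] d_form_generators)
  then show ?thesis
    by (simp add: d_form_mult[OF homog_forms(1)] d_form_generators)
qed

text \<open>Each application moves one differential across \<open>n\<close> others, which
  contributes the sign \<open>(- 1) ^ n\<close>.\<close>

lemma kappa_df_prod:
  assumes "length bs = Suc n"
  shows "(kappa_form ^^ i) (prod_list (map df bs)) - (- 1) ^ (n * i) * prod_list (map df ((rotr ^^ i) bs)) \<in> ideal"
proof (induction i)
  case 0
  then show ?case by (simp add: falg.subspace_0 subspace_ideal)
next
  case (Suc i)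
  let ?bs = "(rotr ^^ i) bs"
  obtain cs c where bs: "?bs = cs @ [c]"
    using length_rotr_funpow[OF assms, of i] by (cases ?bs rule: rev_cases) auto
  have n: "length cs = n"
    using length_rotr_funpow[OF assms, of i] by (simp add: bs)
  have 1: "kappa_form ((kappa_form ^^ i) (prod_list (map df bs)) - (- 1) ^ (n * i) * prod_list (map df ?bs)) \<in> ideal"
    by (rule form_act_ideal[OF subspace_ideal cochain_kappa Suc])
  have 2: "kappa_form (prod_list (map df ?bs)) - (- 1) ^ n * prod_list (map df (c # cs)) \<in> ideal"
    using kappa_form_snoc[OF df_prod_homog, of cs c] by (simp add: bs n flip: kappa_last_def)
  have "kappa_form ((- 1) ^ (n * i) * prod_list (map df ?bs)) = (- 1) ^ (n * i) * kappa_form (prod_list (map df ?bs))"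
    by (simp only: form_act_scl flip: scl_minus_one_power)
  moreover have "(- 1) ^ (n * i) * ((- 1) ^ n * prod_list (map df (c # cs))) = (- 1) ^ (n * Suc i) * prod_list (map df (c # cs))"
    by (cases "even n") (simp_all add: power_add)
  moreover have "(rotr ^^ Suc i) bs = c # cs"
    by (simp add: bs rotr_def)
  ultimately have "kappa_form ((kappa_form ^^ i) (prod_list (map df bs)) - (- 1) ^ (n * i) * prod_list (map df ?bs))
      + (- 1) ^ (n * i) * (kappa_form (prod_list (map df ?bs)) - (- 1) ^ n * prod_list (map df (c # cs)))
    = (kappa_form ^^ Suc i) (prod_list (map df bs)) - (- 1) ^ (n * Suc i) * prod_list (map df ((rotr ^^ Suc i) bs))"
    by (simp only: form_act_diff right_diff_distrib funpow.simps(2) o_apply) simp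
  with falg.subspace_add[OF subspace_ideal 1 subspace_sign[OF subspace_ideal 2, of "n * i"]] show ?case
    by (simp only:)
qed

lemma B_tsygan_form:
  "tsygan_form p q (B_form x) - (case p of 0 \<Rightarrow> 0 | Suc p' \<Rightarrow> dt_form (tsygan_form p' q x)) \<in> DR_null \<iota>"
proof (rule forms_agree[OF _ _ subspace_DR_null])
  show "lmap (\<lambda>x. tsygan_form p q (B_form x))"
    by (rule lmap_compose[OF lmap_form_act lmap_form_act])
  show "lmap (\<lambda>x. case p of 0 \<Rightarrow> 0 | Suc p' \<Rightarrow> dt_form (tsygan_form p' q x))"
    by (cases p) (simp_all add: lmap_0 lmap_compose[OF lmap_dt_form lmap_form_act])
  show "tsygan_form p q (B_form x) \<in> DR_null \<iota>" if "x \<in> ideal" for x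
    by (rule ideal_t_DR_null[OF tsygan_form_ideal[OF form_act_ideal[OF subspace_ideal cochain_B that]]])
  show "(case p of 0 \<Rightarrow> 0 | Suc p' \<Rightarrow> dt_form (tsygan_form p' q x)) \<in> DR_null \<iota>" if "x \<in> ideal" for x
    using ideal_t_DR_null[OF dt_form_ideal[OF tsygan_form_ideal[OF that]]]
    by (cases p) (simp_all add: falg.subspace_0 subspace_DR_null)
  fix a0 :: 'a and as :: "'a list"
  let ?x = "el a0 * prod_list (map df as) :: ('a gen, 'k) falg" and ?n = "length as" and ?bs = "a0 # as"
  let ?r = "\<lambda>i. (- 1) ^ (?n * i) * prod_list (map df ((rotr ^^ i) ?bs)) :: ('a gen, 'k) falg"
  have len: "length ?bs = Suc ?n" by simp
  have r: "?r i \<in> homog gdeg (Suc ?n)" for i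
    using df_prod_homog[of "(rotr ^^ i) ?bs"] by (intro subspace_sign subspace_homog) (simp add: length_rotr_funpow[OF len])
  have B: "B_form ?x - (\<Sum>i\<le>?n. ?r i) \<in> ideal"
  proof -
    have "B_last ?n ?x - (\<Sum>i\<le>?n. ?r i) \<in> ideal"
      unfolding B_last_def d_form_nform by (rule subspace_sum_diff[OF subspace_ideal kappa_df_prod[OF len]])
    from falg.subspace_add[OF subspace_ideal B_form_homog[OF nform_homog[of a0 as]] this] show ?thesis by simp
  qed
  have 1: "tsygan_form p q (B_form ?x) - (\<Sum>i\<le>?n. tsygan_form p q (?r i)) \<in> DR_null \<iota>"
    using ideal_t_DR_null[OF tsygan_form_ideal[OF B]] by (simp add: form_act_diff lmap_sum[OF lmap_form_act])
  show "tsygan_form p q (B_form ?x) - (case p of 0 \<Rightarrow> 0 | Suc p' \<Rightarrow> dt_form (tsygan_form p' q ?x)) \<in> DR_null \<iota>"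
  proof (cases "p = Suc ?n")
    case False
    have "(case p of 0 \<Rightarrow> 0 | Suc p' \<Rightarrow> dt_form (tsygan_form p' q ?x)) = 0"
      using False tsygan_form_homog_eq_0[OF nform_homog] by (cases p) (simp_all add: lmap_zero[OF lmap_dt_form])
    moreover have "(\<Sum>i\<le>?n. tsygan_form p q (?r i)) = 0"
      using tsygan_form_homog_eq_0[OF r False] by simp
    ultimately show ?thesis using 1 by simp
  next
    case True
    let ?c = "\<rho> (1 / fact (q + Suc ?n))"
    \<comment> \<open>After \<open>i\<close> rotations the weight sits on the last exponent, which
      is exponent \<open>n - i\<close> of the original list. The sign from kappa cancels the one
      from rotating back, so the weights add up without signs.\<close>
    have "tsygan_form p q (?r i) - scl ?c (weighted_sum (?n - i) q ?bs) \<in> DR_null \<iota>" if i: "i \<in> {..?n}" for i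
    proof -
      let ?rb = "(rotr ^^ i) ?bs" and ?s = "(- 1) ^ (?n * i) :: ('a tgen, 'k) falg"
      have a: "tsygan_form p q (?r i) - scl ?c (T q (?r i)) \<in> DR_null \<iota>"
        using ideal_t_DR_null[OF tsygan_form_eq_T[OF r]] True by simp
      have b: "scl ?c (?s * (T q (prod_list (map df ?rb)) - weighted_sum ?n q ?rb)) \<in> DR_null \<iota>"
        by (intro falg.subspace_scale subspace_sign subspace_DR_null T_df_prod length_rotr_funpow len)
      have c: "scl ?c (weighted_sum (?n - i) q ?bs - ?s * weighted_sum ?n q ?rb) \<in> DR_null \<iota>"
        using weighted_sum_rotr[OF len, of "?n - i" i q] i
        by (intro falg.subspace_scale subspace_DR_null) simp
      have "T q (?r i) = ?s * T q (prod_list (map df ?rb))"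
        by (simp only: form_act_scl flip: scl_minus_one_power)
      then have "tsygan_form p q (?r i) - scl ?c (weighted_sum (?n - i) q ?bs) =
          (tsygan_form p q (?r i) - scl ?c (T q (?r i)))
          + scl ?c (?s * (T q (prod_list (map df ?rb)) - weighted_sum ?n q ?rb))
          - scl ?c (weighted_sum (?n - i) q ?bs - ?s * weighted_sum ?n q ?rb)"
        by (simp only: right_diff_distrib falg.scale_right_diff_distrib) simp
      with falg.subspace_diff[OF subspace_DR_null falg.subspace_add[OF subspace_DR_null a b] c] show ?thesis
        by (simp only:)
    qed
    then have 2: "(\<Sum>i\<le>?n. tsygan_form p q (?r i)) - (\<Sum>i\<le>?n. scl ?c (weighted_sum (?n - i) q ?bs)) \<in> DR_null \<iota>"
      by (rule subspace_sum_diff[OF subspace_DR_null])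
    have "(\<Sum>i\<le>?n. scl ?c (weighted_sum (?n - i) q ?bs)) = scl ?c (\<Sum>j\<le>?n. weighted_sum j q ?bs)"
      unfolding falg.scale_sum_right[symmetric]
      by (intro arg_cong[where f = "scl _"] sum.reindex_bij_witness[where i = "\<lambda>j. ?n - j" and j = "\<lambda>j. ?n - j"]) auto
    \<comment> \<open>B raises the degree to \<open>n + 1\<close>, so \<open>?c\<close> has
      denominator \<open>(q + n + 1)!\<close>; the total weight \<open>q + n + 1\<close> lowers it
      to the normalization in degree \<open>n\<close>.\<close>
    also have "\<dots> = scl (\<rho> (1 / fact (q + ?n))) (cyclic_sum q ?bs)"
      unfolding sum_weighted_sum[OF len] add_Suc_right by (rule scl_fact_Suc)
    also have "\<dots> = dt_form (tsygan_cochain ?n q a0 as)"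
      by (simp add: tsygan_cochain_def lmap_scl[OF lmap_dt_form] dt_tsygan_sum)
    finally have 3: "(\<Sum>i\<le>?n. scl ?c (weighted_sum (?n - i) q ?bs)) = dt_form (tsygan_cochain ?n q a0 as)" .
    have 4: "dt_form (tsygan_form ?n q ?x - tsygan_cochain ?n q a0 as) \<in> DR_null \<iota>"
      by (rule ideal_t_DR_null[OF dt_form_ideal[OF tsygan_form_nform]])
    from falg.subspace_diff[OF subspace_DR_null falg.subspace_add[OF subspace_DR_null 1 2] 4] show ?thesis
      unfolding 3 by (simp add: True lmap_diff[OF lmap_dt_form])
  qed
qed

section \<open>The identities on the reduced quotients\<close>

lemma Omega_barE:
  assumes "\<omega> \<in> Omega_bar \<iota>"
  obtains x where "\<omega> = x +o Omega_null \<iota>"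
  using assms by (auto simp: Omega_bar_def quo_def)

lemma ddt_hat_tsygan: "\<omega> \<in> Omega_bar \<iota> \<Longrightarrow> ddt_hat \<iota> (tsygan \<rho> \<iota> \<omega>) = tsygan \<rho> \<iota> \<omega>"
proof (elim Omega_barE, intro ext)
  fix x p q assume \<omega>: "\<omega> = x +o Omega_null \<iota>"
  have "ddt_hat \<iota> (tsygan \<rho> \<iota> \<omega>) p q = ddt_form (tsygan_form p (Suc q) x) +o DR_null \<iota>"
    by (simp add: \<omega> ddt_hat_def tsygan_coset
      qmap_coset[OF lmap_ddt_form subspace_DR_null subspace_DR_null ddt_form_DR_null])
  then show "ddt_hat \<iota> (tsygan \<rho> \<iota> \<omega>) p q = tsygan \<rho> \<iota> \<omega> p q"
    using ideal_t_DR_null[OF ddt_tsygan_form[of p q x]]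
    by (simp add: \<omega> tsygan_coset coset_eq_iff[OF subspace_DR_null])
qed

lemma tsygan_B: "\<omega> \<in> Omega_bar \<iota> \<Longrightarrow> tsygan \<rho> \<iota> (B_bar \<iota> \<omega>) = d_hat \<iota> (tsygan \<rho> \<iota> \<omega>)"
proof (elim Omega_barE, intro ext)
  fix x p q assume \<omega>: "\<omega> = x +o Omega_null \<iota>"
  have "d_hat \<iota> (tsygan \<rho> \<iota> \<omega>) p q = (case p of 0 \<Rightarrow> 0 | Suc p' \<Rightarrow> dt_form (tsygan_form p' q x)) +o DR_null \<iota>"
    by (cases p) (simp_all add: \<omega> d_hat_def tsygan_coset
      qmap_coset[OF lmap_dt_form subspace_DR_null subspace_DR_null dt_form_DR_null])
  then show "tsygan \<rho> \<iota> (B_bar \<iota> \<omega>) p q = d_hat \<iota> (tsygan \<rho> \<iota> \<omega>) p q"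
    using B_tsygan_form[of p q x] by (simp add: \<omega> B_bar_coset tsygan_coset coset_eq_iff[OF subspace_DR_null])
qed

lemma tsygan_b: "\<omega> \<in> Omega_bar \<iota> \<Longrightarrow> tsygan \<rho> \<iota> (b_bar \<iota> \<omega>) = it_hat \<iota> (tsygan \<rho> \<iota> \<omega>)"
proof (elim Omega_barE, intro ext)
  fix x p q assume \<omega>: "\<omega> = x +o Omega_null \<iota>"
  have "it_hat \<iota> (tsygan \<rho> \<iota> \<omega>) p q = (case q of 0 \<Rightarrow> 0 | Suc q' \<Rightarrow> it_form (tsygan_form (Suc p) q' x)) +o DR_null \<iota>"
    by (cases q) (simp_all add: \<omega> it_hat_def tsygan_coset
      qmap_coset[OF lmap_it_form subspace_DR_null subspace_DR_null it_form_DR_null])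
  then show "tsygan \<rho> \<iota> (b_bar \<iota> \<omega>) p q = it_hat \<iota> (tsygan \<rho> \<iota> \<omega>) p q"
    using b_tsygan_form[of p q x] by (simp add: \<omega> b_bar_coset tsygan_coset coset_eq_iff[OF subspace_DR_null])
qed

end

theorem theorem5p3p3:
  fixes \<rho> :: "rat \<Rightarrow> 'k::comm_ring_1" and \<iota> :: "'k \<Rightarrow> 'a::ring_1"
  assumes "split_algebra \<rho> \<iota>"
  shows "(\<forall>\<omega>\<in>Omega_bar \<iota>. ddt_hat \<iota> (tsygan \<rho> \<iota> \<omega>) = tsygan \<rho> \<iota> \<omega>) \<and>
    (\<forall>\<omega>\<in>Omega_bar \<iota>. tsygan \<rho> \<iota> (B_bar \<iota> \<omega>) = d_hat \<iota> (tsygan \<rho> \<iota> \<omega>)) \<and>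
    (\<forall>\<omega>\<in>Omega_bar \<iota>. tsygan \<rho> \<iota> (b_bar \<iota> \<omega>) = it_hat \<iota> (tsygan \<rho> \<iota> \<omega>))"
proof -
  interpret split_algebra \<rho> \<iota> by (rule assms)
  show ?thesis
    by (intro conjI ballI ddt_hat_tsygan tsygan_B tsygan_b)
qed

end
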